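(* Let $P=(P(i,j))_{(i,j)\in\mathbb{N}^2}$ be an irreducible and aperiodic Markov kernel on $\mathbb{N}$ with a unique invariant probability measure $\pi=(\pi(i))_{i\in\mathbb{N}}$, and suppose that there exist $i_0\in\mathbb{N}$ and $N\in\mathbb{N}$, $N\ge 1$, such that for all $i\ge i_0$ and all $j\in\mathbb{N}$, $|i-j|>N$ implies $P(i,j)=0$. Assume moreover that: (i) for every $m=-N,\ldots,N$, $P(i,i+m)\to a_m\in[0,1]$ as $i\to+\infty$; (ii) $\pi(i+1)/\pi(i)\to\tau\in[0,1)$ as $i\to+\infty$; (iii) $\sum_{k=-N}^{N}k\,a_k<0$. Let $V:=(\pi(n)^{-1/2})_{n\in\mathbb{N}}$, and let $\alpha_0:=\sum_{m=-N}^{N}a_m\,\tau^{-m/2}$ if $\tau\in(0,1)$ and $\alpha_0:=a_0$ if $\tau=0$. Then: (a) $\varrho_2\le\alpha_0\iff\varrho_V\le\alpha_0$, and in this case $\limsup_k\rho_k\le\alpha_0$; (b) $\varrho_2>\alpha_0\iff\varrho_V>\alpha_0$, and in this case $\varrho_2=\varrho_V=\lim_k\rho_k$.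
   Context: $\mathbb{N}=\{0,1,2,\ldots\}$. $\ell^2(\pi)$ is the Hilbert space of complex sequences $f=(f(i))_{i\in\mathbb{N}}$ with $\|f\|_2:=\big(\sum_{i\ge0}|f(i)|^2\pi(i)\big)^{1/2}<\infty$. $\mathcal{B}_V$ is the Banach space of complex sequences $g=(g(n))_{n\in\mathbb{N}}$ with $\|g\|_V:=\sup_nV(n)^{-1}|g(n)|<\infty$. $P$ acts by $(Pf)(i)=\sum_jP(i,j)f(j)$. $\Pi f:=\pi(f)1_{\mathbb{N}}$, where $\pi(f):=\sum_{i\ge0}f(i)\pi(i)$ and $1_{\mathbb{N}}$ is the constant sequence $1$. $\varrho_2$ is the infimum of the $\rho\in(0,1)$ for which there exists $C\in(0,+\infty)$ such that $\|P^nf-\Pi f\|_2\le C\rho^n\|f\|_2$ for all $n\ge1$ and $f\in\ell^2(\pi)$. $\varrho_V$ is the infimum of the $\rho\in(0,1)$ for which there exists $C\in(0,+\infty)$ such that $\|P^nf-\Pi f\|_V\le C\rho^n\|f\|_V$ for all $n\ge1$ and $f\in\mathcal{B}_V$. For $k\ge1$, $P_k$ is the $k$-th truncated matrix of $P$ augmented on the last column, i.e. the stochastic matrix on $\{0,\ldots,k\}$ given, for $0\le i\le k$, by $P_k(i,j)=P(i,j)$ if $0\le j\le k-1$ and $P_k(i,k)=\sum_{j\ge k}P(i,j)$. With $\sigma(P_k)$ the set of (complex) eigenvalues of $P_k$, $\rho_k:=\max\{|\lambda| : \lambda\in\sigma(P_k),\ |\lambda|<1\}$ (with value $0$ if this set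 is empty). *)

theory Defs
  imports
    "HOL-Library.Extended_Real"
    "Jordan_Normal_Form.Spectral_Radius"
begin

definition markov_kernel :: "(nat \<Rightarrow> nat \<Rightarrow> real) \<Rightarrow> bool" where
  "markov_kernel P \<longleftrightarrow> (\<forall>i j. 0 \<le> P i j) \<and> (\<forall>i. (\<lambda>j. P i j) sums 1)"

fun kernel_power :: "(nat \<Rightarrow> nat \<Rightarrow> real) \<Rightarrow> nat \<Rightarrow> nat \<Rightarrow> nat \<Rightarrow> real" where
  "kernel_power P 0 i j = (if i = j then 1 else 0)"
| "kernel_power P (Suc n) i j = (\<Sum>l. P i l * kernel_power P n l j)"

definition irreducible_kernel :: "(nat \<Rightarrow> nat \<Rightarrow> real) \<Rightarrow> bool" where
  "irreducible_kernel P \<longleftrightarrow> (\<forall>i j. \<exists>n. 0 < kernel_power P n i j)"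

definition aperiodic_kernel :: "(nat \<Rightarrow> nat \<Rightarrow> real) \<Rightarrow> bool" where
  "aperiodic_kernel P \<longleftrightarrow> (\<forall>i. Gcd {n. 1 \<le> n \<and> 0 < kernel_power P n i i} = 1)"

definition invariant_probability :: "(nat \<Rightarrow> nat \<Rightarrow> real) \<Rightarrow> (nat \<Rightarrow> real) \<Rightarrow> bool" where
  "invariant_probability P \<pi> \<longleftrightarrow>
     (\<forall>i. 0 \<le> \<pi> i) \<and> \<pi> sums 1 \<and> (\<forall>j. (\<lambda>i. \<pi> i * P i j) sums \<pi> j)"

definition kernel_op :: "(nat \<Rightarrow> nat \<Rightarrow> real) \<Rightarrow> (nat \<Rightarrow> complex) \<Rightarrow> nat \<Rightarrow> complex" where
  "kernel_op P f = (\<lambda>i. \<Sum>j. complex_of_real (P i j) * f j)"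

definition mean_op :: "(nat \<Rightarrow> real) \<Rightarrow> (nat \<Rightarrow> complex) \<Rightarrow> nat \<Rightarrow> complex" where
  "mean_op \<pi> f = (\<lambda>_. \<Sum>i. f i * complex_of_real (\<pi> i))"

definition ell2_space :: "(nat \<Rightarrow> real) \<Rightarrow> (nat \<Rightarrow> complex) set" where
  "ell2_space \<pi> = {f. summable (\<lambda>i. (cmod (f i))\<^sup>2 * \<pi> i)}"

definition ell2_norm :: "(nat \<Rightarrow> real) \<Rightarrow> (nat \<Rightarrow> complex) \<Rightarrow> real" where
  "ell2_norm \<pi> f = sqrt (\<Sum>i. (cmod (f i))\<^sup>2 * \<pi> i)"

definition weighted_space :: "(nat \<Rightarrow> real) \<Rightarrow> (nat \<Rightarrow> complex) set" where
  "weighted_space V = {g. bdd_above (range (\<lambda>n. inverse (V n) * cmod (g n)))}"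

definition weighted_norm :: "(nat \<Rightarrow> real) \<Rightarrow> (nat \<Rightarrow> complex) \<Rightarrow> real" where
  "weighted_norm V g = (SUP n. inverse (V n) * cmod (g n))"

text \<open>
  The infimum is taken in the extended reals, so that it is \<open>\<infinity>\<close> if no rate is admissible.
  The norms above are meaningful only on the corresponding spaces; membership of
  \<open>P\<^sup>n f - \<Pi> f\<close> in the space expresses that its norm is finite.
\<close>

definition convergence_rate ::
  "(nat \<Rightarrow> nat \<Rightarrow> real) \<Rightarrow> (nat \<Rightarrow> real) \<Rightarrow> (nat \<Rightarrow> complex) set \<Rightarrow>
   ((nat \<Rightarrow> complex) \<Rightarrow> real) \<Rightarrow> ereal" where
  "convergence_rate P \<pi> X nrm = Inf (ereal ` {\<rho>. 0 < \<rho> \<and> \<rho> < 1 \<and>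
     (\<exists>C>0. \<forall>n\<ge>1. \<forall>f\<in>X.
        (\<lambda>i. (kernel_op P ^^ n) f i - mean_op \<pi> f i) \<in> X \<and>
        nrm (\<lambda>i. (kernel_op P ^^ n) f i - mean_op \<pi> f i) \<le> C * \<rho> ^ n * nrm f)})"

definition rate_ell2 :: "(nat \<Rightarrow> nat \<Rightarrow> real) \<Rightarrow> (nat \<Rightarrow> real) \<Rightarrow> ereal" where
  "rate_ell2 P \<pi> = convergence_rate P \<pi> (ell2_space \<pi>) (ell2_norm \<pi>)"

definition rate_weighted ::
  "(nat \<Rightarrow> nat \<Rightarrow> real) \<Rightarrow> (nat \<Rightarrow> real) \<Rightarrow> (nat \<Rightarrow> real) \<Rightarrow> ereal" where
  "rate_weighted P \<pi> V = convergence_rate P \<pi> (weighted_space V) (weighted_norm V)"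

definition truncated_kernel :: "(nat \<Rightarrow> nat \<Rightarrow> real) \<Rightarrow> nat \<Rightarrow> complex mat" where
  "truncated_kernel P k = mat (k + 1) (k + 1)
     (\<lambda>(i, j). complex_of_real (if j < k then P i j else (\<Sum>l. P i (k + l))))"

definition second_modulus :: "(nat \<Rightarrow> nat \<Rightarrow> real) \<Rightarrow> nat \<Rightarrow> real" where
  "second_modulus P k =
     (let S = {cmod z |z. z \<in> spectrum (truncated_kernel P k) \<and> cmod z < 1}
      in if S = {} then 0 else Max S)"

definition alpha0 :: "nat \<Rightarrow> (int \<Rightarrow> real) \<Rightarrow> real \<Rightarrow> real" where
  "alpha0 N a \<tau> =
     (if \<tau> = 0 then a 0 else (\<Sum>m = - int N..int N. a m * \<tau> powr (- real_of_int m / 2)))"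

end

theory Submission
  imports Defs "HOL-Complex_Analysis.Great_Picard"
begin

text \<open>
  Put \<open>q = sqrt \<pi>\<close>.  Multiplication by \<open>q\<close> carries \<open>\<ell>\<^sup>2(\<pi>)\<close> to \<open>\<ell>\<^sup>2\<close> and the weighted supremum space to
  the bounded sequences, and it turns \<open>P - \<Pi>\<close> into the real matrix
  \<open>M(i,j) = q(i) (P(i,j) - \<pi>(j)) / q(j)\<close>; the distance to equilibrium at time \<open>n \<ge> 1\<close> becomes
  \<open>M ^ n\<close> (\<open>pow_M_eq\<close>).  Along the diagonal \<open>j - i = m\<close> the entries of \<open>M\<close> converge to
  \<open>a(m) \<tau> powr (- m / 2)\<close> if \<open>\<tau> > 0\<close>; if \<open>\<tau> = 0\<close>, they converge to \<open>a(0)\<close> for \<open>m = 0\<close> and to \<open>0\<close>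
  otherwise.  In both cases the limits add up to \<open>\<alpha>\<^sub>0\<close>.  So for every \<open>r > \<alpha>\<^sub>0\<close> there is an \<open>n0\<close> such that the rows with index at
  least \<open>n0\<close> form an operator of norm at most \<open>r\<close> on \<open>\<ell>\<^sup>\<infinity>\<close> (row sums) and on \<open>\<ell>\<^sup>2\<close> (Schur test, row and
  column sums), and \<open>M\<close> is this contraction plus an operator of finite rank, on both spaces at once
  (\<open>tail_contraction_M\<close>).

  \<^emph>\<open>The two rates.\<close>  Fix \<open>\<rho>\<close> with \<open>r < \<rho> < 1\<close>.  The powers \<open>M ^ n\<close> are of order \<open>\<rho> ^ n\<close> in norm as soon as
  the finitely many corner entries \<open>M ^ n (i,j)\<close>, \<open>i, j < n0\<close>, are of that order
  (\<open>corner_bound_imp_norm_bound\<close>, \<open>pow_ell2_bound\<close>).  The corner entries do not know the space, so above the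
  threshold \<open>\<alpha>\<^sub>0\<close> the admissible rates of the two spaces coincide (\<open>admissible_iff\<close>).

  \<^emph>\<open>Eigenvalues.\<close>  The generating function \<open>H(w) = \<Sum>n. w ^ n M ^ n\<close> of the corner satisfies a renewal equation
  \<open>H(w) G(w) = I\<close>, where \<open>G\<close> is a matrix of size \<open>n0\<close>, holomorphic for \<open>|w| < 1 / r\<close>.  A zero of \<open>det G\<close>
  yields an eigenvector of \<open>M\<close> with eigenvalue \<open>1 / w\<close> (\<open>corner_det_zero_imp_eigenvector\<close>); where \<open>det G\<close> has no zero,
  \<open>H = adj G / det G\<close> is holomorphic and Cauchy's estimate bounds the corner entries
  (\<open>corner_bound_of_det_nonzero\<close>).  Irreducibility and aperiodicity exclude eigenvalues of \<open>M\<close> of modulus at least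
  \<open>1\<close>, and the drift condition gives \<open>\<alpha>\<^sub>0 < 1\<close>; hence some rate below \<open>1\<close> is admissible.

  \<^emph>\<open>Truncations.\<close>  Up to the eigenvalue \<open>1\<close> of the constants, the nonzero eigenvalues of \<open>P\<^sub>k\<close> are those of a truncation
  \<open>M\<^sub>k\<close> of \<open>M\<close>.  Since \<open>q\<close> is eventually decreasing, lumping the columns beyond \<open>k\<close> does not increase row
  sums, so \<open>M\<^sub>k\<close> obeys the bounds of \<open>M\<close> with the same \<open>n0\<close> and \<open>r\<close>, and its rows converge in \<open>\<ell>\<^sup>1\<close> to those
  of \<open>M\<close> (\<open>truncation_limit\<close>).  If \<open>\<rho>\<close> is admissible, the corner bound passes to \<open>M\<^sub>k\<close> up to any fixed time,
  which confines the eigenvalues of \<open>M\<^sub>k\<close> (\<open>eigenvalues_eventually_small\<close>).  If conversely infinitely many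
  \<open>P\<^sub>k\<close> have no eigenvalue of modulus in \<open>(\<rho>, 1)\<close>, then \<open>det G\<^sub>k \<longlonglongrightarrow> det G\<close> locally uniformly, and Hurwitz'
  theorem shows that \<open>det G\<close> has no zero for \<open>|w| < 1 / \<rho>\<close>
  (\<open>frequently_second_modulus_le_imp_admissible\<close>).
\<close>

section \<open>Infinite matrices acting on bounded sequences\<close>

definition row_norm :: "(nat \<Rightarrow> nat \<Rightarrow> real) \<Rightarrow> nat \<Rightarrow> real" where
  "row_norm M i = (\<Sum>j. \<bar>M i j\<bar>)"

definition tail_rows :: "nat \<Rightarrow> (nat \<Rightarrow> nat \<Rightarrow> real) \<Rightarrow> nat \<Rightarrow> nat \<Rightarrow> real" where
  "tail_rows n M i j = (if i < n then 0 else M i j)"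

definition unit_seq :: "nat \<Rightarrow> nat \<Rightarrow> complex" where
  "unit_seq j = (\<lambda>i. if i = j then 1 else 0)"

lemma cmod_unit_seq_le: "cmod (unit_seq j i) \<le> 1"
  by (simp add: unit_seq_def)

lemma Bseq_unit_seq [simp]: "Bseq (unit_seq j)"
  by (rule BseqI[of 1]) (auto simp: cmod_unit_seq_le)

lemma sum_unit_seq: "(\<Sum>l<n. a l * unit_seq l i) = (if i < n then a i else 0)"
proof -
  have "(\<Sum>l<n. a l * unit_seq l i) = (\<Sum>l<n. if i = l then a l else 0)"
    by (rule sum.cong) (auto simp: unit_seq_def)
  then show ?thesis by simp
qed

lemma kernel_op_term_summable:
  assumes "summable (\<lambda>j. \<bar>M i j\<bar>)" and "\<And>j. cmod (y j) \<le> c"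
  shows "summable (\<lambda>j. cmod (complex_of_real (M i j) * y j))"
proof (rule summable_comparison_test')
  show "summable (\<lambda>j. \<bar>M i j\<bar> * c)" using assms(1) by (rule summable_mult2)
  show "norm (cmod (complex_of_real (M i n) * y n)) \<le> \<bar>M i n\<bar> * c" for n
    using mult_left_mono[OF assms(2)[of n], of "\<bar>M i n\<bar>"] by (simp add: norm_mult)
qed

lemma cmod_kernel_op_le:
  assumes "summable (\<lambda>j. \<bar>M i j\<bar>)" and "\<And>j. cmod (y j) \<le> c"
  shows "cmod (kernel_op M y i) \<le> row_norm M i * c"
proof -
  have "cmod (kernel_op M y i) \<le> (\<Sum>j. cmod (complex_of_real (M i j) * y j))"
    unfolding kernel_op_def by (rule summable_norm[OF kernel_op_term_summable[where M=M and i=i, OF assms]])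
  also have "\<dots> \<le> (\<Sum>j. \<bar>M i j\<bar> * c)"
    using mult_left_mono[OF assms(2), of "\<bar>M i _\<bar>"]
    by (intro suminf_le kernel_op_term_summable[where M=M and i=i, OF assms] summable_mult2 assms(1))
      (simp add: norm_mult)
  also have "\<dots> = row_norm M i * c"
    unfolding row_norm_def using assms(1) by (rule suminf_mult2[symmetric])
  finally show ?thesis .
qed

lemma kernel_op_linear:
  assumes "summable (\<lambda>j. \<bar>M i j\<bar>)" and "Bseq y" and "Bseq z"
  shows "kernel_op M (\<lambda>j. a * y j + z j) i = a * kernel_op M y i + kernel_op M z i"
proof -
  obtain c d where cd: "\<And>j. cmod (y j) \<le> c" "\<And>j. cmod (z j) \<le> d"
    using assms(2,3) by (auto simp: Bseq_def)
  have s: "summable (\<lambda>j. complex_of_real (M i j) * y j)" "summable (\<lambda>j. complex_of_real (M i j) * z j)"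
    by (rule summable_norm_cancel, rule kernel_op_term_summable[where M=M and i=i, OF assms(1)], rule cd)+
  have "(\<lambda>j. a * (complex_of_real (M i j) * y j) + complex_of_real (M i j) * z j)
          sums (a * kernel_op M y i + kernel_op M z i)"
    unfolding kernel_op_def using s by (intro sums_add sums_mult summable_sums)
  then show ?thesis
    unfolding kernel_op_def by (simp add: sums_iff algebra_simps)
qed

lemma Bseq_add_mult:
  assumes "Bseq y" and "Bseq z" shows "Bseq (\<lambda>j. (a::complex) * y j + z j)"
proof -
  obtain c d where "\<And>j. cmod (y j) \<le> c" "\<And>j. cmod (z j) \<le> d"
    using assms by (auto simp: Bseq_def)
  then show ?thesis
    by (intro BseqI'[of _ "cmod a * c + d"])
      (auto simp: norm_mult intro!: order_trans[OF norm_triangle_ineq] add_mono mult_left_mono)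
qed

text \<open>
  The rows may change with \<open>k\<close> without a common summable majorant, as the mass that a truncation lumps
  into one column does; \<open>\<ell>\<^sup>1\<close> convergence of the rows takes the place of dominated convergence.
\<close>

lemma kernel_op_tendsto:
  fixes M :: "nat \<Rightarrow> nat \<Rightarrow> real" and Mk :: "nat \<Rightarrow> nat \<Rightarrow> nat \<Rightarrow> real"
  assumes sM: "summable (\<lambda>j. \<bar>M i j\<bar>)" and sMk: "\<And>k. summable (\<lambda>j. \<bar>Mk k i j\<bar>)"
    and diff: "(\<lambda>k. row_norm (\<lambda>i j. Mk k i j - M i j) i) \<longlonglongrightarrow> 0"
    and bound: "\<And>k j. cmod (y k j) \<le> c"
    and lim: "\<And>j. (\<lambda>k. y k j) \<longlonglongrightarrow> z j"
  shows "(\<lambda>k. kernel_op (Mk k) (y k) i) \<longlonglongrightarrow> kernel_op M z i"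
proof -
  have 1: "(\<lambda>k. kernel_op M (y k) i) \<longlonglongrightarrow> kernel_op M z i"
    unfolding kernel_op_def
  proof (rule tannerys_theorem[where M = "\<lambda>j. \<bar>M i j\<bar> * c", THEN conjunct2, THEN conjunct2])
    show "(\<lambda>k. complex_of_real (M i j) * y k j) \<longlonglongrightarrow> complex_of_real (M i j) * z j" for j
      by (intro tendsto_mult tendsto_const lim)
    show "\<forall>\<^sub>F (j, k) in sequentially \<times>\<^sub>F sequentially.
        norm (complex_of_real (M i j) * y k j) \<le> \<bar>M i j\<bar> * c"
      using bound by (intro always_eventually) (auto simp: norm_mult intro: mult_left_mono)
  qed (use sM in \<open>auto intro: summable_mult2\<close>)
  have s: "summable (\<lambda>j. \<bar>Mk k i j - M i j\<bar>)" for k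
  proof (rule summable_comparison_test')
    show "summable (\<lambda>j. \<bar>Mk k i j\<bar> + \<bar>M i j\<bar>)" by (intro summable_add sM sMk)
  qed (rule order_trans[OF _ abs_triangle_ineq4], simp)
  have 2: "(\<lambda>k. kernel_op (Mk k) (y k) i - kernel_op M (y k) i) \<longlonglongrightarrow> 0"
  proof (rule Lim_null_comparison)
    show "\<forall>\<^sub>F k in sequentially. norm (kernel_op (Mk k) (y k) i - kernel_op M (y k) i)
        \<le> row_norm (\<lambda>i j. Mk k i j - M i j) i * c"
    proof (rule always_eventually, rule allI)
      fix k
      have "kernel_op (Mk k) (y k) i - kernel_op M (y k) i = kernel_op (\<lambda>i j. Mk k i j - M i j) (y k) i"
        unfolding kernel_op_def
        by (subst suminf_diff)
          (auto simp: left_diff_distrib intro!: summable_norm_cancel[OF kernel_op_term_summable] sM sMk bound)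
      then show "norm (kernel_op (Mk k) (y k) i - kernel_op M (y k) i)
        \<le> row_norm (\<lambda>i j. Mk k i j - M i j) i * c"
        using cmod_kernel_op_le[where M = "\<lambda>i j. Mk k i j - M i j" and i = i and y = "y k" and c = c, OF s bound]
        by simp
    qed
    show "(\<lambda>k. row_norm (\<lambda>i j. Mk k i j - M i j) i * c) \<longlonglongrightarrow> 0"
      using tendsto_mult_left_zero[OF diff] .
  qed
  show ?thesis using tendsto_add[OF 2 1] by simp
qed

lemma suminf_kernel_op:
  assumes sM: "summable (\<lambda>j. \<bar>M i j\<bar>)" and b: "summable b" and v: "\<And>m j. cmod (v m j) \<le> b m"
  shows "(\<lambda>m. kernel_op M (v m) i) sums kernel_op M (\<lambda>j. \<Sum>m. v m j) i"
proof -
  have sv: "summable (\<lambda>m. cmod (v m j))" for j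
    using v by (intro summable_comparison_test'[OF b]) auto
  have b0: "0 \<le> b m" for m using v[of m 0] norm_ge_zero order_trans by blast
  have part: "kernel_op M (\<lambda>j. \<Sum>m<p. v m j) i = (\<Sum>m<p. kernel_op M (v m) i)" for p
  proof (induction p)
    case (Suc p)
    have "cmod (\<Sum>m<p. v m j) \<le> suminf b" for j
      by (rule order_trans[OF sum_norm_le sum_le_suminf[OF b]]) (auto simp: v b0)
    then have "Bseq (\<lambda>j. \<Sum>m<p. v m j)" by (rule BseqI')
    moreover have "Bseq (v p)" using v by (rule BseqI')
    ultimately show ?case
      using kernel_op_linear[where M = M and i = i and y = "v p" and z = "\<lambda>j. \<Sum>m<p. v m j" and a = 1, OF sM]
      by (simp add: Suc.IH algebra_simps)
  qed (simp add: kernel_op_def)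
  have "(\<lambda>p. kernel_op M (\<lambda>j. \<Sum>m<p. v m j) i) \<longlonglongrightarrow> kernel_op M (\<lambda>j. \<Sum>m. v m j) i"
  proof (rule kernel_op_tendsto[where Mk = "\<lambda>_. M" and c = "suminf b"])
    show "cmod (\<Sum>m<p. v m j) \<le> suminf b" for p j
      by (rule order_trans[OF sum_norm_le sum_le_suminf[OF b]]) (auto simp: v b0)
    show "(\<lambda>p. \<Sum>m<p. v m j) \<longlonglongrightarrow> (\<Sum>m. v m j)" for j
      using summable_sums[OF summable_norm_cancel[OF sv]] by (simp add: sums_def)
  qed (auto simp: sM row_norm_def)
  then show ?thesis unfolding part sums_def .
qed

section \<open>Matrices that contract outside finitely many rows\<close>

text \<open>
  Only the first \<open>n0\<close> rows of the matrix prevent it from being a contraction (with constant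
  \<open>r\<close>) of the bounded sequences.  Such an operator is a contraction plus an operator of finite
  rank.
\<close>

locale tail_contraction =
  fixes M :: "nat \<Rightarrow> nat \<Rightarrow> real" and n0 :: nat and r B :: real
  assumes summable_row: "\<And>i. summable (\<lambda>j. \<bar>M i j\<bar>)"
    and row_le: "\<And>i. row_norm M i \<le> B"
    and tail_row_le: "\<And>i. n0 \<le> i \<Longrightarrow> row_norm M i \<le> r"
    and r_pos: "0 < r"
begin

abbreviation "R \<equiv> tail_rows n0 M"

lemma row_norm_nonneg: "0 \<le> row_norm M i"
  unfolding row_norm_def by (rule suminf_nonneg[OF summable_row]) simp

lemma B_nonneg: "0 \<le> B"
  using row_norm_nonneg row_le order_trans by blast

lemma kernel_op_tail: "kernel_op R y i = (if i < n0 then 0 else kernel_op M y i)"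
  by (simp add: kernel_op_def tail_rows_def)

lemma cmod_op_le:
  assumes "\<And>j. cmod (y j) \<le> c" shows "cmod (kernel_op M y i) \<le> B * c"
proof -
  have "0 \<le> c" using assms[of 0] norm_ge_zero order_trans by blast
  moreover have "cmod (kernel_op M y i) \<le> row_norm M i * c"
    by (intro cmod_kernel_op_le summable_row assms)
  ultimately show ?thesis using mult_right_mono[OF row_le[of i], of c] by simp
qed

lemma cmod_tail_le:
  assumes "\<And>j. cmod (y j) \<le> c" shows "cmod (kernel_op R y i) \<le> r * c"
proof -
  have "0 \<le> c" using assms[of 0] norm_ge_zero order_trans by blast
  moreover have "cmod (kernel_op M y i) \<le> row_norm M i * c"
    by (intro cmod_kernel_op_le summable_row assms)
  ultimately show ?thesis
    using mult_right_mono[OF tail_row_le[of i], of c] less_imp_le[OF r_pos] by (auto simp: kernel_op_tail)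
qed

lemma Bseq_op [intro]: assumes "Bseq y" shows "Bseq (kernel_op M y)"
proof -
  obtain c where "\<And>j. cmod (y j) \<le> c" using assms by (auto simp: Bseq_def)
  then show ?thesis by (intro BseqI'[of _ "B * c"] cmod_op_le)
qed

lemma Bseq_tail [intro]: assumes "Bseq y" shows "Bseq (kernel_op R y)"
proof -
  obtain c where "\<And>j. cmod (y j) \<le> c" using assms by (auto simp: Bseq_def)
  then show ?thesis by (intro BseqI'[of _ "r * c"] cmod_tail_le)
qed

lemma Bseq_pow [intro]: "Bseq y \<Longrightarrow> Bseq ((kernel_op M ^^ n) y)"
  by (induction n) auto

lemma cmod_pow_le: "(\<And>j. cmod (y j) \<le> c) \<Longrightarrow> cmod ((kernel_op M ^^ n) y i) \<le> B ^ n * c"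
proof (induction n arbitrary: i)
  case (Suc n)
  have "cmod (kernel_op M ((kernel_op M ^^ n) y) i) \<le> B * (B ^ n * c)"
    using Suc by (intro cmod_op_le) auto
  then show ?case by (simp add: mult.assoc)
qed auto

lemma cmod_tail_pow_le: "(\<And>j. cmod (y j) \<le> c) \<Longrightarrow> cmod ((kernel_op R ^^ n) y i) \<le> r ^ n * c"
proof (induction n arbitrary: i)
  case (Suc n)
  have "cmod (kernel_op R ((kernel_op R ^^ n) y) i) \<le> r * (r ^ n * c)"
    using Suc by (intro cmod_tail_le) auto
  then show ?case by (simp add: mult.assoc)
qed auto

lemma pow_linear:
  assumes "Bseq y" and "Bseq z"
  shows "(kernel_op M ^^ n) (\<lambda>j. a * y j + z j) = (\<lambda>i. a * (kernel_op M ^^ n) y i + (kernel_op M ^^ n) z i)"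
  using assms by (induction n) (auto simp: kernel_op_linear[where M=M, OF summable_row] Bseq_pow)

lemma op_scale: "Bseq y \<Longrightarrow> kernel_op M (\<lambda>j. a * y j) = (\<lambda>i. a * kernel_op M y i)"
  using kernel_op_linear[where M=M and y=y and z="\<lambda>_. 0" and a=a, OF summable_row] by (simp add: kernel_op_def Bfun_const)

lemma pow_scale: "Bseq y \<Longrightarrow> (kernel_op M ^^ n) (\<lambda>j. a * y j) = (\<lambda>i. a * (kernel_op M ^^ n) y i)"
  by (induction n) (auto simp: op_scale Bseq_pow)

lemma pow_add_sum_unit:
  assumes "Bseq z"
  shows "(kernel_op M ^^ n) (\<lambda>i. (\<Sum>l<p. a l * unit_seq l i) + z i) i =
     (\<Sum>l<p. a l * (kernel_op M ^^ n) (unit_seq l) i) + (kernel_op M ^^ n) z i"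
  using assms
proof (induction p arbitrary: z i)
  case (Suc p)
  have "(kernel_op M ^^ n) (\<lambda>i. (\<Sum>l<Suc p. a l * unit_seq l i) + z i) =
    (kernel_op M ^^ n) (\<lambda>i. (\<Sum>l<p. a l * unit_seq l i) + (a p * unit_seq p i + z i))"
    by (simp add: add.assoc)
  moreover have "Bseq (\<lambda>i. a p * unit_seq p i + z i)"
    using Suc.prems by (simp add: Bseq_add_mult)
  ultimately show ?case
    using Suc.IH[of "\<lambda>i. a p * unit_seq p i + z i"] Suc.prems by (simp add: pow_linear)
qed auto

lemma op_split:
  "kernel_op M y = (\<lambda>i. (\<Sum>l<n0. kernel_op M y l * unit_seq l i) + kernel_op R y i)"
  by (auto simp: sum_unit_seq kernel_op_tail)

text \<open>
  The first step of the operator leads either into the corner, from where the orbits of the unit sequences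
  continue, or to a shrunk sequence.
\<close>

lemma pow_Suc_split:
  assumes "Bseq y"
  shows "(kernel_op M ^^ Suc n) y i =
    (\<Sum>l<n0. kernel_op M y l * (kernel_op M ^^ n) (unit_seq l) i) + (kernel_op M ^^ n) (kernel_op R y) i"
proof -
  have "(kernel_op M ^^ Suc n) y i = (kernel_op M ^^ n) (kernel_op M y) i"
    by (simp add: funpow_swap1)
  also have "\<dots> = (kernel_op M ^^ n) (\<lambda>i. (\<Sum>l<n0. kernel_op M y l * unit_seq l i) + kernel_op R y i) i"
    by (subst op_split) (rule refl)
  finally show ?thesis
    using pow_add_sum_unit[OF Bseq_tail[OF assms], of n "\<lambda>l. kernel_op M y l" n0 i] by simp
qed

text \<open>
  The growth of the powers is already visible on the finite corner block.  For the rows below \<open>n0\<close>,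
  one step of the operator splits into an excursion through the corner and a step that shrinks the norm
  by the factor \<open>r < \<rho>\<close>, so the constants form a convergent recursion; the other rows shrink by themselves.
  The constant \<open>D\<close> is independent of the time horizon \<open>p\<close>, which makes the estimate stable under
  approximations that converge only up to each fixed time.
\<close>

lemma corner_bound_imp_norm_bound:
  assumes "r < \<rho>" and "0 \<le> C"
    and corner: "\<And>n i j. n \<le> p \<Longrightarrow> i < n0 \<Longrightarrow> j < n0 \<Longrightarrow>
      cmod ((kernel_op M ^^ n) (unit_seq j) i) \<le> C * \<rho> ^ n"
    and D: "D = max 1 (real n0 * C * B / (\<rho> - r))"
    and "n \<le> p" and f: "\<And>j. cmod (f j) \<le> c"
  shows "cmod ((kernel_op M ^^ n) f i) \<le> D * \<rho> ^ n * c"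
proof -
  have \<rho>: "0 < \<rho>" using assms(1) less_imp_le[OF r_pos] by linarith
  have D1: "1 \<le> D" and D2: "real n0 * C * B \<le> D * (\<rho> - r)"
    using assms(1) by (auto simp: D pos_divide_le_eq[symmetric])
  have upper: "cmod ((kernel_op M ^^ n) f i) \<le> D * \<rho> ^ n * c"
    if "i < n0" "n \<le> p" "\<And>j. cmod (f j) \<le> c" for n f c i
    using that
  proof (induction n arbitrary: f c)
    case 0
    then have "cmod (f i) \<le> 1 * c" "0 \<le> c" using norm_ge_zero order_trans by (auto, blast)
    then show ?case using mult_right_mono[OF D1, of c] by simp
  next
    case (Suc n)
    have c: "0 \<le> c" using Suc.prems(3)[of 0] norm_ge_zero order_trans by blast
    have "Bseq f" using Suc.prems(3) by (rule BseqI')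
    have "cmod ((kernel_op M ^^ Suc n) f i) \<le>
       (\<Sum>l<n0. cmod (kernel_op M f l) * cmod ((kernel_op M ^^ n) (unit_seq l) i))
        + cmod ((kernel_op M ^^ n) (kernel_op R f) i)"
      unfolding pow_Suc_split[OF \<open>Bseq f\<close>]
      by (intro order_trans[OF norm_triangle_ineq] add_right_mono sum_norm_le) (simp add: norm_mult)
    also have "\<dots> \<le> (\<Sum>l<n0. (B * c) * (C * \<rho> ^ n)) + D * \<rho> ^ n * (r * c)"
      using Suc.prems
      by (intro add_mono sum_mono mult_mono Suc.IH corner cmod_op_le cmod_tail_le)
        (auto intro!: mult_nonneg_nonneg B_nonneg c)
    also have "\<dots> = (real n0 * C * B + D * r) * (\<rho> ^ n * c)" by (simp add: algebra_simps)
    also have "\<dots> \<le> (D * \<rho>) * (\<rho> ^ n * c)"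
      using D2 \<rho> c by (intro mult_right_mono) (auto simp: algebra_simps)
    finally show ?case by (simp add: algebra_simps)
  qed
  show ?thesis using \<open>n \<le> p\<close>
  proof (induction n arbitrary: i)
    case 0
    have "cmod (f i) \<le> 1 * c" "0 \<le> c" using f[of i] norm_ge_zero order_trans by (auto, blast)
    then show ?case using mult_right_mono[OF D1, of c] by simp
  next
    case (Suc n)
    show ?case
    proof (cases "i < n0")
      case True then show ?thesis using upper f Suc.prems by blast
    next
      case False
      have IH: "\<And>j. cmod ((kernel_op M ^^ n) f j) \<le> D * \<rho> ^ n * c" using Suc by simp
      have "0 \<le> c" using f[of 0] norm_ge_zero order_trans by blast
      have "cmod (kernel_op R ((kernel_op M ^^ n) f) i) \<le> r * (D * \<rho> ^ n * c)"
        by (intro cmod_tail_le IH)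
      then have "cmod ((kernel_op M ^^ Suc n) f i) \<le> r * (D * \<rho> ^ n * c)"
        using False by (simp add: kernel_op_tail)
      also have "\<dots> \<le> \<rho> * (D * \<rho> ^ n * c)"
        using \<open>0 \<le> c\<close> assms(1) \<rho> D1 by (intro mult_right_mono) auto
      finally show ?thesis by (simp add: algebra_simps)
    qed
  qed
qed

end

context tail_contraction
begin

lemma tail_is_contraction: "tail_contraction (tail_rows n0 M) n0 r B"
proof
  show "summable (\<lambda>j. \<bar>R i j\<bar>)" for i
    using summable_row[of i] by (cases "i < n0") (simp_all add: tail_rows_def)
  show "row_norm R i \<le> B" for i
    using row_le[of i] B_nonneg by (cases "i < n0") (simp_all add: row_norm_def tail_rows_def)
  show "row_norm R i \<le> r" if "n0 \<le> i" for i
    using tail_row_le[OF that] that by (simp add: row_norm_def tail_rows_def)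
qed (rule r_pos)

lemma Bseq_sum:
  assumes "\<And>l. l < (p :: nat) \<Longrightarrow> Bseq (y l)"
  shows "Bseq (\<lambda>j. \<Sum>l<p. (a l :: complex) * y l j)"
  using assms
proof (induction p)
  case (Suc p)
  then have "Bseq (\<lambda>j. a p * y p j + (\<Sum>l<p. a l * y l j))" by (intro Bseq_add_mult) auto
  then show ?case by (simp add: add.commute)
qed (simp add: Bfun_const)

lemma pow_sum:
  assumes "\<And>l. l < (p :: nat) \<Longrightarrow> Bseq (y l)"
  shows "(kernel_op M ^^ n) (\<lambda>j. \<Sum>l<p. a l * y l j) = (\<lambda>i. \<Sum>l<p. a l * (kernel_op M ^^ n) (y l) i)"
  using assms
proof (induction p)
  case 0
  show ?case using pow_scale[of "\<lambda>_. 0" n 0] by (simp add: Bfun_const)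
next
  case (Suc p)
  have "(kernel_op M ^^ n) (\<lambda>j. a p * y p j + (\<Sum>l<p. a l * y l j)) =
      (\<lambda>i. a p * (kernel_op M ^^ n) (y p) i + (kernel_op M ^^ n) (\<lambda>j. \<Sum>l<p. a l * y l j) i)"
    using Suc.prems by (intro pow_linear Bseq_sum) auto
  then show ?case using Suc by (simp add: add.commute)
qed

text \<open>
  Schur's test: row and column sums at most \<open>r\<close> give the norm \<open>r\<close> on \<open>\<ell>\<^sup>2\<close>.
\<close>

lemma tail_ell2:
  assumes col: "\<And>j n. (\<Sum>i<n. \<bar>R i j\<bar>) \<le> r" and sf: "summable (\<lambda>j. (cmod (f j))\<^sup>2)"
  shows "summable (\<lambda>i. (cmod (kernel_op R f i))\<^sup>2)"
    and "(\<Sum>i. (cmod (kernel_op R f i))\<^sup>2) \<le> r\<^sup>2 * (\<Sum>j. (cmod (f j))\<^sup>2)"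
proof -
  interpret tail: tail_contraction "tail_rows n0 M" n0 r B by (rule tail_is_contraction)
  define T where "T = (\<Sum>j. (cmod (f j))\<^sup>2)"
  have fT: "cmod (f j) \<le> sqrt T" for j
    using sum_le_suminf[OF sf, of "{j}"] by (intro real_le_rsqrt) (simp add: T_def)
  have fT2: "(cmod (f j))\<^sup>2 \<le> T" for j
    using sum_le_suminf[OF sf, of "{j}"] by (simp add: T_def)
  have s1: "summable (\<lambda>j. \<bar>R i j\<bar> * cmod (f j))" for i
    using kernel_op_term_summable[where M = R and i = i and y = f, OF tail.summable_row fT] by (simp add: norm_mult)
  have s2: "summable (\<lambda>j. \<bar>R i j\<bar> * (cmod (f j))\<^sup>2)" for i
    by (rule summable_comparison_test'[OF summable_mult2[OF tail.summable_row[of i], of T]])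
      (auto simp: abs_mult intro!: mult_left_mono fT2)
  have row: "(\<Sum>j. \<bar>R i j\<bar>) \<le> r" for i
    using tail_row_le[of i] r_pos by (cases "i < n0") (auto simp: row_norm_def tail_rows_def)
  have pt: "(cmod (kernel_op R f i))\<^sup>2 \<le> r * (\<Sum>j. \<bar>R i j\<bar> * (cmod (f j))\<^sup>2)" for i
  proof -
    have "cmod (kernel_op R f i) \<le> (\<Sum>j. \<bar>R i j\<bar> * cmod (f j))"
      unfolding kernel_op_def using summable_norm[of "\<lambda>j. complex_of_real (R i j) * f j"] s1[of i]
      by (simp add: norm_mult)
    then have "(cmod (kernel_op R f i))\<^sup>2 \<le> (\<Sum>j. \<bar>R i j\<bar> * cmod (f j))\<^sup>2"
      by (rule power_mono) simp
    also have "\<dots> \<le> (\<Sum>j. \<bar>R i j\<bar>) * (\<Sum>j. \<bar>R i j\<bar> * (cmod (f j))\<^sup>2)"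
    proof (rule LIMSEQ_le)
      show "(\<lambda>p. (\<Sum>j<p. \<bar>R i j\<bar> * cmod (f j))\<^sup>2) \<longlonglongrightarrow> (\<Sum>j. \<bar>R i j\<bar> * cmod (f j))\<^sup>2"
        by (intro tendsto_power summable_LIMSEQ s1)
      show "(\<lambda>p. (\<Sum>j<p. \<bar>R i j\<bar>) * (\<Sum>j<p. \<bar>R i j\<bar> * (cmod (f j))\<^sup>2)) \<longlonglongrightarrow>
          (\<Sum>j. \<bar>R i j\<bar>) * (\<Sum>j. \<bar>R i j\<bar> * (cmod (f j))\<^sup>2)"
        by (intro tendsto_mult summable_LIMSEQ s2 tail.summable_row)
      have "(\<Sum>j<p. \<bar>R i j\<bar> * cmod (f j))\<^sup>2 \<le> (\<Sum>j<p. \<bar>R i j\<bar>) * (\<Sum>j<p. \<bar>R i j\<bar> * (cmod (f j))\<^sup>2)" for p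
        using Cauchy_Schwarz_ineq_sum[of "\<lambda>j. sqrt \<bar>R i j\<bar>" "\<lambda>j. sqrt \<bar>R i j\<bar> * cmod (f j)" "{..<p}"]
        by (simp add: power_mult_distrib flip: mult.assoc)
      then show "\<exists>N. \<forall>p\<ge>N. (\<Sum>j<p. \<bar>R i j\<bar> * cmod (f j))\<^sup>2 \<le>
          (\<Sum>j<p. \<bar>R i j\<bar>) * (\<Sum>j<p. \<bar>R i j\<bar> * (cmod (f j))\<^sup>2)" by blast
    qed
    also have "\<dots> \<le> r * (\<Sum>j. \<bar>R i j\<bar> * (cmod (f j))\<^sup>2)"
      by (intro mult_right_mono row suminf_nonneg s2) auto
    finally show ?thesis .
  qed
  have fin: "(\<Sum>i<n. (cmod (kernel_op R f i))\<^sup>2) \<le> r\<^sup>2 * T" for n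
  proof -
    have "(\<Sum>i<n. (cmod (kernel_op R f i))\<^sup>2) \<le> r * (\<Sum>i<n. \<Sum>j. \<bar>R i j\<bar> * (cmod (f j))\<^sup>2)"
      unfolding sum_distrib_left by (intro sum_mono pt)
    also have "(\<Sum>i<n. \<Sum>j. \<bar>R i j\<bar> * (cmod (f j))\<^sup>2) = (\<Sum>j. \<Sum>i<n. \<bar>R i j\<bar> * (cmod (f j))\<^sup>2)"
      by (rule suminf_sum[symmetric]) (rule s2)
    also have "\<dots> \<le> (\<Sum>j. r * (cmod (f j))\<^sup>2)"
      by (intro suminf_le summable_sum s2 summable_mult sf)
        (auto simp flip: sum_distrib_right intro: mult_right_mono col)
    also have "\<dots> = r * T" unfolding T_def by (rule suminf_mult[OF sf])
    finally show ?thesis using r_pos by (simp add: power2_eq_square mult.assoc)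
  qed
  show s: "summable (\<lambda>i. (cmod (kernel_op R f i))\<^sup>2)"
    by (rule summableI_nonneg_bounded[where x = "r\<^sup>2 * T"]) (auto simp: fin)
  show "(\<Sum>i. (cmod (kernel_op R f i))\<^sup>2) \<le> r\<^sup>2 * (\<Sum>j. (cmod (f j))\<^sup>2)"
    unfolding T_def[symmetric] by (rule suminf_le_const[OF s fin])
qed

text \<open>
  A supremum bound upgrades to an \<open>\<ell>\<^sup>2\<close> bound because \<open>M\<close> splits into two parts with disjoint supports: on the
  first \<open>n0\<close> coordinates the supremum bound controls the square sum, and the remaining rows contract \<open>\<ell>\<^sup>2\<close>.
  Disjointness lets the square sums add, and \<open>D2\<close> is chosen so that the recursion preserves the bound.
\<close>

lemma pow_ell2_bound:
  assumes col: "\<And>j n. (\<Sum>i<n. \<bar>R i j\<bar>) \<le> r" and sf: "summable (\<lambda>j. (cmod (f j))\<^sup>2)"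
    and \<rho>: "r < \<rho>" and pow: "\<And>n i. cmod ((kernel_op M ^^ n) f i) \<le> D * \<rho> ^ n * c"
    and c: "c\<^sup>2 \<le> (\<Sum>j. (cmod (f j))\<^sup>2)"
    and D2: "D2 = max 1 (real n0 * D\<^sup>2 * \<rho>\<^sup>2 / (\<rho>\<^sup>2 - r\<^sup>2))"
  shows "summable (\<lambda>i. (cmod ((kernel_op M ^^ n) f i))\<^sup>2) \<and>
    (\<Sum>i. (cmod ((kernel_op M ^^ n) f i))\<^sup>2) \<le> D2 * (\<rho> ^ n)\<^sup>2 * (\<Sum>j. (cmod (f j))\<^sup>2)"
proof (induction n)
  case 0
  have "0 \<le> (\<Sum>j. (cmod (f j))\<^sup>2)" by (intro suminf_nonneg sf) simp
  moreover have "1 \<le> D2" by (simp add: D2)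
  ultimately show ?case using sf mult_right_mono[of 1 D2 "\<Sum>j. (cmod (f j))\<^sup>2"] by simp
next
  case (Suc n)
  define T where "T = (\<Sum>j. (cmod (f j))\<^sup>2)"
  define g where "g = (kernel_op M ^^ n) f"
  have T0: "0 \<le> T" unfolding T_def by (intro suminf_nonneg sf) simp
  have "r\<^sup>2 < \<rho>\<^sup>2" using \<rho> r_pos by (intro power_strict_mono) auto
  then have DD: "real n0 * D\<^sup>2 * \<rho>\<^sup>2 \<le> D2 * (\<rho>\<^sup>2 - r\<^sup>2)"
    by (auto simp: D2 pos_divide_le_eq[symmetric])
  have sg: "summable (\<lambda>j. (cmod (g j))\<^sup>2)" and g: "(\<Sum>j. (cmod (g j))\<^sup>2) \<le> D2 * (\<rho> ^ n)\<^sup>2 * T"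
    using Suc.IH by (auto simp: g_def T_def)
  define e where "e i = (if i \<in> {..<n0} then (cmod (kernel_op M g i))\<^sup>2 else 0)" for i
  have e: "e sums (\<Sum>i<n0. (cmod (kernel_op M g i))\<^sup>2)"
    unfolding e_def by (rule sums_If_finite_set) simp
  have split: "(cmod (kernel_op M g i))\<^sup>2 = e i + (cmod (kernel_op R g i))\<^sup>2" for i
    by (simp add: e_def kernel_op_tail)
  have sums: "(\<lambda>i. (cmod (kernel_op M g i))\<^sup>2) sums
     ((\<Sum>i<n0. (cmod (kernel_op M g i))\<^sup>2) + (\<Sum>i. (cmod (kernel_op R g i))\<^sup>2))"
    unfolding split by (intro sums_add summable_sums tail_ell2(1)[OF col sg]) (use e in \<open>simp add: split[symmetric]\<close>)
  have "(\<Sum>i<n0. (cmod (kernel_op M g i))\<^sup>2) \<le> (\<Sum>i<n0. (D * \<rho> ^ Suc n)\<^sup>2 * T)"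
  proof (rule sum_mono)
    fix i
    have "(cmod (kernel_op M g i))\<^sup>2 \<le> (D * \<rho> ^ Suc n * c)\<^sup>2"
      using pow[of "Suc n" i] by (intro power_mono) (auto simp: g_def)
    also have "\<dots> \<le> (D * \<rho> ^ Suc n)\<^sup>2 * T"
      unfolding power_mult_distrib[of _ c] T_def by (intro mult_left_mono c) simp
    finally show "(cmod (kernel_op M g i))\<^sup>2 \<le> (D * \<rho> ^ Suc n)\<^sup>2 * T" .
  qed
  moreover have "(\<Sum>i. (cmod (kernel_op R g i))\<^sup>2) \<le> r\<^sup>2 * (D2 * (\<rho> ^ n)\<^sup>2 * T)"
    using tail_ell2(2)[OF col sg] mult_left_mono[OF g, of "r\<^sup>2"] by simp
  ultimately have "(\<Sum>i<n0. (cmod (kernel_op M g i))\<^sup>2) + (\<Sum>i. (cmod (kernel_op R g i))\<^sup>2)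
      \<le> (real n0 * D\<^sup>2 * \<rho>\<^sup>2 + r\<^sup>2 * D2) * ((\<rho> ^ n)\<^sup>2 * T)"
    by (simp add: algebra_simps power_mult_distrib)
  also have "\<dots> \<le> (D2 * \<rho>\<^sup>2) * ((\<rho> ^ n)\<^sup>2 * T)"
    using DD T0 by (intro mult_right_mono) (auto simp: algebra_simps)
  also have "\<dots> = D2 * (\<rho> ^ Suc n)\<^sup>2 * T" by (simp add: power_mult_distrib)
  finally show ?case using sums by (auto simp: sums_iff g_def T_def)
qed

end

section \<open>The characteristic determinant of the corner block\<close>

text \<open>
  Expanding a power of the matrix according to its last visit to the first \<open>n0\<close> rows expresses the corner
  entries through one another by a renewal equation; the kernel of this equation collects the paths with
  exactly \<open>m\<close> intermediate states, all of them outside these rows.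
\<close>

definition corner_coeff :: "(nat \<Rightarrow> nat \<Rightarrow> real) \<Rightarrow> nat \<Rightarrow> nat \<Rightarrow> nat \<Rightarrow> nat \<Rightarrow> complex" where
  "corner_coeff M n0 m i j = kernel_op M ((kernel_op (tail_rows n0 M) ^^ m) (unit_seq j)) i"

definition corner_series :: "(nat \<Rightarrow> nat \<Rightarrow> real) \<Rightarrow> nat \<Rightarrow> nat \<Rightarrow> nat \<Rightarrow> complex \<Rightarrow> complex" where
  "corner_series M n0 i j w = (\<Sum>m. corner_coeff M n0 m i j * w ^ m)"

definition corner_mat :: "(nat \<Rightarrow> nat \<Rightarrow> real) \<Rightarrow> nat \<Rightarrow> complex \<Rightarrow> complex mat" where
  "corner_mat M n0 w =
     Matrix.mat n0 n0 (\<lambda>(i, j). (if i = j then 1 else 0) - w * corner_series M n0 i j w)"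

definition corner_det :: "(nat \<Rightarrow> nat \<Rightarrow> real) \<Rightarrow> nat \<Rightarrow> complex \<Rightarrow> complex" where
  "corner_det M n0 w = Determinant.det (corner_mat M n0 w)"

lemma corner_mat_carrier [simp]: "corner_mat M n0 w \<in> carrier_mat n0 n0"
  by (simp add: corner_mat_def)

text \<open>
  Determinants are polynomials in the entries, so they inherit holomorphy and locally uniform convergence.
\<close>

lemma holomorphic_on_det:
  assumes "\<And>w. A w \<in> carrier_mat n n"
    and "\<And>i j. i < n \<Longrightarrow> j < n \<Longrightarrow> (\<lambda>w. A w $$ (i, j)) holomorphic_on S"
  shows "(\<lambda>w. Determinant.det (A w)) holomorphic_on S"
  unfolding det_def'[OF assms(1)]
  by (intro holomorphic_intros assms(2)) (auto simp: permutes_in_image)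

lemma uniform_limit_sum':
  fixes f :: "'a \<Rightarrow> 'i \<Rightarrow> 'b \<Rightarrow> complex"
  assumes "\<And>i. i \<in> I \<Longrightarrow> uniform_limit S (\<lambda>k. f k i) (g i) F"
  shows "uniform_limit S (\<lambda>k w. \<Sum>i\<in>I. f k i w) (\<lambda>w. \<Sum>i\<in>I. g i w) F"
  using assms by (induction I rule: infinite_finite_induct) (auto intro!: uniform_limit_intros)

lemma uniform_limit_prod':
  fixes f :: "'a \<Rightarrow> 'i \<Rightarrow> 'b \<Rightarrow> complex"
  assumes "\<And>i. i \<in> I \<Longrightarrow> uniform_limit S (\<lambda>k. f k i) (g i) F"
    and "\<And>i. i \<in> I \<Longrightarrow> bounded (g i ` S)"
  shows "uniform_limit S (\<lambda>k w. \<Prod>i\<in>I. f k i w) (\<lambda>w. \<Prod>i\<in>I. g i w) F \<and>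
    bounded ((\<lambda>w. \<Prod>i\<in>I. g i w) ` S)"
  using assms
proof (induction I rule: infinite_finite_induct)
  case (insert x I)
  then have IH: "uniform_limit S (\<lambda>k w. \<Prod>i\<in>I. f k i w) (\<lambda>w. \<Prod>i\<in>I. g i w) F"
    "bounded ((\<lambda>w. \<Prod>i\<in>I. g i w) ` S)" by auto
  obtain a b where ab: "\<And>w. w \<in> S \<Longrightarrow> cmod (g x w) \<le> a" "\<And>w. w \<in> S \<Longrightarrow> cmod (\<Prod>i\<in>I. g i w) \<le> b"
    using insert.prems(2)[of x] IH(2) unfolding bounded_iff by auto
  have "bounded ((\<lambda>w. g x w * (\<Prod>i\<in>I. g i w)) ` S)"
    unfolding bounded_iff
  proof (intro exI ballI)
    fix y assume "y \<in> (\<lambda>w. g x w * (\<Prod>i\<in>I. g i w)) ` S"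
    then obtain w where "w \<in> S" "y = g x w * (\<Prod>i\<in>I. g i w)" by auto
    then show "norm y \<le> a * b"
      using ab[of w] order_trans[OF norm_ge_zero ab(1)[of w]] by (auto simp: norm_mult intro!: mult_mono intro: order_trans)
  qed
  moreover have "uniform_limit S (\<lambda>k w. f k x w * (\<Prod>i\<in>I. f k i w)) (\<lambda>w. g x w * (\<Prod>i\<in>I. g i w)) F"
    using insert.prems IH by (intro uniform_lim_mult) auto
  ultimately show ?case using insert.hyps by simp
qed (auto intro!: uniform_limit_intros simp: bounded_iff)

lemma uniform_limit_det:
  fixes A :: "'a \<Rightarrow> complex mat"
  assumes A: "\<And>w. A w \<in> carrier_mat n n" and Ak: "\<And>k w. Ak k w \<in> carrier_mat n n"
    and lim: "\<And>i j. i < n \<Longrightarrow> j < n \<Longrightarrow>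
      uniform_limit S (\<lambda>k w. Ak k w $$ (i, j)) (\<lambda>w. A w $$ (i, j)) F"
    and bd: "\<And>i j. i < n \<Longrightarrow> j < n \<Longrightarrow> bounded ((\<lambda>w. A w $$ (i, j)) ` S)"
  shows "uniform_limit S (\<lambda>k w. Determinant.det (Ak k w)) (\<lambda>w. Determinant.det (A w)) F"
  unfolding det_def'[OF A] det_def'[OF Ak]
proof (rule uniform_limit_sum'[where
      f = "\<lambda>k p w. of_int (sign p) * (\<Prod>i = 0..<n. Ak k w $$ (i, p i))" and
      g = "\<lambda>p w. of_int (sign p) * (\<Prod>i = 0..<n. A w $$ (i, p i))"])
  fix p assume "p \<in> {p. p permutes {0..<n}}"
  then have p: "p i < n" if "i < n" for i
    using that permutes_in_image[of p "{0..<n}" i] by auto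
  note P = uniform_limit_prod'[where I = "{0..<n}" and S = S and F = F and
      f = "\<lambda>k i w. Ak k w $$ (i, p i)" and g = "\<lambda>i w. A w $$ (i, p i)"]
  have "bounded ((\<lambda>w. of_int (sign p) :: complex) ` S)" by (auto simp: bounded_iff)
  then show "uniform_limit S (\<lambda>k w. of_int (sign p) * (\<Prod>i = 0..<n. Ak k w $$ (i, p i)))
        (\<lambda>w. of_int (sign p) * (\<Prod>i = 0..<n. A w $$ (i, p i))) F"
    using P lim bd p by (intro uniform_lim_mult uniform_limit_const) auto
qed

text \<open>The Taylor series of the extension has the same coefficients and converges on the larger disc.\<close>

lemma power_series_coeff_bound:
  fixes h :: "nat \<Rightarrow> complex"
  assumes hol: "\<phi> holomorphic_on ball 0 S" and "0 < s" "s < S" "0 < \<epsilon>"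
    and ser: "\<And>w. cmod w < \<epsilon> \<Longrightarrow> (\<lambda>n. h n * w ^ n) sums \<phi> w"
  shows "\<exists>C\<ge>0. \<forall>n. cmod (h n) \<le> C * (1 / s) ^ n"
proof -
  define t where "t n = (deriv ^^ n) \<phi> 0 / fact n" for n
  have t: "(\<lambda>n. t n * w ^ n) sums \<phi> w" if "cmod w < S" for w
    using holomorphic_power_series[OF hol, of w] that by (simp add: t_def)
  define e where "e = min \<epsilon> S"
  have e: "0 < e" using assms by (auto simp: e_def)
  have z: "(\<lambda>n. (h n - t n) * (w - 0) ^ n) sums 0" if "cmod (w - 0) < e" for w
    using sums_diff[OF ser t, of w w] that by (simp add: e_def algebra_simps)
  have h0: "h 0 - t 0 = 0"
    using z[of 0] e by simp
  have "h n = t n" for n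
  proof (rule ccontr)
    assume ne: "h n \<noteq> t n"
    then have "0 < n" using h0 by (cases n) auto
    show False
    proof (rule powser_0_nonzero[of e 0 "\<lambda>n. h n - t n" "\<lambda>_. 0" n])
      show "0 < e" by (rule e)
      show "(\<lambda>n. (h n - t n) * (x - 0) ^ n) sums 0" if "cmod (x - 0) < e" for x
        using that by (rule z)
      show "h n - t n \<noteq> 0" "0 < n" using ne \<open>0 < n\<close> by auto
    next
      fix s' :: real
      assume "0 < s'" and s': "\<And>w::complex. w \<in> cball 0 s' - {0} \<Longrightarrow> (0::complex) \<noteq> 0"
      have "complex_of_real s' \<in> cball 0 s' - {0}" using \<open>0 < s'\<close> by simp
      from s'[OF this] show False by simp
    qed (rule refl)
  qed
  then have "summable (\<lambda>n. h n * of_real s ^ n)"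
    using t[of "of_real s"] assms by (auto simp: sums_iff)
  then obtain C where "C > 0" and C: "\<And>n. cmod (h n * of_real s ^ n) \<le> C"
    using summable_imp_Bseq unfolding Bseq_def by blast
  then have "cmod (h n) \<le> C * (1 / s) ^ n" for n
    using C[of n] \<open>0 < s\<close> by (simp add: norm_mult norm_power field_simps power_one_over)
  then show ?thesis using \<open>C > 0\<close> by (intro exI[of _ C]) auto
qed

context tail_contraction
begin

abbreviation "K \<equiv> corner_coeff M n0"

lemma cmod_K_le: "cmod (K m i j) \<le> B * r ^ m"
  unfolding corner_coeff_def
  using cmod_op_le[of "(kernel_op R ^^ m) (unit_seq j)" "r ^ m"]
    cmod_tail_pow_le[of "unit_seq j" 1 m] by (simp add: cmod_unit_seq_le)

lemma summable_K:
  assumes "cmod w * r < 1" shows "summable (\<lambda>m. cmod (K m i j * w ^ m))"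
proof (rule summable_comparison_test')
  show "summable (\<lambda>m. B * (cmod w * r) ^ m)"
    using assms r_pos by (intro summable_mult summable_geometric) auto
  show "norm (cmod (K m i j * w ^ m)) \<le> B * (cmod w * r) ^ m" for m
    using mult_right_mono[OF cmod_K_le[of m i j], of "cmod w ^ m"]
    by (simp add: norm_mult norm_power power_mult_distrib mult_ac)
qed

lemma corner_series_sums:
  assumes "cmod w * r < 1" shows "(\<lambda>m. K m i j * w ^ m) sums corner_series M n0 i j w"
  unfolding corner_series_def by (rule summable_sums[OF summable_norm_cancel[OF summable_K[OF assms]]])

lemma corner_series_holomorphic: "corner_series M n0 i j holomorphic_on ball 0 (1 / r)"
proof (rule power_series_holomorphic[where a = "\<lambda>m. K m i j"])
  fix w :: complex assume "w \<in> ball 0 (1 / r)"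
  then have "cmod w * r < 1" using r_pos by (simp add: field_simps)
  then show "(\<lambda>m. K m i j * (w - 0) ^ m) sums corner_series M n0 i j w"
    using corner_series_sums by simp
qed

lemma corner_entry_holomorphic:
  "i < n0 \<Longrightarrow> j < n0 \<Longrightarrow> (\<lambda>w. corner_mat M n0 w $$ (i, j)) holomorphic_on ball 0 (1 / r)"
  unfolding corner_mat_def by (auto intro!: holomorphic_intros corner_series_holomorphic)

lemma corner_det_holomorphic: "corner_det M n0 holomorphic_on ball 0 (1 / r)"
  unfolding corner_det_def[abs_def]
  by (rule holomorphic_on_det[where n = n0]) (auto intro: corner_entry_holomorphic)

lemma corner_det_0: "corner_det M n0 0 = 1"
proof -
  have "corner_mat M n0 0 = 1\<^sub>m n0" by (auto simp: corner_mat_def)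
  then show ?thesis by (simp add: corner_det_def)
qed


text \<open>
  A vector \<open>x\<close> in the kernel of \<open>I - w K(w)\<close> is extended from the corner to \<open>y = inverse (I - w R) x\<close> by the
  Neumann series.  Beyond the corner \<open>y = w M y\<close> holds by construction of the series, and in the corner it is the
  kernel equation.
\<close>

lemma corner_det_zero_imp_eigenvector:
  assumes w: "cmod w * r < 1" and det0: "corner_det M n0 w = 0"
  obtains y where "Bseq y" and "\<exists>i. y i \<noteq> 0" and "\<And>i. y i = w * kernel_op M y i"
proof -
  interpret tail: tail_contraction "tail_rows n0 M" n0 r B by (rule tail_is_contraction)
  obtain v where v: "v \<in> carrier_vec n0" "v \<noteq> 0\<^sub>v n0" and Gv: "corner_mat M n0 w *\<^sub>v v = 0\<^sub>v n0"
    using det0 det_0_iff_vec_prod_zero[OF corner_mat_carrier] unfolding corner_det_def by blast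
  define x where "x l = vec_index v l" for l
  define X where "X j = (\<Sum>l<n0. x l * unit_seq l j)" for j
  define U where "U m = (kernel_op R ^^ m) X" for m
  define c where "c = (\<Sum>l<n0. cmod (x l))"
  have c0: "0 \<le> c" unfolding c_def by (intro sum_nonneg) simp
  have X: "X j = (if j < n0 then x j else 0)" for j by (simp add: X_def sum_unit_seq)
  have Xc: "cmod (X j) \<le> c" for j
    unfolding X c_def using member_le_sum[of j "{..<n0}" "\<lambda>l. cmod (x l)"] c0 by (auto simp: c_def)
  have BX: "Bseq X" using Xc by (rule BseqI')
  have Uc: "cmod (U m j) \<le> r ^ m * c" for m j
    unfolding U_def by (intro cmod_tail_pow_le Xc)
  have BU: "Bseq (U m)" for m using Uc by (rule BseqI')
  define u where "u m j = w ^ m * U m j" for m j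
  define b where "b m = (cmod w * r) ^ m * c" for m
  have ub: "cmod (u m j) \<le> b m" for m j
    using mult_left_mono[OF Uc, of "cmod w ^ m" m j]
    by (simp add: u_def b_def norm_mult norm_power power_mult_distrib mult_ac)
  have sb: "summable b"
    unfolding b_def using w r_pos by (intro summable_mult2 summable_geometric) auto
  define y where "y j = (\<Sum>m. u m j)" for j
  have u_sums: "(\<lambda>m. u m j) sums y j" for j
    unfolding y_def by (rule summable_sums, rule summable_norm_cancel,
      rule summable_comparison_test'[OF sb]) (simp add: ub)
  have y_bound: "cmod (y j) \<le> suminf b" for j
  proof -
    have s: "summable (\<lambda>m. cmod (u m j))" by (rule summable_comparison_test'[OF sb]) (simp add: ub)
    show ?thesis unfolding y_def
      by (rule order_trans[OF summable_norm[OF s] suminf_le[OF ub s sb]])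
  qed
  have op_u: "kernel_op M (u m) i = w ^ m * kernel_op M (U m) i" for m i
    unfolding u_def by (subst op_scale[OF BU]) simp
  have op_y: "(\<lambda>m. w ^ m * kernel_op M (U m) i) sums kernel_op M y i" for i
    unfolding y_def op_u[symmetric] by (rule suminf_kernel_op[OF summable_row sb ub])
  have y_upper: "y i = x i" if "i < n0" for i
  proof -
    have "(\<lambda>m. u (Suc m) i) = (\<lambda>m. 0)" using that by (simp add: u_def U_def kernel_op_tail)
    then have "(\<lambda>m. u (Suc m) i) sums 0" by simp
    then have "(\<lambda>m. u m i) sums (0 + u 0 i)" by (rule sums_Suc_iff[THEN iffD1])
    then show ?thesis using sums_unique2[OF u_sums, of i] that by (simp add: u_def U_def X)
  qed
  have eq: "y i = w * kernel_op M y i" for i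
  proof (cases "i < n0")
    case False
    then have "(\<lambda>m. u (Suc m) i) = (\<lambda>m. w * (w ^ m * kernel_op M (U m) i))"
      by (auto simp: u_def U_def kernel_op_tail)
    then have "(\<lambda>m. u (Suc m) i) sums (w * kernel_op M y i)"
      using sums_mult[OF op_y, of w i] by simp
    then have "(\<lambda>m. u m i) sums (w * kernel_op M y i + u 0 i)" by (rule sums_Suc_iff[THEN iffD1])
    then show ?thesis using sums_unique2[OF u_sums, of i] False by (simp add: u_def U_def X)
  next
    case True
    have U_sum: "U m = (\<lambda>j. \<Sum>l<n0. x l * (kernel_op R ^^ m) (unit_seq l) j)" for m
      unfolding U_def X_def[abs_def] by (rule tail.pow_sum) simp
    have "kernel_op M (U m) i = (\<Sum>l<n0. x l * K m i l)" for m
      unfolding U_sum corner_coeff_def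
      using pow_sum[of n0 "\<lambda>l. (kernel_op R ^^ m) (unit_seq l)" 1 x]
      by (simp add: BseqI'[OF cmod_tail_pow_le[OF cmod_unit_seq_le]])
    then have "(\<lambda>m. \<Sum>l<n0. x l * (K m i l * w ^ m)) sums kernel_op M y i"
      using op_y[of i] by (simp add: sum_distrib_left mult_ac)
    moreover have "(\<lambda>m. \<Sum>l<n0. x l * (K m i l * w ^ m)) sums (\<Sum>l<n0. x l * corner_series M n0 i l w)"
      by (intro sums_sum sums_mult corner_series_sums w)
    ultimately have opy: "kernel_op M y i = (\<Sum>l<n0. x l * corner_series M n0 i l w)"
      by (rule sums_unique2)
    have "0 = vec_index (corner_mat M n0 w *\<^sub>v v) i" using Gv True by simp
    also have "\<dots> = (\<Sum>l<n0. corner_mat M n0 w $$ (i, l) * x l)"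
      using True v(1) by (auto simp: scalar_prod_def corner_mat_def x_def lessThan_atLeast0 intro!: sum.cong)
    also have "\<dots> = (\<Sum>l<n0. (if l = i then x l else 0) - w * (x l * corner_series M n0 i l w))"
      using True by (intro sum.cong) (auto simp: corner_mat_def algebra_simps)
    also have "\<dots> = x i - w * (\<Sum>l<n0. x l * corner_series M n0 i l w)"
      using True by (simp add: sum_subtractf sum_distrib_left)
    finally show ?thesis using y_upper[OF True] opy by simp
  qed
  have "\<exists>l<n0. x l \<noteq> 0"
  proof (rule ccontr)
    assume "\<not> (\<exists>l<n0. x l \<noteq> 0)"
    then have "v = 0\<^sub>v n0" using v(1) by (intro eq_vecI) (auto simp: x_def)
    then show False using v(2) by contradiction
  qed
  then have "\<exists>i. y i \<noteq> 0" using y_upper by metis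
  moreover have "Bseq y" using y_bound by (rule BseqI')
  ultimately show thesis using that eq by blast
qed

lemma pow_expand:
  assumes "Bseq f"
  shows "(kernel_op M ^^ n) f i =
     (\<Sum>m<n. \<Sum>l<n0. kernel_op M ((kernel_op R ^^ m) f) l * (kernel_op M ^^ (n - Suc m)) (unit_seq l) i)
      + (kernel_op R ^^ n) f i"
  using assms
proof (induction n arbitrary: f)
  case (Suc n)
  have IH: "(kernel_op M ^^ n) (kernel_op R f) i =
     (\<Sum>m<n. \<Sum>l<n0. kernel_op M ((kernel_op R ^^ Suc m) f) l * (kernel_op M ^^ (n - Suc m)) (unit_seq l) i)
      + (kernel_op R ^^ Suc n) f i"
    using Suc.IH[OF Bseq_tail[OF Suc.prems]] by (simp add: funpow_swap1)
  show ?case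
    unfolding pow_Suc_split[OF Suc.prems] IH by (subst sum.lessThan_Suc_shift) simp
qed auto

lemma corner_renewal:
  assumes "i < n0"
  shows "(kernel_op M ^^ Suc n) (unit_seq j) i =
     (\<Sum>l<n0. \<Sum>m\<le>n. (kernel_op M ^^ (n - m)) (unit_seq l) i * K m l j)"
proof -
  have "(kernel_op M ^^ Suc n) (unit_seq j) i =
    (\<Sum>m<Suc n. \<Sum>l<n0. (kernel_op M ^^ (n - m)) (unit_seq l) i * K m l j)"
    using assms by (subst pow_expand) (auto simp: kernel_op_tail corner_coeff_def mult.commute simp del: sum.lessThan_Suc)
  then show ?thesis by (subst sum.swap) (simp add: lessThan_Suc_atMost)
qed

text \<open>
  For small \<open>w\<close> the Cauchy product turns the renewal equation into \<open>H(w) G(w) = I\<close>, and Cramer's rule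
  identifies \<open>H(w)\<close> with a quotient that makes sense on a larger disc.
\<close>

lemma corner_generating_function:
  assumes w: "cmod w * r < 1" "cmod w * B < 1" and det: "corner_det M n0 w \<noteq> 0"
    and ij: "i < n0" "j < n0"
  shows "(\<lambda>n. (kernel_op M ^^ n) (unit_seq j) i * w ^ n) sums
     (adj_mat (corner_mat M n0 w) $$ (i, j) / corner_det M n0 w)"
proof -
  define h where "h n i j = (kernel_op M ^^ n) (unit_seq j) i" for n i j
  have hB: "cmod (h n i j) \<le> B ^ n" for n i j
    using cmod_pow_le[of "unit_seq j" 1 n i] cmod_unit_seq_le by (simp add: h_def)
  have sh: "summable (\<lambda>n. cmod (h n i j * w ^ n))" for i j
  proof (rule summable_comparison_test')
    show "summable (\<lambda>n. (cmod w * B) ^ n)"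
      using w B_nonneg by (intro summable_geometric) auto
    show "norm (cmod (h n i j * w ^ n)) \<le> (cmod w * B) ^ n" for n
      using mult_right_mono[OF hB[of n i j], of "cmod w ^ n"]
      by (simp add: norm_mult norm_power power_mult_distrib mult_ac)
  qed
  define H where "H i j = (\<Sum>n. h n i j * w ^ n)" for i j
  have H: "(\<lambda>n. h n i j * w ^ n) sums H i j" for i j
    unfolding H_def by (rule summable_sums[OF summable_norm_cancel[OF sh]])
  define S where "S = corner_series M n0"
  have HS: "H i j = (if i = j then 1 else 0) + w * (\<Sum>l<n0. H i l * S l j w)" if "i < n0" for i j
  proof -
    have "(\<lambda>n. \<Sum>p\<le>n. K p l j * w ^ p * (h (n - p) i l * w ^ (n - p))) sums (S l j w * H i l)" for l
      using Cauchy_product_sums[OF summable_K[OF w(1), of l j] sh[of i l]]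
      by (simp add: S_def corner_series_def H_def)
    moreover have "(\<Sum>p\<le>n. K p l j * w ^ p * (h (n - p) i l * w ^ (n - p)))
        = (\<Sum>p\<le>n. h (n - p) i l * K p l j) * w ^ n" for n l
      unfolding sum_distrib_right by (intro sum.cong refl) (auto simp flip: power_add)
    ultimately have "(\<lambda>n. w * (\<Sum>l<n0. (\<Sum>p\<le>n. h (n - p) i l * K p l j) * w ^ n)) sums
        (w * (\<Sum>l<n0. S l j w * H i l))"
      by (intro sums_mult sums_sum) simp
    moreover have "w * (\<Sum>l<n0. (\<Sum>p\<le>n. h (n - p) i l * K p l j) * w ^ n) = h (Suc n) i j * w ^ Suc n" for n
      using corner_renewal[OF that, of n j]
      by (simp add: h_def sum_distrib_right[symmetric] del: funpow.simps)
    ultimately have "(\<lambda>n. h (Suc n) i j * w ^ Suc n) sums (w * (\<Sum>l<n0. S l j w * H i l))" by simp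
    then have "(\<lambda>n. h n i j * w ^ n) sums (w * (\<Sum>l<n0. S l j w * H i l) + h 0 i j * w ^ 0)"
      by (subst (asm) sums_Suc_iff)
    then show ?thesis using sums_unique2[OF H, of i j] by (simp add: h_def unit_seq_def mult.commute)
  qed
  define X where "X = Matrix.mat n0 n0 (\<lambda>(i, j). H i j)"
  define A where "A = corner_mat M n0 w"
  have carr: "X \<in> carrier_mat n0 n0" "A \<in> carrier_mat n0 n0" by (auto simp: X_def A_def)
  have XA: "X * A = 1\<^sub>m n0"
  proof (rule eq_matI)
    fix i j assume "i < dim_row (1\<^sub>m n0 :: complex mat)" "j < dim_col (1\<^sub>m n0 :: complex mat)"
    then have ij: "i < n0" "j < n0" by auto
    have "(X * A) $$ (i, j) = (\<Sum>l<n0. H i l * A $$ (l, j))"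
      using ij carr by (auto simp: scalar_prod_def X_def lessThan_atLeast0 intro!: sum.cong)
    also have "\<dots> = (\<Sum>l<n0. (if l = j then H i l else 0) - w * (H i l * S l j w))"
      using ij by (intro sum.cong) (auto simp: A_def corner_mat_def S_def algebra_simps)
    also have "\<dots> = H i j - w * (\<Sum>l<n0. H i l * S l j w)"
      using ij by (simp add: sum_subtractf sum_distrib_left)
    also have "\<dots> = 1\<^sub>m n0 $$ (i, j)" using ij HS[of i j] by simp
    finally show "(X * A) $$ (i, j) = 1\<^sub>m n0 $$ (i, j)" .
  qed (use carr in auto)
  have "adj_mat A = X * A * adj_mat A" using XA adj_mat(1)[OF carr(2)] by simp
  also have "\<dots> = X * (Determinant.det A \<cdot>\<^sub>m 1\<^sub>m n0)"
    using adj_mat[OF carr(2)] assoc_mult_mat[OF carr adj_mat(1)[OF carr(2)]] by simp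
  also have "\<dots> = Determinant.det A \<cdot>\<^sub>m X" using carr mult_smult_distrib[OF carr(1) one_carrier_mat] by simp
  finally have "adj_mat A $$ (i, j) = Determinant.det A * H i j" using ij carr by (simp add: X_def)
  then have "H i j = adj_mat (corner_mat M n0 w) $$ (i, j) / corner_det M n0 w"
    using det by (simp add: A_def corner_det_def)
  then show ?thesis using H[of i j] by (simp add: h_def)
qed

lemma corner_bound_of_det_nonzero:
  assumes S: "S \<le> 1 / r" and nz: "\<And>w. cmod w < S \<Longrightarrow> corner_det M n0 w \<noteq> 0" and s: "0 < s" "s < S"
  shows "\<exists>C\<ge>0. \<forall>n. \<forall>i<n0. \<forall>j<n0. cmod ((kernel_op M ^^ n) (unit_seq j) i) \<le> C * (1 / s) ^ n"
proof -
  have "\<exists>C\<ge>0. \<forall>n. cmod ((kernel_op M ^^ n) (unit_seq j) i) \<le> C * (1 / s) ^ n"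
    if ij: "i < n0" "j < n0" for i j
  proof (rule power_series_coeff_bound)
    have sub: "ball 0 S \<subseteq> ball (0::complex) (1 / r)" using S by auto
    have "(\<lambda>w. Determinant.det (mat_delete (corner_mat M n0 w) j i)) holomorphic_on ball 0 (1 / r)"
    proof (rule holomorphic_on_det)
      show "mat_delete (corner_mat M n0 w) j i \<in> carrier_mat (n0 - 1) (n0 - 1)" for w
        by (rule mat_delete_carrier) simp
      fix i' j' assume "i' < n0 - 1" "j' < n0 - 1"
      then have "mat_delete (corner_mat M n0 w) j i $$ (i', j') =
        corner_mat M n0 w $$ (if i' < j then i' else Suc i', if j' < i then j' else Suc j')" for w
        by (simp add: mat_delete_def corner_mat_def)
      then show "(\<lambda>w. mat_delete (corner_mat M n0 w) j i $$ (i', j')) holomorphic_on ball 0 (1 / r)"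
        using \<open>i' < n0 - 1\<close> \<open>j' < n0 - 1\<close> by (simp only:) (rule corner_entry_holomorphic, auto)
    qed
    then have "(\<lambda>w. adj_mat (corner_mat M n0 w) $$ (i, j)) holomorphic_on ball 0 (1 / r)"
      using ij by (auto simp: adj_mat_def cofactor_def corner_mat_def intro!: holomorphic_intros)
    then show "(\<lambda>w. adj_mat (corner_mat M n0 w) $$ (i, j) / corner_det M n0 w) holomorphic_on ball 0 S"
      using sub nz by (intro holomorphic_on_divide holomorphic_on_subset[OF corner_det_holomorphic]
        holomorphic_on_subset[of _ "ball 0 (1 / r)" "ball 0 S"]) auto
    show "0 < s" "s < S" using s by auto
    show "0 < min S (1 / (B + 1))" using s B_nonneg by auto
    fix w :: complex assume w: "cmod w < min S (1 / (B + 1))"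
    then have "cmod w * (B + 1) < 1" using B_nonneg by (simp add: field_simps)
    then have "cmod w * B < 1" using norm_ge_zero[of w] unfolding distrib_left by linarith
    moreover have "cmod w < 1 / r" using w S by simp
    then have "cmod w * r < 1" using r_pos by (simp add: field_simps)
    ultimately show "(\<lambda>n. (kernel_op M ^^ n) (unit_seq j) i * w ^ n) sums
      (adj_mat (corner_mat M n0 w) $$ (i, j) / corner_det M n0 w)"
      using w nz ij by (intro corner_generating_function) auto
  qed
  then obtain C where C0: "\<And>i j. i < n0 \<Longrightarrow> j < n0 \<Longrightarrow> 0 \<le> C i j"
    and C: "\<And>i j n. i < n0 \<Longrightarrow> j < n0 \<Longrightarrow> cmod ((kernel_op M ^^ n) (unit_seq j) i) \<le> C i j * (1 / s) ^ n"
    by metis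
  have "C i j \<le> (\<Sum>i<n0. \<Sum>j<n0. C i j)" if "i < n0" "j < n0" for i j
  proof -
    have "C i j \<le> (\<Sum>j<n0. C i j)"
      using that C0 by (intro member_le_sum) auto
    also have "\<dots> \<le> (\<Sum>i<n0. \<Sum>j<n0. C i j)"
      using that C0 by (intro member_le_sum[where f = "\<lambda>i. \<Sum>j<n0. C i j"]) (auto intro!: sum_nonneg)
    finally show ?thesis .
  qed
  then have "cmod ((kernel_op M ^^ n) (unit_seq j) i) \<le> (\<Sum>i<n0. \<Sum>j<n0. C i j) * (1 / s) ^ n"
    if "i < n0" "j < n0" for n i j
    using that s(1) by (intro order_trans[OF C mult_right_mono]) auto
  then show ?thesis using C0 by (intro exI[of _ "\<Sum>i<n0. \<Sum>j<n0. C i j"]) (auto intro!: sum_nonneg)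
qed

lemma pow_eigenvector:
  assumes "Bseq y" and "\<And>i. kernel_op M y i = z * y i"
  shows "(kernel_op M ^^ n) y = (\<lambda>i. z ^ n * y i)"
proof (induction n)
  case (Suc n)
  have "kernel_op M (\<lambda>i. z ^ n * y i) = (\<lambda>i. z ^ n * kernel_op M y i)"
    by (rule op_scale[OF assms(1)])
  then show ?case using Suc assms(2) by (simp add: mult_ac)
qed simp

text \<open>
  The zero-free closed unit disc is compact, so it can be enlarged.
\<close>

lemma corner_det_nonzero_beyond:
  assumes "r < 1" and nz: "\<And>w. cmod w \<le> 1 \<Longrightarrow> corner_det M n0 w \<noteq> 0"
  obtains \<rho> where "r < \<rho>" "\<rho> < 1" "\<And>w. cmod w < 1 / \<rho> \<Longrightarrow> corner_det M n0 w \<noteq> 0"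
proof -
  define U where "U = {w \<in> ball 0 (1 / r). corner_det M n0 w \<noteq> 0}"
  have "open (ball 0 (1 / r) \<inter> corner_det M n0 -` (- {0}))"
    by (rule continuous_open_preimage[OF holomorphic_on_imp_continuous_on[OF corner_det_holomorphic]]) auto
  also have "ball 0 (1 / r) \<inter> corner_det M n0 -` (- {0}) = U" by (auto simp: U_def)
  finally have "open U" .
  moreover have r1: "1 < 1 / r" using assms(1) r_pos by simp
  then have "cball 0 1 \<subseteq> U" using nz by (auto simp: U_def)
  ultimately obtain e where e: "0 < e" "(\<Union>x\<in>cball 0 1. ball x e) \<subseteq> U"
    using compact_subset_open_imp_ball_epsilon_subset[OF compact_cball] by metis
  have out: "corner_det M n0 w \<noteq> 0" if w: "cmod w < 1 + e" for w
  proof (cases "cmod w \<le> 1")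
    case False
    define x where "x = w / of_real (cmod w)"
    have x1: "x \<in> cball 0 1" using False by (simp add: x_def norm_divide)
    have "x * of_real (cmod w) = w" using False by (auto simp: x_def)
    then have "x - w = x * of_real (1 - cmod w)" by (simp add: right_diff_distrib)
    then have "cmod (x - w) = cmod x * \<bar>1 - cmod w\<bar>" by (simp only: norm_mult norm_of_real)
    moreover have "cmod x = 1" using False by (auto simp: x_def norm_divide)
    ultimately have "cmod (x - w) = cmod w - 1" using False by simp
    then have "w \<in> ball x e" using w by (simp add: dist_norm)
    then have "w \<in> U" using e x1 by blast
    then show ?thesis by (simp add: U_def)
  qed (rule nz)
  define \<rho> where "\<rho> = max (1 / (1 + e)) ((r + 1) / 2)"
  have \<rho>: "0 < \<rho>" "r < \<rho>" "\<rho> < 1" "1 / (1 + e) \<le> \<rho>"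
    using assms(1) r_pos e(1) by (auto simp: \<rho>_def less_max_iff_disj)
  then have "1 / \<rho> \<le> 1 + e" using e(1) by (simp add: field_simps)
  then show thesis using that[of \<rho>] \<rho> out by force
qed

end

section \<open>Approximation by matrices with the same bounds\<close>

text \<open>
  The approximations share all bounds with the limit, but they need not converge in operator norm.
\<close>

locale tail_contraction_limit = tail_contraction +
  fixes Mk :: "nat \<Rightarrow> nat \<Rightarrow> nat \<Rightarrow> real"
  assumes approx: "\<And>k. tail_contraction (Mk k) n0 r B"
    and rows_tendsto: "\<And>i. (\<lambda>k. row_norm (\<lambda>i j. Mk k i j - M i j) i) \<longlonglongrightarrow> 0"
begin

lemma summable_row_k: "summable (\<lambda>j. \<bar>Mk k i j\<bar>)"
  using approx[of k] by (rule tail_contraction.summable_row)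

lemma pow_tendsto:
  assumes "\<And>k j. cmod (y k j) \<le> c" and "\<And>j. (\<lambda>k. y k j) \<longlonglongrightarrow> z j"
  shows "(\<lambda>k. (kernel_op (Mk k) ^^ n) (y k) i) \<longlonglongrightarrow> (kernel_op M ^^ n) z i"
proof (induction n arbitrary: i)
  case (Suc n)
  show ?case
    unfolding funpow.simps o_apply
    by (rule kernel_op_tendsto[OF summable_row summable_row_k rows_tendsto
          tail_contraction.cmod_pow_le[OF approx assms(1)] Suc.IH])
qed (simp add: assms)

lemma tail_limit: "tail_contraction_limit (tail_rows n0 M) n0 r B (\<lambda>k. tail_rows n0 (Mk k))"
proof (rule tail_contraction_limit.intro[OF tail_is_contraction], rule tail_contraction_limit_axioms.intro)
  fix k show "tail_contraction (tail_rows n0 (Mk k)) n0 r B"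
    by (rule tail_contraction.tail_is_contraction[OF approx])
next
  fix i show "(\<lambda>k. row_norm (\<lambda>i j. tail_rows n0 (Mk k) i j - tail_rows n0 M i j) i) \<longlonglongrightarrow> 0"
    using rows_tendsto[of i] by (cases "i < n0") (simp_all add: tail_rows_def row_norm_def)
qed

lemma corner_coeff_tendsto: "(\<lambda>k. corner_coeff (Mk k) n0 m i j) \<longlonglongrightarrow> K m i j"
  unfolding corner_coeff_def
proof (rule kernel_op_tendsto[OF summable_row summable_row_k rows_tendsto])
  show "cmod ((kernel_op (tail_rows n0 (Mk k)) ^^ m) (unit_seq j) l) \<le> r ^ m * 1" for k l
    by (rule tail_contraction.cmod_tail_pow_le[OF approx cmod_unit_seq_le])
  show "(\<lambda>k. (kernel_op (tail_rows n0 (Mk k)) ^^ m) (unit_seq j) l) \<longlonglongrightarrow> (kernel_op R ^^ m) (unit_seq j) l" for l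
    by (rule tail_contraction_limit.pow_tendsto[OF tail_limit cmod_unit_seq_le tendsto_const])
qed

lemma corner_series_uniform_limit:
  assumes "0 \<le> s" "s * r < 1"
  shows "uniform_limit (cball 0 s) (\<lambda>k. corner_series (Mk k) n0 i j) (corner_series M n0 i j) sequentially"
proof -
  define d where "d m k = cmod (corner_coeff (Mk k) n0 m i j - K m i j) * s ^ m" for m k
  have Kk: "cmod (corner_coeff (Mk k) n0 m i j) \<le> B * r ^ m" for k m
    by (rule tail_contraction.cmod_K_le[OF approx])
  have db: "\<bar>d m k\<bar> \<le> 2 * B * (s * r) ^ m" for m k
  proof -
    have "cmod (corner_coeff (Mk k) n0 m i j - K m i j) \<le> 2 * B * r ^ m"
      using norm_triangle_ineq4[of "corner_coeff (Mk k) n0 m i j" "K m i j"] Kk[of k m] cmod_K_le[of m i j] by simp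
    from mult_right_mono[OF this, of "s ^ m"] show ?thesis
      using assms(1) by (simp add: d_def power_mult_distrib mult_ac)
  qed
  have sb: "summable (\<lambda>m. 2 * B * (s * r) ^ m)"
    using assms r_pos by (intro summable_mult summable_geometric) auto
  have sd: "summable (\<lambda>m. d m k)" for k
    using db by (intro summable_comparison_test'[OF sb]) auto
  have "(\<lambda>k. \<Sum>m. d m k) \<longlonglongrightarrow> (\<Sum>m. 0)"
  proof (rule tannerys_theorem[where M = "\<lambda>m. 2 * B * (s * r) ^ m", THEN conjunct2, THEN conjunct2])
    show "(\<lambda>k. d m k) \<longlonglongrightarrow> 0" for m
      unfolding d_def using corner_coeff_tendsto[of m i j]
      by (intro tendsto_mult_left_zero tendsto_norm_zero) (simp add: LIM_zero)
    show "\<forall>\<^sub>F (m, k) in sequentially \<times>\<^sub>F sequentially. norm (d m k) \<le> 2 * B * (s * r) ^ m"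
      using db by (intro always_eventually) auto
  qed (rule sb, simp)
  then have lim: "(\<lambda>k. \<Sum>m. d m k) \<longlonglongrightarrow> 0" by simp
  show ?thesis
  proof (rule uniform_limitI)
    fix e :: real assume "e > 0"
    have "\<forall>\<^sub>F k in sequentially. (\<Sum>m. d m k) < e"
      using order_tendstoD(2)[OF lim \<open>e > 0\<close>] .
    then show "\<forall>\<^sub>F k in sequentially. \<forall>w\<in>cball 0 s.
        dist (corner_series (Mk k) n0 i j w) (corner_series M n0 i j w) < e"
    proof eventually_elim
      case (elim k)
      show ?case
      proof
        fix w :: complex assume "w \<in> cball 0 s"
        then have ws: "cmod w \<le> s" by simp
        then have wr: "cmod w * r < 1" 
          using le_less_trans[OF mult_right_mono[OF _ less_imp_le[OF r_pos]] assms(2)] by blast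
        have "(\<lambda>m. corner_coeff (Mk k) n0 m i j * w ^ m - K m i j * w ^ m) sums
            (corner_series (Mk k) n0 i j w - corner_series M n0 i j w)"
          by (intro sums_diff corner_series_sums wr tail_contraction.corner_series_sums[OF approx])
        then have "corner_series (Mk k) n0 i j w - corner_series M n0 i j w =
            (\<Sum>m. corner_coeff (Mk k) n0 m i j * w ^ m - K m i j * w ^ m)" by (rule sums_unique)
        moreover have le: "cmod (corner_coeff (Mk k) n0 m i j * w ^ m - K m i j * w ^ m) \<le> d m k" for m
          using power_mono[OF ws norm_ge_zero, of m]
          by (simp add: d_def norm_mult norm_power mult_left_mono flip: left_diff_distrib)
        ultimately have "cmod (corner_series (Mk k) n0 i j w - corner_series M n0 i j w) \<le> (\<Sum>m. d m k)"
          using norm_suminf_le[OF le sd] by simp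
        then show "dist (corner_series (Mk k) n0 i j w) (corner_series M n0 i j w) < e"
          using elim by (simp add: dist_norm)
      qed
    qed
  qed
qed

lemma corner_det_uniform_limit:
  assumes "0 \<le> s" "s * r < 1"
  shows "uniform_limit (cball 0 s) (\<lambda>k. corner_det (Mk k) n0) (corner_det M n0) sequentially"
  unfolding corner_det_def[abs_def]
proof (rule uniform_limit_det[where n = n0])
  fix i j assume ij: "i < n0" "j < n0"
  have "cmod w * r < 1" if "cmod w \<le> s" for w
    using le_less_trans[OF mult_right_mono[OF that less_imp_le[OF r_pos]] assms(2)] .
  then have "continuous_on (cball 0 s) (corner_series M n0 i j)"
    using r_pos
    by (intro holomorphic_on_imp_continuous_on holomorphic_on_subset[OF corner_series_holomorphic]) 
      (auto simp: field_simps)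
  then have "continuous_on (cball 0 s) (\<lambda>w. corner_mat M n0 w $$ (i, j))"
    using ij by (auto simp: corner_mat_def intro!: continuous_intros)
  then show "bounded ((\<lambda>w. corner_mat M n0 w $$ (i, j)) ` cball 0 s)"
    by (intro compact_imp_bounded compact_continuous_image compact_cball)
  have "bounded (corner_series M n0 i j ` cball 0 s)"
    using \<open>continuous_on (cball 0 s) (corner_series M n0 i j)\<close>
    by (intro compact_imp_bounded compact_continuous_image compact_cball)
  then have "uniform_limit (cball 0 s) (\<lambda>k w. (if i = j then 1 else 0) - w * corner_series (Mk k) n0 i j w)
      (\<lambda>w. (if i = j then 1 else 0) - w * corner_series M n0 i j w) sequentially"
    using corner_series_uniform_limit[OF assms, of i j]
    by (intro uniform_limit_minus uniform_lim_mult uniform_limit_const) (auto simp: bounded_iff)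
  then show "uniform_limit (cball 0 s) (\<lambda>k w. corner_mat (Mk k) n0 w $$ (i, j))
      (\<lambda>w. corner_mat M n0 w $$ (i, j)) sequentially"
    using ij by (simp add: corner_mat_def)
qed auto

text \<open>
  Up to any fixed time \<open>p\<close> the corner entries of the approximations obey the bound of the
  limit, with a constant that is independent of \<open>p\<close>; hence so do the norms of the \<open>p\<close>-th powers, and
  \<open>p\<close> can be taken so large that this constant is absorbed by passing from \<open>\<rho>\<close> to \<open>\<rho>'\<close>.
\<close>

lemma eigenvalues_eventually_small:
  assumes \<rho>: "r < \<rho>" "\<rho> < \<rho>'" and "0 \<le> C"
    and corner: "\<And>n i j. i < n0 \<Longrightarrow> j < n0 \<Longrightarrow> cmod ((kernel_op M ^^ n) (unit_seq j) i) \<le> C * \<rho> ^ n"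
  shows "\<forall>\<^sub>F k in sequentially. \<forall>z y. Bseq y \<longrightarrow> (\<exists>i. y i \<noteq> 0) \<longrightarrow>
    (\<forall>i. kernel_op (Mk k) y i = z * y i) \<longrightarrow> cmod z \<le> \<rho>'"
proof -
  define D where "D = max 1 (real n0 * (C + 1) * B / (\<rho> - r))"
  have D: "1 \<le> D" by (simp add: D_def)
  have pos: "0 < \<rho>" "0 < \<rho>'" using \<rho> r_pos by auto
  \<comment> \<open>The horizon \<open>p\<close> depends only on \<open>D\<close>, so \<open>k\<close> may be taken large in terms of \<open>p\<close>.\<close>
  obtain p where "(\<rho> / \<rho>') ^ p < 1 / D"
    using real_arch_pow_inv[of "1 / D" "\<rho> / \<rho>'"] D \<rho> pos by auto
  then have p: "D * \<rho> ^ p < \<rho>' ^ p" using D pos by (simp add: power_divide field_simps)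
  define T where "T = {..p} \<times> {..<n0} \<times> {..<n0}"
  have "\<forall>\<^sub>F k in sequentially. \<forall>x\<in>T. case x of (n, i, j) \<Rightarrow>
      cmod ((kernel_op (Mk k) ^^ n) (unit_seq j) i) \<le> (C + 1) * \<rho> ^ n"
  proof (rule eventually_ball_finite)
    show "finite T" by (simp add: T_def)
    show "\<forall>x\<in>T. \<forall>\<^sub>F k in sequentially. case x of (n, i, j) \<Rightarrow>
      cmod ((kernel_op (Mk k) ^^ n) (unit_seq j) i) \<le> (C + 1) * \<rho> ^ n"
    proof safe
      fix n i j assume "(n, i, j) \<in> T"
      then have "cmod ((kernel_op M ^^ n) (unit_seq j) i) \<le> C * \<rho> ^ n"
        by (intro corner) (auto simp: T_def)
      also have "\<dots> < (C + 1) * \<rho> ^ n" using pos by (simp add: algebra_simps)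
      finally have "cmod ((kernel_op M ^^ n) (unit_seq j) i) < (C + 1) * \<rho> ^ n" .
      moreover have "(\<lambda>k. cmod ((kernel_op (Mk k) ^^ n) (unit_seq j) i)) \<longlonglongrightarrow>
          cmod ((kernel_op M ^^ n) (unit_seq j) i)"
        by (intro tendsto_norm pow_tendsto[where c = 1] cmod_unit_seq_le tendsto_const)
      ultimately have "\<forall>\<^sub>F k in sequentially. cmod ((kernel_op (Mk k) ^^ n) (unit_seq j) i) < (C + 1) * \<rho> ^ n"
        by (intro order_tendstoD(2))
      then show "\<forall>\<^sub>F k in sequentially. cmod ((kernel_op (Mk k) ^^ n) (unit_seq j) i) \<le> (C + 1) * \<rho> ^ n"
        by (rule eventually_mono) simp
    qed
  qed
  then show ?thesis
  proof eventually_elim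
    case (elim k)
    interpret k: tail_contraction "Mk k" n0 r B by (rule approx)
    show ?case
    proof (intro allI impI)
      fix z y assume y: "Bseq y" "\<exists>i. y i \<noteq> 0" "\<forall>i. kernel_op (Mk k) y i = z * y i"
      obtain K where K: "\<And>i. cmod (y i) \<le> K" using y(1) by (auto simp: Bseq_def)
      define c where "c = (SUP i. cmod (y i))"
      have bdd: "bdd_above (range (\<lambda>i. cmod (y i)))" by (intro bdd_aboveI2[where M = K] K)
      have yc: "cmod (y i) \<le> c" for i unfolding c_def by (rule cSUP_upper[OF _ bdd]) simp
      obtain i1 where "y i1 \<noteq> 0" using y(2) by blast
      then have c: "0 < c" using yc[of i1] by (smt (verit) zero_less_norm_iff)
      have bound: "cmod z ^ p * cmod (y i) \<le> D * \<rho> ^ p * c" for i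
      proof -
        have "cmod ((kernel_op (Mk k) ^^ p) y i) \<le> D * \<rho> ^ p * c"
          using elim \<open>0 \<le> C\<close> \<rho>(1)
          by (intro k.corner_bound_imp_norm_bound[where C = "C + 1" and p = p] yc)
            (auto simp: T_def D_def)
        then show ?thesis
          unfolding k.pow_eigenvector[OF y(1) y(3)[rule_format]] by (simp add: norm_mult norm_power)
      qed
      show "cmod z \<le> \<rho>'"
      proof (rule ccontr)
        assume "\<not> cmod z \<le> \<rho>'"
        then have zp: "\<rho>' ^ p \<le> cmod z ^ p" using pos by (intro power_mono) auto
        have "cmod (y i) \<le> D * \<rho> ^ p * c / \<rho>' ^ p" for i
          using bound[of i] mult_right_mono[OF zp, of "cmod (y i)"] pos by (simp add: field_simps)
        then have "c \<le> D * \<rho> ^ p * c / \<rho>' ^ p" unfolding c_def by (intro cSUP_least) auto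
        then have "\<rho>' ^ p * c \<le> D * \<rho> ^ p * c" using pos by (simp add: field_simps)
        then show False using p c by simp
      qed
    qed
  qed
qed

text \<open>
  Along a subsequence without zeros in the disc of radius \<open>1 / \<rho>\<close>, Hurwitz' theorem passes the absence of
  zeros to a nonconstant limit; a constant limit equals its value \<open>1\<close> at the origin.
\<close>

lemma corner_bound_of_frequently_nonzero:
  assumes \<rho>: "r \<le> \<rho>" "\<rho> < \<rho>'"
    and freq: "\<exists>\<^sub>F k in sequentially. \<forall>w. cmod w < 1 / \<rho> \<longrightarrow> corner_det (Mk k) n0 w \<noteq> 0"
  shows "\<exists>C\<ge>0. \<forall>n. \<forall>i<n0. \<forall>j<n0. cmod ((kernel_op M ^^ n) (unit_seq j) i) \<le> C * \<rho>' ^ n"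
proof -
  have pos: "0 < \<rho>" "0 < \<rho>'" using \<rho> r_pos by auto
  define S where "S = 1 / \<rho>"
  have S: "0 < S" "S \<le> 1 / r" using \<rho> pos r_pos by (auto simp: S_def field_simps)
  have "infinite {k. \<forall>w. cmod w < S \<longrightarrow> corner_det (Mk k) n0 w \<noteq> 0}"
    using freq by (simp add: S_def frequently_cofinite flip: cofinite_eq_sequentially)
  from infinite_enumerate[OF this] obtain \<phi> :: "nat \<Rightarrow> nat" where \<phi>: "strict_mono \<phi>"
    and \<phi>_in: "\<And>k. \<phi> k \<in> {k. \<forall>w. cmod w < S \<longrightarrow> corner_det (Mk k) n0 w \<noteq> 0}" by blast
  then have nzk: "corner_det (Mk (\<phi> k)) n0 w \<noteq> 0" if "cmod w < S" for k w
    using that \<phi>_in[of k] by simp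
  have sub: "ball 0 S \<subseteq> ball (0 :: complex) (1 / r)" using S by auto
  have nz: "corner_det M n0 w \<noteq> 0" if w: "cmod w < S" for w
  proof (cases "corner_det M n0 constant_on ball 0 S")
    case True
    then have "corner_det M n0 w = corner_det M n0 0"
      using w S(1) by (auto simp: constant_on_def)
    then show ?thesis by (simp add: corner_det_0)
  next
    case False
    show ?thesis
    proof (rule Hurwitz_no_zeros[where S = "ball 0 S" and \<F> = "\<lambda>k. corner_det (Mk (\<phi> k)) n0"
          and g = "corner_det M n0" and ?z0.0 = w])
      show "corner_det (Mk (\<phi> k)) n0 holomorphic_on ball 0 S" for k
        by (rule holomorphic_on_subset[OF tail_contraction.corner_det_holomorphic[OF approx] sub])
      show "corner_det M n0 holomorphic_on ball 0 S"
        by (rule holomorphic_on_subset[OF corner_det_holomorphic sub])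
      show "\<not> corner_det M n0 constant_on ball 0 S" by (rule False)
      show "corner_det (Mk (\<phi> k)) n0 w \<noteq> 0" if "w \<in> ball 0 S" for k w
        using that nzk by simp
      show "w \<in> ball 0 S" using w by simp
      fix K :: "complex set" assume K: "compact K" "K \<subseteq> ball 0 S"
      show "uniform_limit K (\<lambda>k. corner_det (Mk (\<phi> k)) n0) (corner_det M n0) sequentially"
      proof (cases "K = {}")
        case False
        then obtain x where x: "x \<in> K" "\<And>y. y \<in> K \<Longrightarrow> cmod y \<le> cmod x"
          using continuous_attains_sup[OF K(1) False continuous_on_norm[OF continuous_on_id]] by auto
        have "cmod x * r < 1"
        proof -
          have "cmod x < 1 / r" using x(1) K(2) S(2) by (auto simp: subset_iff)
          then show ?thesis using r_pos by (simp add: field_simps)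
        qed
        then have "uniform_limit (cball 0 (cmod x)) (\<lambda>k. corner_det (Mk k) n0) (corner_det M n0) sequentially"
          by (intro corner_det_uniform_limit) auto
        then have "uniform_limit K (\<lambda>k. corner_det (Mk k) n0) (corner_det M n0) sequentially"
          by (rule uniform_limit_on_subset) (auto intro: x(2))
        then show ?thesis
          using filterlim_compose[OF _ filterlim_subseq[OF \<phi>]] by blast
      qed simp
    qed auto
  qed
  have "1 / \<rho>' < S" using \<rho> pos by (simp add: S_def field_simps)
  then show ?thesis
    using corner_bound_of_det_nonzero[OF S(2) nz, of "1 / \<rho>'"] pos by simp
qed

end

section \<open>Ergodic chains have no peripheral eigenfunctions\<close>

lemma suminf_swap:
  fixes a :: "nat \<Rightarrow> nat \<Rightarrow> 'a :: {real_normed_algebra, banach}"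
  assumes col: "\<And>j. summable (\<lambda>i. norm (a i j))" and cols: "summable (\<lambda>j. \<Sum>i. norm (a i j))"
  shows "summable (\<lambda>j. norm (a i j))"
    and "(\<lambda>i. \<Sum>j. a i j) sums (\<Sum>j. \<Sum>i. a i j)"
proof -
  have le: "norm (\<Sum>i<n. a i j) \<le> (\<Sum>i. norm (a i j))" for n j
    by (rule order_trans[OF norm_sum sum_le_suminf[OF col]]) auto
  have le1: "norm (a i j) \<le> (\<Sum>i. norm (a i j))" for i j
    using sum_le_suminf[OF col, of "{i}" j] by simp
  show s: "summable (\<lambda>j. norm (a i j))" for i
    using le1 by (intro summable_comparison_test'[OF cols]) simp
  have "(\<lambda>n. \<Sum>j. \<Sum>i<n. a i j) \<longlonglongrightarrow> (\<Sum>j. \<Sum>i. a i j)"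
  proof (rule tannerys_theorem[where M = "\<lambda>j. \<Sum>i. norm (a i j)", THEN conjunct2, THEN conjunct2])
    show "(\<lambda>n. \<Sum>i<n. a i j) \<longlonglongrightarrow> (\<Sum>i. a i j)" for j
      by (rule summable_LIMSEQ[OF summable_norm_cancel[OF col]])
    show "\<forall>\<^sub>F (j, n) in sequentially \<times>\<^sub>F sequentially. norm (\<Sum>i<n. a i j) \<le> (\<Sum>i. norm (a i j))"
      using le by (intro always_eventually) auto
  qed (rule cols, simp)
  moreover have "(\<Sum>j. \<Sum>i<n. a i j) = (\<Sum>i<n. \<Sum>j. a i j)" for n
    by (rule suminf_sum) (rule summable_norm_cancel[OF s])
  ultimately show "(\<lambda>i. \<Sum>j. a i j) sums (\<Sum>j. \<Sum>i. a i j)" by (simp add: sums_def)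
qed

lemma sums_0_nonneg:
  fixes f :: "nat \<Rightarrow> real"
  assumes "f sums 0" and "\<And>n. 0 \<le> f n" shows "f n = 0"
  using assms suminf_eq_zero_iff[of f] by (simp add: sums_iff)

text \<open>
  The order of \<open>z\<close> divides every element of \<open>A\<close>.
\<close>

lemma root_of_unity_Gcd:
  fixes z :: complex
  assumes A: "\<And>n. n \<in> A \<Longrightarrow> z ^ n = 1" and G: "Gcd A = (1 :: nat)"
  shows "z = 1"
proof -
  have "\<exists>n\<in>A. n \<noteq> 0"
  proof (rule ccontr)
    assume "\<not> (\<exists>n\<in>A. n \<noteq> 0)"
    then have "Gcd A = 0" by (simp add: Gcd_0_iff subset_iff)
    then show False using G by simp
  qed
  then have ex: "\<exists>d. 0 < d \<and> z ^ d = 1" using A by auto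
  define d where "d = (LEAST d. 0 < d \<and> z ^ d = 1)"
  have d: "0 < d" "z ^ d = 1" using LeastI_ex[OF ex] by (auto simp: d_def)
  have "d dvd n" if "n \<in> A" for n
  proof (rule ccontr)
    assume "\<not> d dvd n"
    then have pos: "0 < n mod d" by (simp add: mod_greater_zero_iff_not_dvd)
    have "z ^ n = z ^ (d * (n div d) + n mod d)" by (simp only: mult_div_mod_eq)
    also have "\<dots> = (z ^ d) ^ (n div d) * z ^ (n mod d)" by (simp only: power_add power_mult)
    finally have "z ^ n = (z ^ d) ^ (n div d) * z ^ (n mod d)" .
    then have "z ^ (n mod d) = 1" using A[OF that] d by simp
    then have "d \<le> n mod d" unfolding d_def using pos by (intro Least_le) (auto simp: d_def)
    then show False using mod_less_divisor[OF d(1), of n] by linarith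
  qed
  then have "d dvd 1" using G Gcd_greatest[of A d] by auto
  then show ?thesis using d by simp
qed

locale ergodic_chain =
  fixes P :: "nat \<Rightarrow> nat \<Rightarrow> real" and \<pi> :: "nat \<Rightarrow> real"
  assumes kernel: "markov_kernel P" and irreducible: "irreducible_kernel P"
    and aperiodic: "aperiodic_kernel P" and invariant: "invariant_probability P \<pi>"
begin

lemma P_nonneg [simp]: "0 \<le> P i j" and P_sums: "(\<lambda>j. P i j) sums 1"
  using kernel by (auto simp: markov_kernel_def)

lemma pi_nonneg: "0 \<le> \<pi> i" and pi_sums: "\<pi> sums 1" and pi_P_sums: "(\<lambda>i. \<pi> i * P i j) sums \<pi> j"
  using invariant by (auto simp: invariant_probability_def)

text \<open>
  A positive entry of a power of the kernel is witnessed by a path of positive transitions; \<open>T\<close> is any property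
  that is transported along such paths.
\<close>

lemma kernel_power_path:
  assumes "kernel_power P n i j \<noteq> 0" and "T 0 i"
    and "\<And>n i l. T n i \<Longrightarrow> 0 < P i l \<Longrightarrow> T (Suc n) l"
  shows "T n j"
proof -
  have "T (m + n) j" if "kernel_power P n i j \<noteq> 0" "T m i" for m i
    using that
  proof (induction n arbitrary: m i)
    case 0 then show ?case by (simp split: if_splits)
  next
    case (Suc n)
    have "\<exists>l. P i l * kernel_power P n l j \<noteq> 0"
    proof (rule ccontr)
      assume "\<nexists>l. P i l * kernel_power P n l j \<noteq> 0"
      then have "(\<lambda>l. P i l * kernel_power P n l j) = (\<lambda>l. 0)" by (simp only: not_ex not_not)
      then show False using Suc.prems by simp
    qed
    then obtain l where l: "P i l \<noteq> 0" "kernel_power P n l j \<noteq> 0" by auto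
    have "T (Suc m) l" using assms(3)[OF Suc.prems(2), of l] l(1) P_nonneg[of i l] by simp
    from Suc.IH[OF l(2) this] show ?case by simp
  qed
  from this[OF assms(1,2)] show ?thesis by simp
qed

lemma irreducible_closed:
  assumes "T i" and "\<And>i l. T i \<Longrightarrow> 0 < P i l \<Longrightarrow> T l" shows "T j"
proof -
  obtain n where "0 < kernel_power P n i j" using irreducible by (auto simp: irreducible_kernel_def)
  then show ?thesis using kernel_power_path[of n i j "\<lambda>_. T"] assms by auto
qed

lemma pi_P_le: "\<pi> i * P i j \<le> \<pi> j"
  using sum_le_suminf[OF sums_summable[OF pi_P_sums], of "{i}" j] sums_unique[OF pi_P_sums[of j]]
  by (simp add: pi_nonneg)

lemma pi_pos: "0 < \<pi> i"
proof -
  have "\<exists>i. 0 < \<pi> i"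
  proof (rule ccontr)
    assume "\<nexists>i. 0 < \<pi> i"
    then have "\<pi> = (\<lambda>_. 0)" using pi_nonneg by (auto simp: not_less antisym)
    then show False using pi_sums sums_unique2[OF sums_zero] by fastforce
  qed
  then obtain i0 where "0 < \<pi> i0" by blast
  then show ?thesis
    by (rule irreducible_closed) (metis pi_P_le mult_pos_pos order_less_le_trans)
qed

lemma P_le: "P i j \<le> \<pi> j / \<pi> i"
  using pi_P_le[of i j] pi_pos[of i] by (simp add: pos_le_divide_eq mult.commute)

definition integrable_seq :: "(nat \<Rightarrow> 'a :: real_normed_vector) \<Rightarrow> bool" where
  "integrable_seq f \<longleftrightarrow> summable (\<lambda>i. \<pi> i * norm (f i))"

lemma P_summable:
  assumes "integrable_seq f" shows "summable (\<lambda>j. P i j * norm (f j))"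
proof (rule summable_comparison_test')
  show "summable (\<lambda>j. (\<pi> j * norm (f j)) / \<pi> i)"
    using assms unfolding integrable_seq_def by (rule summable_divide)
  show "norm (P i j * norm (f j)) \<le> (\<pi> j * norm (f j)) / \<pi> i" for j
    using mult_right_mono[OF P_le[of i j], of "norm (f j)"] by simp
qed

lemma invariance_mean:
  fixes f :: "nat \<Rightarrow> 'a :: {real_normed_algebra_1, banach}"
  assumes "integrable_seq f"
  shows "integrable_seq (\<lambda>i. \<Sum>j. of_real (P i j) * f j)"
    and "(\<lambda>i. of_real (\<pi> i) * (\<Sum>j. of_real (P i j) * f j)) sums (\<Sum>j. of_real (\<pi> j) * f j)"
proof -
  define a where "a i j = of_real (\<pi> i * P i j) * f j" for i j
  have na: "norm (a i j) = \<pi> i * P i j * norm (f j)" for i j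
    using norm_scaleR[of "\<pi> i * P i j" "f j"]
    by (simp add: a_def pi_nonneg flip: scaleR_conv_of_real)
  have col: "(\<lambda>i. norm (a i j)) sums (\<pi> j * norm (f j))" for j
    unfolding na by (intro sums_mult2 pi_P_sums)
  have cols: "summable (\<lambda>j. \<Sum>i. norm (a i j))"
    using assms unfolding integrable_seq_def sums_unique[OF col, symmetric] .
  have cola: "(\<lambda>i. a i j) sums (of_real (\<pi> j) * f j)" for j
    unfolding a_def by (intro sums_mult2 sums_of_real pi_P_sums)
  have row: "(\<Sum>j. a i j) = of_real (\<pi> i) * (\<Sum>j. of_real (P i j) * f j)" for i
  proof -
    have "summable (\<lambda>j. norm (of_real (P i j) * f j))"
      using P_summable[OF assms, of i] by (simp flip: scaleR_conv_of_real)
    then show ?thesis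
      unfolding a_def of_real_mult mult.assoc by (intro suminf_mult) (rule summable_norm_cancel)
  qed
  show "(\<lambda>i. of_real (\<pi> i) * (\<Sum>j. of_real (P i j) * f j)) sums (\<Sum>j. of_real (\<pi> j) * f j)"
    using suminf_swap(2)[of a, OF sums_summable[OF col] cols]
    unfolding row sums_unique[OF cola, symmetric] .
  have "summable (\<lambda>i. \<Sum>j. norm (a i j))"
    using suminf_swap(2)[of "\<lambda>i j. norm (a i j)"] sums_summable[OF col] cols by (auto simp: sums_iff)
  from this show "integrable_seq (\<lambda>i. \<Sum>j. of_real (P i j) * f j)"
    unfolding integrable_seq_def
  proof (rule summable_comparison_test')
    fix i
    have s: "summable (\<lambda>j. norm (a i j))"
      by (rule suminf_swap(1)[OF sums_summable[OF col] cols])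
    have "\<pi> i * norm (\<Sum>j. of_real (P i j) * f j) = norm (\<Sum>j. a i j)"
      unfolding row by (simp add: pi_nonneg flip: scaleR_conv_of_real)
    then show "norm (\<pi> i * norm (\<Sum>j. of_real (P i j) * f j)) \<le> (\<Sum>j. norm (a i j))"
      using summable_norm[OF s] by simp
  qed
qed

text \<open>
  Both sides have the same mean under the invariant measure, which charges every state.
\<close>

lemma superharmonic_imp_harmonic:
  fixes u :: "nat \<Rightarrow> real"
  assumes u: "integrable_seq u" and le: "\<And>i. (\<Sum>j. P i j * u j) \<le> u i"
  shows "(\<Sum>j. P i j * u j) = u i"
proof -
  have "(\<lambda>i. \<pi> i * (\<Sum>j. P i j * u j)) sums (\<Sum>j. \<pi> j * u j)"
    using invariance_mean(2)[OF u] by simp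
  moreover have "(\<lambda>i. \<pi> i * u i) sums (\<Sum>j. \<pi> j * u j)"
    using u by (intro summable_sums, intro summable_norm_cancel[of "\<lambda>i. \<pi> i * u i"])
      (simp add: integrable_seq_def abs_mult pi_nonneg)
  ultimately have "(\<lambda>i. \<pi> i * u i - \<pi> i * (\<Sum>j. P i j * u j)) sums
      ((\<Sum>j. \<pi> j * u j) - (\<Sum>j. \<pi> j * u j))"
    by (intro sums_diff)
  then have "(\<lambda>i. \<pi> i * u i - \<pi> i * (\<Sum>j. P i j * u j)) sums 0" by simp
  moreover have "0 \<le> \<pi> i * u i - \<pi> i * (\<Sum>j. P i j * u j)" for i
    using mult_left_mono[OF le pi_nonneg] by simp
  ultimately have "\<pi> i * u i - \<pi> i * (\<Sum>j. P i j * u j) = 0"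
    by (rule sums_0_nonneg)
  then have "\<pi> i * (u i - (\<Sum>j. P i j * u j)) = 0" by (simp only: right_diff_distrib)
  then show ?thesis using pi_pos[of i] by simp
qed

text \<open>
  Such an \<open>h\<close> is harmonic, hence \<open>min h c\<close> is superharmonic and therefore harmonic for every level \<open>c\<close>.  Thus the
  chain cannot leave the set where \<open>h \<ge> c\<close>, and by irreducibility this set is empty or everything.
\<close>

lemma subharmonic_constant:
  fixes h :: "nat \<Rightarrow> real"
  assumes h0: "\<And>i. 0 \<le> h i" and h: "integrable_seq h" and le: "\<And>i. h i \<le> (\<Sum>j. P i j * h j)"
  shows "h i = h j"
proof -
  have hP: "summable (\<lambda>j. P i j * h j)" for i using P_summable[OF h, of i] h0 by simp
  have harm: "(\<Sum>j. P i j * h j) = h i" for i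
  proof -
    have "(\<Sum>j. P i j * - h j) = - h i"
    proof (rule superharmonic_imp_harmonic[where u = "\<lambda>j. - h j"])
      show "integrable_seq (\<lambda>j. - h j)" using h by (simp add: integrable_seq_def)
      show "(\<Sum>j. P i j * - h j) \<le> - h i" for i using le[of i] suminf_minus[OF hP, of i] by simp
    qed
    then show ?thesis using suminf_minus[OF hP, of i] by simp
  qed
  have "h i \<le> h j" for i j
  proof -
    define c where "c = h i"
    define m where "m j = min (h j) c" for j
    have m: "0 \<le> m j" "m j \<le> h j" "m j \<le> c" for j by (auto simp: m_def c_def h0)
    have mi: "integrable_seq m"
      unfolding integrable_seq_def
    proof (rule summable_comparison_test')
      show "summable (\<lambda>i. \<pi> i * norm (h i))" using h by (simp add: integrable_seq_def)
      show "norm (\<pi> n * norm (m n)) \<le> \<pi> n * norm (h n)" for n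
        using m[of n] h0[of n] by (simp add: abs_mult pi_nonneg mult_left_mono)
    qed
    have mP: "summable (\<lambda>j. P i j * m j)" for i using P_summable[OF mi, of i] m by simp
    have "(\<Sum>j. P i j * m j) \<le> m i" for i
    proof -
      have "(\<Sum>j. P i j * m j) \<le> (\<Sum>j. P i j * h j)"
        by (intro suminf_le mP hP mult_left_mono m) simp
      moreover have "(\<Sum>j. P i j * m j) \<le> (\<Sum>j. P i j * c)"
        by (intro suminf_le mP mult_left_mono m sums_summable[OF sums_mult2[OF P_sums]]) simp
      moreover have "(\<Sum>j. P i j * c) = c" using sums_mult2[OF P_sums, of i c] by (simp add: sums_iff)
      ultimately show ?thesis using harm[of i] by (simp add: m_def)
    qed
    note mharm = superharmonic_imp_harmonic[OF mi this]
    have "c \<le> h j"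
    proof (rule irreducible_closed[where T = "\<lambda>j. c \<le> h j"])
      show "c \<le> h i" by (simp add: c_def)
      fix i l assume i: "c \<le> h i" and pos: "0 < P i l"
      have "(\<lambda>j. P i j * c - P i j * m j) sums (1 * c - m i)"
        using mharm[of i] mP[of i] by (intro sums_diff sums_mult2 P_sums) (simp add: sums_iff)
      moreover have "m i = c" using i by (simp add: m_def)
      ultimately have s: "(\<lambda>j. P i j * c - P i j * m j) sums 0" by simp
      moreover have "0 \<le> P i j * c - P i j * m j" for j using mult_left_mono[OF m(3), of "P i j" j] by simp
      ultimately have "P i l * c - P i l * m l = 0"
        by (rule sums_0_nonneg)
      then have "m l = c" using pos by simp
      then show "c \<le> h l" using m(2)[of l] by simp
    qed
    then show ?thesis by (simp add: c_def)
  qed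
  then show ?thesis by (simp add: antisym)
qed

text \<open>
  The modulus of an eigenfunction for \<open>|z| \<ge> 1\<close> is subharmonic, hence constant.  Then \<open>z g(i)\<close> is an average of
  numbers of the same modulus, so \<open>g(l) = z g(i)\<close> along every possible transition.  Aperiodicity forces
  \<open>z = 1\<close>, irreducibility makes \<open>g\<close> constant, and the constant is the mean of \<open>g\<close>.
\<close>

lemma no_peripheral_eigenvector:
  fixes g :: "nat \<Rightarrow> complex"
  assumes g: "integrable_seq g" and eig: "\<And>i. kernel_op P g i = z * g i" and z: "1 \<le> cmod z"
    and mean: "(\<Sum>i. g i * complex_of_real (\<pi> i)) = 0"
  shows "g i = 0"
proof -
  have sg: "summable (\<lambda>j. P i j * cmod (g j))" for i by (rule P_summable[OF g])
  have Pg: "cmod (z * g i) \<le> (\<Sum>j. P i j * cmod (g j))" for i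
    unfolding eig[symmetric] kernel_op_def
    using summable_norm[of "\<lambda>j. complex_of_real (P i j) * g j"] sg[of i] by (simp add: norm_mult)
  define c where "c = cmod (g 0)"
  have c: "cmod (g i) = c" for i
    unfolding c_def
  proof (rule subharmonic_constant)
    show "integrable_seq (\<lambda>i. cmod (g i))" using g by (simp add: integrable_seq_def)
    show "cmod (g i) \<le> (\<Sum>j. P i j * cmod (g j))" for i
      using Pg[of i] mult_right_mono[OF z, of "cmod (g i)"] by (simp add: norm_mult)
  qed simp
  show ?thesis
  proof (cases "c = 0")
    case True then show ?thesis using c[of i] by simp
  next
    case False
    then have cpos: "0 < c" by (simp add: c_def)
    have "(\<Sum>j. P 0 j * cmod (g j)) = c"
      using sums_mult2[OF P_sums, of 0 c] by (simp add: c sums_iff)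
    then have "cmod z \<le> 1" using Pg[of 0] cpos by (simp add: norm_mult c)
    then have z1: "cmod z = 1" using z by simp
    have step: "g l = z * g i" if "0 < P i l" for i l
    proof -
      define d where "d = z * g i"
      have d: "cmod d = c" by (simp add: d_def norm_mult z1 c)
      have "(\<lambda>j. complex_of_real (P i j) * g j) sums d"
        unfolding d_def eig[symmetric] kernel_op_def
        using sg[of i]
        by (intro summable_sums, intro summable_norm_cancel[of "\<lambda>j. complex_of_real (P i j) * g j"])
          (simp add: norm_mult)
      then have "(\<lambda>j. Re (complex_of_real (P i j) * g j * cnj d)) sums Re (d * cnj d)"
        by (intro sums_Re sums_mult2)
      moreover have "Re (d * cnj d) = c\<^sup>2" by (simp add: d flip: complex_norm_square)
      ultimately have "(\<lambda>j. P i j * c\<^sup>2 - Re (complex_of_real (P i j) * g j * cnj d)) sums (1 * c\<^sup>2 - c\<^sup>2)"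
        by (intro sums_diff sums_mult2 P_sums) simp
      then have s: "(\<lambda>j. P i j * (c\<^sup>2 - Re (g j * cnj d))) sums 0"
        by (simp add: right_diff_distrib mult.assoc)
      have Re_le: "Re (g j * cnj d) \<le> c\<^sup>2" for j
        using complex_Re_le_cmod[of "g j * cnj d"] by (simp add: norm_mult c d power2_eq_square)
      then have "0 \<le> P i j * (c\<^sup>2 - Re (g j * cnj d))" for j by simp
      then have "P i l * (c\<^sup>2 - Re (g l * cnj d)) = 0"
        by (rule sums_0_nonneg[OF s])
      then have Re: "Re (g l * cnj d) = c\<^sup>2" using that by simp
      have "(cmod (g l - d))\<^sup>2 = (cmod (g l))\<^sup>2 + (cmod d)\<^sup>2 - 2 * Re (g l * cnj d)"
        unfolding cmod_power2 by (simp add: power2_eq_square algebra_simps)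
      also have "\<dots> = 0" unfolding Re by (simp add: c d)
      finally show ?thesis by (simp add: d_def)
    qed
    have g0: "g i \<noteq> 0" for i using c[of i] cpos by auto
    have "z = 1"
    proof (rule root_of_unity_Gcd)
      show "Gcd {n. 1 \<le> n \<and> 0 < kernel_power P n 0 0} = 1"
        using aperiodic by (simp add: aperiodic_kernel_def)
      fix n assume n: "n \<in> {n. 1 \<le> n \<and> 0 < kernel_power P n 0 0}"
      have "g 0 = z ^ n * g 0"
      proof (rule kernel_power_path[where T = "\<lambda>n i. g i = z ^ n * g 0"])
        show "kernel_power P n 0 0 \<noteq> 0" using n by simp
        fix m i l assume "g i = z ^ m * g 0" "0 < P i l"
        then show "g l = z ^ Suc m * g 0" using step[of i l] by simp
      qed simp
      then show "z ^ n = 1" using g0[of 0] by simp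
    qed
    have const: "g i = g 0" for i
      by (rule irreducible_closed[where T = "\<lambda>i. g i = g 0" and i = 0]) (use step \<open>z = 1\<close> in simp_all)
    have "(\<lambda>i. g 0 * complex_of_real (\<pi> i)) sums (g 0 * complex_of_real 1)"
      by (intro sums_mult sums_of_real pi_sums)
    moreover have "(\<lambda>i. g i * complex_of_real (\<pi> i)) = (\<lambda>i. g 0 * complex_of_real (\<pi> i))"
      by (rule ext) (subst const, rule refl)
    ultimately have "g 0 = 0" using mean by (simp add: sums_iff)
    then show ?thesis using const by simp
  qed
qed

end

section \<open>Asymptotically homogeneous banded chains\<close>

locale band_chain = ergodic_chain +
  fixes i0 N :: nat and a :: "int \<Rightarrow> real" and \<tau> :: real
  assumes band: "\<And>i j. i0 \<le> i \<Longrightarrow> int N < \<bar>int i - int j\<bar> \<Longrightarrow> P i j = 0"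
    and a_lim: "\<And>m. m \<in> {- int N..int N} \<Longrightarrow> (\<lambda>i. P i (nat (int i + m))) \<longlonglongrightarrow> a m"
    and tau_nonneg: "0 \<le> \<tau>" and tau_less_1: "\<tau> < 1"
    and tau_lim: "(\<lambda>i. \<pi> (i + 1) / \<pi> i) \<longlonglongrightarrow> \<tau>"
    and drift: "(\<Sum>k = - int N..int N. real_of_int k * a k) < 0"
begin

definition q :: "nat \<Rightarrow> real" where "q i = sqrt (\<pi> i)"

lemma q_pos [simp]: "0 < q i" by (simp add: q_def pi_pos)
lemma q_nonneg [simp]: "0 \<le> q i" by (rule less_imp_le[OF q_pos])
lemma q_neq_0 [simp]: "q i \<noteq> 0" by (metis q_pos order_less_irrefl)
lemma q_square: "q i * q i = \<pi> i" by (simp add: q_def pi_nonneg)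

lemma pi_le_1: "\<pi> i \<le> 1"
  using sum_le_suminf[OF sums_summable[OF pi_sums], of "{i}"] pi_sums pi_nonneg by (simp add: sums_iff)

lemma q_le_1: "q i \<le> 1" by (simp add: q_def pi_le_1)

lemma q_ratio_lim: "(\<lambda>i. q (i + k) / q i) \<longlonglongrightarrow> sqrt (\<tau> ^ k)"
proof -
  have "(\<lambda>i. \<pi> (i + k) / \<pi> i) \<longlonglongrightarrow> \<tau> ^ k"
  proof (induction k)
    case 0
    have "\<pi> i \<noteq> 0" for i using pi_pos[of i] by simp
    then show ?case by simp
  next
    case (Suc k)
    have "(\<lambda>i. \<pi> (i + k + 1) / \<pi> (i + k) * (\<pi> (i + k) / \<pi> i)) \<longlonglongrightarrow> \<tau> * \<tau> ^ k"
      by (intro tendsto_mult Suc LIMSEQ_ignore_initial_segment[OF tau_lim, of k])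
    moreover have "\<pi> (i + k) \<noteq> 0" for i using pi_pos[of "i + k"] by simp
    ultimately show ?case by simp
  qed
  then show ?thesis unfolding q_def real_sqrt_divide[symmetric] by (rule tendsto_real_sqrt)
qed

lemma q_eventually_contracts: "\<exists>c<1. \<exists>n. \<forall>i\<ge>n. q (Suc i) \<le> c * q i"
proof -
  have "sqrt \<tau> < 1" using tau_less_1 by simp
  then obtain c where c: "sqrt \<tau> < c" "c < 1" using dense by blast
  have "\<forall>\<^sub>F i in sequentially. q (i + 1) / q i < c"
    using order_tendstoD(2)[OF q_ratio_lim[of 1], of c] c by simp
  then obtain n where "\<And>i. n \<le> i \<Longrightarrow> q (i + 1) / q i < c" by (auto simp: eventually_sequentially)
  then have "q (Suc i) \<le> c * q i" if "n \<le> i" for i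
    using that by (force simp: divide_less_eq)
  then show ?thesis using c(2) by blast
qed

lemma q_summable: "summable q"
proof -
  obtain c n where "c < 1" "\<And>i. n \<le> i \<Longrightarrow> q (Suc i) \<le> c * q i" using q_eventually_contracts by blast
  then show ?thesis by (intro summable_ratio_test[of c n]) auto
qed

lemma q_eventually_decreasing: "\<exists>n. \<forall>k\<ge>n. \<forall>l. q (k + l) \<le> q k"
proof -
  obtain c n where c: "c < 1" "\<And>i. n \<le> i \<Longrightarrow> q (Suc i) \<le> c * q i" using q_eventually_contracts by blast
  have dec: "q (Suc i) \<le> q i" if "n \<le> i" for i
  proof -
    have "c * q i \<le> 1 * q i" using c(1) by (intro mult_right_mono) auto
    then show ?thesis using c(2)[OF that] by linarith
  qed
  have "q (k + l) \<le> q k" if "n \<le> k" for k l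
  proof (induction l)
    case (Suc l) then show ?case using dec[of "k + l"] that by simp
  qed simp
  then show ?thesis by blast
qed

definition A :: "nat \<Rightarrow> nat \<Rightarrow> real" where "A i j = q i * P i j / q j"

text \<open>
  The limit of the entries of \<open>A\<close> along the \<open>m\<close>-th diagonal.  For \<open>\<tau> = 0\<close> all diagonals except the main one
  vanish in the limit.
\<close>

definition \<alpha> :: "int \<Rightarrow> real" where
  "\<alpha> m = (if \<tau> = 0 then if m = 0 then a 0 else 0 else a m * \<tau> powr (- real_of_int m / 2))"

lemma \<alpha>_zero: "\<tau> = 0 \<Longrightarrow> \<alpha> m = (if m = 0 then a 0 else 0)"
  unfolding \<alpha>_def by simp

lemma A_nonneg: "0 \<le> A i j" by (simp add: A_def)

lemma A_le: "A i j \<le> q j / q i"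
proof -
  have "A i j \<le> q i * (\<pi> j / \<pi> i) / q j"
    unfolding A_def by (intro divide_right_mono mult_left_mono P_le) auto
  also have "\<dots> = q j / q i" by (simp add: q_square[symmetric])
  finally show ?thesis .
qed

lemma sqrt_power_tau: "0 < \<tau> \<Longrightarrow> sqrt (\<tau> ^ k) = \<tau> powr (real k / 2)"
  by (simp add: powr_half_sqrt[symmetric] powr_powr flip: powr_realpow)

lemma q_quotient_lim:
  assumes "0 < \<tau>"
  shows "(\<lambda>i. q i / q (nat (int i + m))) \<longlonglongrightarrow> \<tau> powr (- real_of_int m / 2)"
proof (cases "0 \<le> m")
  case True
  then obtain k where m: "m = int k" by (metis nonneg_int_cases)
  have "(\<lambda>i. inverse (q (i + k) / q i)) \<longlonglongrightarrow> inverse (sqrt (\<tau> ^ k))"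
    using assms by (intro tendsto_inverse q_ratio_lim) simp
  moreover have "nat (int i + m) = i + k" for i by (simp add: m)
  ultimately show ?thesis using assms by (simp add: sqrt_power_tau m powr_minus)
next
  case False
  then obtain k where m: "m = - int k" by (metis int_cases2 of_nat_0_le_iff)
  show ?thesis
  proof (rule LIMSEQ_offset[where k = k])
    have "nat (int (i + k) + m) = i" for i by (simp add: m)
    then show "(\<lambda>i. q (i + k) / q (nat (int (i + k) + m))) \<longlonglongrightarrow> \<tau> powr (- real_of_int m / 2)"
      using q_ratio_lim[of k] assms by (simp add: sqrt_power_tau m)
  qed
qed

text \<open>
  For \<open>\<tau> > 0\<close> this is the product of the two given limits.  For \<open>\<tau> = 0\<close> and \<open>m > 0\<close> the factor \<open>q(i) / q(i + m)\<close>
  explodes, and the bound \<open>A(i,j) \<le> q(j) / q(i)\<close>, a consequence of invariance, is what forces the limit \<open>0\<close>.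
\<close>

lemma A_lim:
  assumes m: "m \<in> {- int N..int N}"
  shows "(\<lambda>i. A i (nat (int i + m))) \<longlonglongrightarrow> \<alpha> m"
proof (cases "\<tau> = 0")
  case False
  then have "0 < \<tau>" using tau_nonneg by simp
  then have "(\<lambda>i. P i (nat (int i + m)) * (q i / q (nat (int i + m)))) \<longlonglongrightarrow> a m * \<tau> powr (- real_of_int m / 2)"
    by (intro tendsto_mult a_lim[OF m] q_quotient_lim)
  then show ?thesis using False by (simp add: A_def \<alpha>_def mult.commute)
next
  case True
  consider "m = 0" | k where "m = int k" "0 < k" | k where "m = - int k" "0 < k"
    by (cases m rule: int_cases3) auto
  then show ?thesis
  proof cases
    case 1
    then show ?thesis using a_lim[OF m] unfolding \<alpha>_zero[OF True] by (simp add: A_def)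
  next
    case 2
    have "(\<lambda>i. q (i + k) / q i) \<longlonglongrightarrow> 0" using q_ratio_lim[of k] 2 True by (simp add: zero_power)
    then have "(\<lambda>i. A i (i + k)) \<longlonglongrightarrow> 0"
      by (rule tendsto_sandwich[OF _ _ tendsto_const, rotated 2]) (simp_all add: A_nonneg A_le)
    moreover have "nat (int i + m) = i + k" for i by (simp add: 2)
    ultimately show ?thesis using 2 unfolding \<alpha>_zero[OF True] by simp
  next
    case 3
    show ?thesis
    proof (rule LIMSEQ_offset[where k = k])
      have lim: "(\<lambda>i. q (i + k) / q i) \<longlonglongrightarrow> 0" using q_ratio_lim[of k] 3 True by (simp add: zero_power)
      have le: "A (i + k) i \<le> q (i + k) / q i" for i
      proof -
        have "P (i + k) i \<le> 1"
          using sum_le_suminf[OF sums_summable[OF P_sums], of "{i}" "i + k"] P_sums[of "i + k"]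
          by (simp add: sums_iff)
        then have "q (i + k) * P (i + k) i / q i \<le> q (i + k) * 1 / q i"
          by (intro divide_right_mono mult_left_mono) auto
        then show ?thesis by (simp add: A_def)
      qed
      have "(\<lambda>i. A (i + k) i) \<longlonglongrightarrow> 0"
        by (rule tendsto_sandwich[OF _ _ tendsto_const lim]) (simp_all add: A_nonneg le)
      moreover have "nat (int (i + k) + m) = i" for i by (simp add: 3)
      ultimately show "(\<lambda>i. A (i + k) (nat (int (i + k) + m))) \<longlonglongrightarrow> \<alpha> m"
        using 3 unfolding \<alpha>_zero[OF True] by simp
    qed
  qed
qed

lemma sum_alpha: "(\<Sum>m = - int N..int N. \<alpha> m) = alpha0 N a \<tau>"
proof (cases "\<tau> = 0")
  case True
  have "(\<Sum>m = - int N..int N. \<alpha> m) = (\<Sum>m = - int N..int N. if m = 0 then a 0 else 0)"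
    unfolding \<alpha>_zero[OF True] ..
  also have "\<dots> = a 0" by (subst sum.delta) auto
  finally show ?thesis using True by (simp add: alpha0_def)
qed (simp add: alpha0_def \<alpha>_def)

lemma band_row_sums:
  assumes "i0 \<le> i" "N \<le> i"
  shows "(\<lambda>j. P i j * w j) sums (\<Sum>m = - int N..int N. P i (nat (int i + m)) * w (nat (int i + m)))"
proof -
  have "(\<lambda>j. P i j * w j) sums (\<Sum>j\<in>{i - N..i + N}. P i j * w j)"
    using band[OF assms(1)] by (intro sums_finite) auto
  also have "(\<Sum>j\<in>{i - N..i + N}. P i j * w j) =
      (\<Sum>m = - int N..int N. P i (nat (int i + m)) * w (nat (int i + m)))"
    using assms(2)
    by (intro sum.reindex_bij_witness[of _ "\<lambda>m. nat (int i + m)" "\<lambda>j. int j - int i"]) auto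
  finally show ?thesis .
qed

lemma band_column_sum:
  assumes "N \<le> j"
  shows "(\<Sum>i\<in>{j - N..j + N}. f i) = (\<Sum>m = - int N..int N. f (nat (int j - m)) :: real)"
  using assms
  by (intro sum.reindex_bij_witness[of _ "\<lambda>m. nat (int j - m)" "\<lambda>i. int j - int i"]) auto

lemma shift_at_top: "filterlim (\<lambda>j. nat (int j - m)) at_top sequentially"
  unfolding filterlim_at_top eventually_sequentially
proof
  fix Z
  have "\<forall>n\<ge>Z + nat \<bar>m\<bar>. Z \<le> nat (int n - m)" by auto
  then show "\<exists>M. \<forall>n\<ge>M. Z \<le> nat (int n - m)" by blast
qed

lemma shift_lim:
  assumes "(\<lambda>i. f i (nat (int i + m))) \<longlonglongrightarrow> L"
  shows "(\<lambda>j. f (nat (int j - m)) j) \<longlonglongrightarrow> L"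
proof -
  have "(\<lambda>j. f (nat (int j - m)) (nat (int (nat (int j - m)) + m))) \<longlonglongrightarrow> L"
    using filterlim_compose[OF assms shift_at_top[of m]] .
  moreover have "\<forall>\<^sub>F j in sequentially.
      f (nat (int j - m)) (nat (int (nat (int j - m)) + m)) = f (nat (int j - m)) j"
    using eventually_ge_at_top[of "nat \<bar>m\<bar>"]
  proof eventually_elim
    case (elim j)
    then have "nat (int (nat (int j - m)) + m) = j" by auto
    then show ?case by simp
  qed
  ultimately show ?thesis by (rule Lim_transform_eventually)
qed

lemma sum_a: "(\<Sum>m = - int N..int N. a m) = 1"
proof -
  have "(\<lambda>i. \<Sum>m = - int N..int N. P i (nat (int i + m))) \<longlonglongrightarrow> (\<Sum>m = - int N..int N. a m)"
    by (intro tendsto_sum a_lim)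
  moreover have "\<forall>\<^sub>F i in sequentially. (\<Sum>m = - int N..int N. P i (nat (int i + m))) = 1"
    using eventually_ge_at_top[of "max i0 N"]
  proof eventually_elim
    case (elim i)
    then show ?case using sums_unique2[OF band_row_sums[of i "\<lambda>_. 1"], of 1] P_sums[of i] by simp
  qed
  then have "(\<lambda>i. \<Sum>m = - int N..int N. P i (nat (int i + m))) \<longlonglongrightarrow> 1"
    by (rule tendsto_eventually)
  ultimately show ?thesis by (rule LIMSEQ_unique)
qed

lemma a_nonneg: "m \<in> {- int N..int N} \<Longrightarrow> 0 \<le> a m"
  by (rule LIMSEQ_le_const[OF a_lim]) auto

lemma ex_a_pos: "\<exists>m\<in>{- int N..int N}. m \<noteq> 0 \<and> 0 < a m"
proof (rule ccontr)
  assume "\<not> ?thesis"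
  then have "real_of_int m * a m = 0" if "m \<in> {- int N..int N}" for m
    using a_nonneg[OF that] that by force
  then have "(\<Sum>k = - int N..int N. real_of_int k * a k) = 0" by (intro sum.neutral) blast
  then show False using drift by simp
qed

lemma alpha0_nonneg: "0 \<le> alpha0 N a \<tau>"
  unfolding sum_alpha[symmetric]
  by (intro sum_nonneg) (auto simp: \<alpha>_def intro!: mult_nonneg_nonneg a_nonneg)

text \<open>
  Row sums give \<open>\<Sum>m. a m = 1\<close>, and invariance of \<open>\<pi>\<close> gives \<open>\<Sum>m. a m * (t m)\<^sup>2 \<le> 1\<close> with
  \<open>t m = \<tau> powr (- m / 2)\<close>.  Since \<open>\<alpha>\<^sub>0\<close> is the sum of the \<open>a m * t m\<close>, the sum of \<open>a m * (1 - t m)\<^sup>2\<close> is at most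
  \<open>2 - 2 * \<alpha>\<^sub>0\<close>; it is positive because the drift condition provides some \<open>m \<noteq> 0\<close> with \<open>a m > 0\<close>.
\<close>

lemma alpha0_less_1: "alpha0 N a \<tau> < 1"
proof (cases "\<tau> = 0")
  case True
  obtain m where m: "m \<in> {- int N..int N}" "m \<noteq> 0" "0 < a m" using ex_a_pos by blast
  have "a 0 + a m = (\<Sum>m\<in>{0, m}. a m)" using m by simp
  also have "\<dots> \<le> (\<Sum>m = - int N..int N. a m)" using m by (intro sum_mono2) (auto intro: a_nonneg)
  finally show ?thesis using m sum_a True by (simp add: alpha0_def)
next
  case False
  then have pos: "0 < \<tau>" using tau_nonneg by simp
  define t where "t m = \<tau> powr (- real_of_int m / 2)" for m
  have \<alpha>0: "alpha0 N a \<tau> = (\<Sum>m = - int N..int N. a m * t m)" using False by (simp add: alpha0_def t_def)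
  have "(\<lambda>j. \<Sum>m = - int N..int N. P (nat (int j - m)) j * (q (nat (int j - m)) / q j)\<^sup>2)
      \<longlonglongrightarrow> (\<Sum>m = - int N..int N. a m * (t m)\<^sup>2)"
    using pos unfolding t_def
    by (intro tendsto_sum tendsto_mult tendsto_power shift_lim[where f = P] a_lim
        shift_lim[where f = "\<lambda>i j. q i / q j"] q_quotient_lim)
  moreover have "\<forall>\<^sub>F j in sequentially.
      (\<Sum>m = - int N..int N. P (nat (int j - m)) j * (q (nat (int j - m)) / q j)\<^sup>2) \<le> 1"
    using eventually_ge_at_top[of N]
  proof eventually_elim
    case (elim j)
    have "(\<Sum>m = - int N..int N. P (nat (int j - m)) j * (q (nat (int j - m)) / q j)\<^sup>2) =
        (\<Sum>i\<in>{j - N..j + N}. P i j * (q i / q j)\<^sup>2)"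
      by (rule band_column_sum[OF elim, symmetric])
    also have "\<dots> = (\<Sum>i\<in>{j - N..j + N}. \<pi> i * P i j) / \<pi> j"
      unfolding sum_divide_distrib by (intro sum.cong) (auto simp: power2_eq_square q_square[symmetric])
    also have "\<dots> \<le> \<pi> j / \<pi> j"
    proof (intro divide_right_mono pi_nonneg)
      show "(\<Sum>i\<in>{j - N..j + N}. \<pi> i * P i j) \<le> \<pi> j"
        using sum_le_suminf[OF sums_summable[OF pi_P_sums], of "{j - N..j + N}" j] pi_P_sums[of j]
        by (simp add: pi_nonneg sums_iff)
    qed
    also have "\<dots> = 1" using pi_pos[of j] by simp
    finally show ?case .
  qed
  ultimately have le1: "(\<Sum>m = - int N..int N. a m * (t m)\<^sup>2) \<le> 1"
    by (intro tendsto_upperbound) auto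
  obtain m where m: "m \<in> {- int N..int N}" "m \<noteq> 0" "0 < a m" using ex_a_pos by blast
  have "t m \<noteq> 1"
    using m pos tau_less_1 by (simp add: t_def powr_eq_one_iff_gen)
  then have "0 < a m * (1 - t m)\<^sup>2" using m by simp
  also have "\<dots> \<le> (\<Sum>m = - int N..int N. a m * (1 - t m)\<^sup>2)"
    using m a_nonneg by (intro member_le_sum) auto
  also have "\<dots> = (\<Sum>m = - int N..int N. a m) - 2 * (\<Sum>m = - int N..int N. a m * t m)
      + (\<Sum>m = - int N..int N. a m * (t m)\<^sup>2)"
    unfolding sum_distrib_left sum_subtractf[symmetric] sum.distrib[symmetric]
    by (intro sum.cong) (auto simp: power2_eq_square algebra_simps)
  finally show ?thesis using le1 sum_a \<alpha>0 by simp
qed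

text \<open>The kernel minus its invariant projection, transported from the weighted spaces to sequences.\<close>

definition M :: "nat \<Rightarrow> nat \<Rightarrow> real" where "M i j = q i * (P i j - \<pi> j) / q j"

lemma abs_M_le: "\<bar>M i j\<bar> \<le> A i j + q i * q j"
proof -
  have "M i j = A i j - q i * q j" by (simp add: M_def A_def q_square[symmetric] field_simps)
  moreover have "0 \<le> q i * q j" by simp
  ultimately show ?thesis using A_nonneg[of i j] by linarith
qed

lemma A_summable: "summable (A i)"
  by (rule summable_comparison_test'[OF summable_divide[OF q_summable, of "q i"]])
    (simp add: A_nonneg A_le)

lemma M_summable: "summable (\<lambda>j. \<bar>M i j\<bar>)"
  by (rule summable_comparison_test'[OF summable_add[OF A_summable summable_mult[OF q_summable]]])
    (simp, rule abs_M_le)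

lemma row_norm_M_le: "row_norm M i \<le> (\<Sum>j. A i j) + q i * suminf q"
proof -
  have "row_norm M i \<le> (\<Sum>j. A i j + q i * q j)"
    unfolding row_norm_def
    by (intro suminf_le abs_M_le M_summable summable_add A_summable summable_mult q_summable)
  also have "\<dots> = (\<Sum>j. A i j) + q i * suminf q"
    by (simp add: suminf_add[symmetric] A_summable summable_mult q_summable suminf_mult)
  finally show ?thesis .
qed

lemma tail_rows_small:
  assumes "alpha0 N a \<tau> < r" shows "\<forall>\<^sub>F n in sequentially. row_norm M n \<le> r"
proof -
  have "(\<lambda>i. (\<Sum>m = - int N..int N. A i (nat (int i + m))) + q i * suminf q) \<longlonglongrightarrow>
      (\<Sum>m = - int N..int N. \<alpha> m) + 0 * suminf q"
    by (intro tendsto_add tendsto_sum A_lim tendsto_mult summable_LIMSEQ_zero[OF q_summable] tendsto_const)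
  then have "\<forall>\<^sub>F i in sequentially. (\<Sum>m = - int N..int N. A i (nat (int i + m))) + q i * suminf q < r"
    using assms by (intro order_tendstoD(2)) (auto simp: sum_alpha)
  then show ?thesis
    using eventually_ge_at_top[of "max i0 N"]
  proof eventually_elim
    case (elim i)
    have "(\<lambda>j. q i * (P i j * (1 / q j))) sums (q i * (\<Sum>m = - int N..int N.
        P i (nat (int i + m)) * (1 / q (nat (int i + m)))))"
      using elim by (intro sums_mult band_row_sums) auto
    then have "(\<Sum>j. A i j) = (\<Sum>m = - int N..int N. A i (nat (int i + m)))"
      by (simp add: A_def sums_iff sum_distrib_left)
    then show ?case using row_norm_M_le[of i] elim by simp
  qed
qed

text \<open>
  A column that meets the rows beyond \<open>n0\<close> inside the band has itself a large index, so its band part is close to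
  \<open>\<alpha>\<^sub>0\<close>.  The rank-one part \<open>q(i) q(j)\<close> is summed over \<open>i \<ge> n0\<close> and is small uniformly in \<open>j\<close>.
\<close>

lemma tail_columns_small:
  assumes r: "alpha0 N a \<tau> < r"
  shows "\<forall>\<^sub>F n0 in sequentially. \<forall>j n. (\<Sum>i<n. \<bar>tail_rows n0 M i j\<bar>) \<le> r"
proof -
  \<comment> \<open>One half of the margin is for the band, the other for the rank-one part.\<close>
  define e where "e = (r - alpha0 N a \<tau>) / 2"
  have e: "0 < e" using r by (simp add: e_def)
  have "(\<lambda>j. \<Sum>m = - int N..int N. A (nat (int j - m)) j) \<longlonglongrightarrow> (\<Sum>m = - int N..int N. \<alpha> m)"
    by (intro tendsto_sum shift_lim[where f = A] A_lim)
  then have "\<forall>\<^sub>F j in sequentially. (\<Sum>m = - int N..int N. A (nat (int j - m)) j) < alpha0 N a \<tau> + e"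
    using e by (intro order_tendstoD(2)) (auto simp: sum_alpha)
  then obtain j0 where j0: "\<And>j. j0 \<le> j \<Longrightarrow> (\<Sum>m = - int N..int N. A (nat (int j - m)) j) < alpha0 N a \<tau> + e"
    by (auto simp: eventually_sequentially)
  have "\<forall>\<^sub>F n0 in sequentially. (\<Sum>i. q (i + n0)) < e"
  proof (rule order_tendstoD(2))
    have "(\<lambda>n. suminf q - (\<Sum>i<n. q i)) \<longlonglongrightarrow> suminf q - suminf q"
      by (intro tendsto_diff tendsto_const summable_LIMSEQ q_summable)
    then show "(\<lambda>n. \<Sum>i. q (i + n)) \<longlonglongrightarrow> 0"
      by (simp add: suminf_minus_initial_segment[OF q_summable])
  qed (rule e)
  then show ?thesis
    using eventually_ge_at_top[of "i0 + 2 * N + j0"]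
  proof eventually_elim
    case (elim n0)
    show ?case
    proof (intro allI)
      fix j n
      have Asum: "(\<Sum>i\<in>{n0..<n}. A i j) \<le> alpha0 N a \<tau> + e"
      proof (cases "j + N < n0")
        case True
        then have "A i j = 0" if "i \<in> {n0..<n}" for i
          using band[of i j] elim that by (simp add: A_def)
        then have "(\<Sum>i\<in>{n0..<n}. A i j) = 0" by (intro sum.neutral) blast
        then show ?thesis using alpha0_nonneg e by simp
      next
        case False
        then have j: "N \<le> j" "j0 \<le> j" using elim by auto
        have "A i j = 0" if "i \<in> {n0..<n} - {j - N..j + N}" for i
          using band[of i j] elim that by (auto simp: A_def)
        then have "(\<Sum>i\<in>{n0..<n}. A i j) = (\<Sum>i\<in>{n0..<n} \<inter> {j - N..j + N}. A i j)"
          by (intro sum.mono_neutral_right) auto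
        also have "\<dots> \<le> (\<Sum>i\<in>{j - N..j + N}. A i j)"
          by (intro sum_mono2) (auto simp: A_nonneg)
        also have "\<dots> \<le> alpha0 N a \<tau> + e"
          unfolding band_column_sum[OF j(1)] using j0[OF j(2)] by simp
        finally show ?thesis .
      qed
      have qsum: "(\<Sum>i\<in>{n0..<n}. q i) \<le> e"
      proof -
        have "(\<Sum>i\<in>{n0..<n}. q i) = (\<Sum>i<n - n0. q (i + n0))"
          by (intro sum.reindex_bij_witness[of _ "\<lambda>i. i + n0" "\<lambda>i. i - n0"]) auto
        also have "\<dots> \<le> (\<Sum>i. q (i + n0))"
          using q_summable by (intro sum_le_suminf) (auto simp: summable_iff_shift)
        finally show ?thesis using elim by simp
      qed
      have "(\<Sum>i<n. \<bar>tail_rows n0 M i j\<bar>) = (\<Sum>i\<in>{n0..<n}. \<bar>M i j\<bar>)"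
        by (intro sum.mono_neutral_cong_right) (auto simp: tail_rows_def)
      also have "\<dots> \<le> (\<Sum>i\<in>{n0..<n}. A i j + q i)"
      proof (rule sum_mono)
        fix i
        have "q i * q j \<le> q i * 1" by (intro mult_left_mono q_le_1) simp
        then show "\<bar>M i j\<bar> \<le> A i j + q i" using abs_M_le[of i j] by linarith
      qed
      also have "\<dots> \<le> r" using Asum qsum by (simp add: sum.distrib e_def field_simps)
      finally show "(\<Sum>i<n. \<bar>tail_rows n0 M i j\<bar>) \<le> r" .
    qed
  qed
qed

lemma tail_contraction_M:
  assumes r: "alpha0 N a \<tau> < r"
  shows "\<exists>n0 B. tail_contraction M n0 r B \<and> (\<forall>j n. (\<Sum>i<n. \<bar>tail_rows n0 M i j\<bar>) \<le> r)"
proof -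
  obtain n1 where n1: "\<And>n. n1 \<le> n \<Longrightarrow> row_norm M n \<le> r"
    using tail_rows_small[OF r] by (auto simp: eventually_sequentially)
  obtain n2 where n2: "\<And>n0 j n. n2 \<le> n0 \<Longrightarrow> (\<Sum>i<n. \<bar>tail_rows n0 M i j\<bar>) \<le> r"
    using tail_columns_small[OF r] by (auto simp: eventually_sequentially)
  have nn: "0 \<le> row_norm M i" for i
    unfolding row_norm_def by (intro suminf_nonneg M_summable) simp
  define B where "B = r + (\<Sum>i<n1. row_norm M i)"
  have "0 < r" using r alpha0_nonneg by simp
  have "row_norm M i \<le> B" for i
  proof (cases "i < n1")
    case True
    then have "row_norm M i \<le> (\<Sum>i<n1. row_norm M i)" by (intro member_le_sum) (auto simp: nn)
    then show ?thesis using \<open>0 < r\<close> by (simp add: B_def)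
  next
    case False
    then show ?thesis using n1[of i] sum_nonneg[of "{..<n1}" "row_norm M"] nn by (simp add: B_def)
  qed
  then have "tail_contraction M (max n1 n2) r B"
    using n1 \<open>0 < r\<close> by unfold_locales (auto simp: M_summable)
  then show ?thesis using n2 by (intro exI[of _ "max n1 n2"] exI[of _ B]) auto
qed

end

section \<open>Truncated kernels\<close>

context band_chain
begin

text \<open>
  A row whose entries from column \<open>k\<close> on have been collected in column \<open>k\<close>, as in the last column of \<open>P\<^sub>k\<close>.
\<close>

definition lump :: "nat \<Rightarrow> (nat \<Rightarrow> real) \<Rightarrow> nat \<Rightarrow> real" where
  "lump k x j = (if j < k then x j else (\<Sum>l. x (k + l)))"

text \<open>
  The counterpart of \<open>M\<close> for \<open>P\<^sub>k\<close>, extended by zero.  The invariant measure is lumped like the rows of the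
  kernel, so the restriction of \<open>q\<close> to \<open>{0..k}\<close>, which represents the constants, is still annihilated.
\<close>

definition M_trunc :: "nat \<Rightarrow> nat \<Rightarrow> nat \<Rightarrow> real" where
  "M_trunc k i j = (if i \<le> k \<and> j \<le> k then q i * (lump k (P i) j - lump k \<pi> j) / q j else 0)"

lemma P_summable_row: "summable (P i)" by (rule sums_summable[OF P_sums])
lemma pi_summable: "summable \<pi>" by (rule sums_summable[OF pi_sums])

lemma sum_lump:
  assumes "summable x" shows "(\<Sum>j\<le>k. lump k x j) = suminf x"
proof -
  have "(\<Sum>j\<le>k. lump k x j) = (\<Sum>j<k. x j) + (\<Sum>l. x (k + l))"
    by (simp add: lessThan_Suc_atMost[symmetric] lump_def)
  then show ?thesis using suminf_split_initial_segment[OF assms, of k] by (simp add: add.commute)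
qed

lemma M_trunc_eq_M: "i \<le> k \<Longrightarrow> j < k \<Longrightarrow> M_trunc k i j = M i j"
  by (simp add: M_trunc_def M_def lump_def)

lemma M_tail_summable: "summable (\<lambda>l. \<bar>M i (k + l)\<bar>)"
  using summable_iff_shift[of "\<lambda>j. \<bar>M i j\<bar>" k] M_summable by (simp add: add.commute)

text \<open>
  Where \<open>q\<close> takes its largest value beyond \<open>k\<close> at \<open>k\<close> itself, dividing the lumped entries by \<open>q(k)\<close> instead of
  \<open>q(k + l)\<close> only shrinks them.
\<close>

lemma M_trunc_last:
  assumes dec: "\<And>l. q (k + l) \<le> q k"
  shows "\<bar>M_trunc k i k\<bar> \<le> (\<Sum>l. \<bar>M i (k + l)\<bar>)"
proof (cases "i \<le> k")
  case True
  have s: "summable (\<lambda>l. P i (k + l))" "summable (\<lambda>l. \<pi> (k + l))"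
    using summable_iff_shift[of "P i" k] summable_iff_shift[of \<pi> k] P_summable_row pi_summable
    by (simp_all add: add.commute)
  have le: "\<bar>q i * (P i (k + l) - \<pi> (k + l)) / q k\<bar> \<le> \<bar>M i (k + l)\<bar>" for l
  proof -
    have "\<bar>q i * (P i (k + l) - \<pi> (k + l))\<bar> / q k \<le> \<bar>q i * (P i (k + l) - \<pi> (k + l))\<bar> / q (k + l)"
      by (intro divide_left_mono dec) auto
    then show ?thesis by (simp add: M_def)
  qed
  have sa: "summable (\<lambda>l. \<bar>q i * (P i (k + l) - \<pi> (k + l)) / q k\<bar>)"
    using le by (intro summable_comparison_test'[OF M_tail_summable[of i k]]) simp
  have "M_trunc k i k = (\<Sum>l. q i * (P i (k + l) - \<pi> (k + l)) / q k)"
    using True s by (simp add: M_trunc_def lump_def suminf_diff suminf_mult suminf_divide summable_diff summable_mult)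
  also have "\<bar>\<dots>\<bar> \<le> (\<Sum>l. \<bar>q i * (P i (k + l) - \<pi> (k + l)) / q k\<bar>)"
    by (rule summable_rabs[OF sa])
  also have "\<dots> \<le> (\<Sum>l. \<bar>M i (k + l)\<bar>)" by (intro suminf_le le sa M_tail_summable)
  finally show ?thesis .
next
  case False
  then show ?thesis by (auto simp: M_trunc_def intro!: suminf_nonneg M_tail_summable)
qed

lemma M_trunc_summable: "summable (\<lambda>j. \<bar>M_trunc k i j\<bar>)"
  by (rule summable_finite[of "{..k}"]) (auto simp: M_trunc_def)

lemma row_norm_M_trunc_le:
  assumes dec: "\<And>l. q (k + l) \<le> q k"
  shows "row_norm (M_trunc k) i \<le> row_norm M i"
proof (cases "i \<le> k")
  case True
  have "row_norm (M_trunc k) i = (\<Sum>j\<le>k. \<bar>M_trunc k i j\<bar>)"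
    unfolding row_norm_def by (rule suminf_finite) (auto simp: M_trunc_def)
  also have "\<dots> = (\<Sum>j<k. \<bar>M i j\<bar>) + \<bar>M_trunc k i k\<bar>"
    using True by (simp add: lessThan_Suc_atMost[symmetric] M_trunc_eq_M)
  also have "\<dots> \<le> (\<Sum>j<k. \<bar>M i j\<bar>) + (\<Sum>l. \<bar>M i (k + l)\<bar>)"
    by (intro add_left_mono M_trunc_last dec)
  also have "\<dots> = row_norm M i"
    unfolding row_norm_def using suminf_split_initial_segment[OF M_summable, of i k]
    by (simp add: add.commute)
  finally show ?thesis .
next
  case False
  then have "row_norm (M_trunc k) i = 0" by (simp add: row_norm_def M_trunc_def)
  then show ?thesis by (simp add: row_norm_def suminf_nonneg M_summable)
qed

lemma row_norm_M_trunc_diff_le: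
  assumes dec: "\<And>l. q (k + l) \<le> q k" and "i \<le> k"
  shows "row_norm (\<lambda>i j. M_trunc k i j - M i j) i \<le> 2 * (\<Sum>l. \<bar>M i (k + l)\<bar>)"
proof -
  let ?d = "\<lambda>j. \<bar>M_trunc k i j - M i j\<bar>"
  have sd: "summable ?d"
    by (rule summable_comparison_test'[OF summable_add[OF M_trunc_summable M_summable]])
      (simp, rule abs_triangle_ineq4)
  have e: "(\<lambda>l. if l = 0 then \<bar>M_trunc k i k\<bar> else 0) sums \<bar>M_trunc k i k\<bar>"
    using sums_single[of 0 "\<lambda>_. \<bar>M_trunc k i k\<bar>"] by simp
  have "(\<Sum>j<k. ?d j) = 0" using assms(2) by (simp add: M_trunc_eq_M)
  then have "row_norm (\<lambda>i j. M_trunc k i j - M i j) i = (\<Sum>l. ?d (l + k))"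
    using suminf_split_initial_segment[OF sd, of k] by (simp add: row_norm_def)
  also have "\<dots> \<le> (\<Sum>l. (if l = 0 then \<bar>M_trunc k i k\<bar> else 0) + \<bar>M i (k + l)\<bar>)"
  proof (rule suminf_le)
    show "?d (l + k) \<le> (if l = 0 then \<bar>M_trunc k i k\<bar> else 0) + \<bar>M i (k + l)\<bar>" for l
      by (cases "l = 0") (simp_all add: M_trunc_def add.commute abs_triangle_ineq4 del: abs_diff_le_iff)
    show "summable (\<lambda>l. ?d (l + k))" using summable_iff_shift[of ?d k] sd by blast
    show "summable (\<lambda>l. (if l = 0 then \<bar>M_trunc k i k\<bar> else 0) + \<bar>M i (k + l)\<bar>)"
      by (intro summable_add M_tail_summable sums_summable[OF e])
  qed
  also have "\<dots> = \<bar>M_trunc k i k\<bar> + (\<Sum>l. \<bar>M i (k + l)\<bar>)"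
    using suminf_add[OF sums_summable[OF e] M_tail_summable[of i k]] e by (simp add: sums_iff)
  finally show ?thesis using M_trunc_last[OF dec, of i] by simp
qed

text \<open>
  Monotonicity of \<open>q\<close>, and with it the bounds for the truncation, starts at some index \<open>k1\<close>; before it, the
  sequence is filled with \<open>M\<close> itself.
\<close>

lemma truncation_limit:
  assumes "tail_contraction M n0 r B"
  shows "\<exists>k1. tail_contraction_limit M n0 r B (\<lambda>k. if k < k1 then M else M_trunc k)"
proof -
  interpret tail_contraction M n0 r B by (rule assms)
  obtain k1 where k1: "\<And>k l. k1 \<le> k \<Longrightarrow> q (k + l) \<le> q k" using q_eventually_decreasing by blast
  have "tail_contraction_limit M n0 r B (\<lambda>k. if k < k1 then M else M_trunc k)"
  proof (rule tail_contraction_limit.intro[OF assms], rule tail_contraction_limit_axioms.intro)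
    fix k
    show "tail_contraction (if k < k1 then M else M_trunc k) n0 r B"
    proof (cases "k < k1")
      case True then show ?thesis using assms by simp
    next
      case False
      then have le: "row_norm (M_trunc k) i \<le> row_norm M i" for i by (intro row_norm_M_trunc_le k1) simp
      have "tail_contraction (M_trunc k) n0 r B"
        using order_trans[OF le row_le] order_trans[OF le tail_row_le]
        by unfold_locales (auto simp: M_trunc_summable r_pos)
      then show ?thesis using False by simp
    qed
  next
    fix i
    let ?d = "\<lambda>k. row_norm (\<lambda>i j. (if k < k1 then M else M_trunc k) i j - M i j) i"
    have "(\<lambda>k. suminf (\<lambda>j. \<bar>M i j\<bar>) - (\<Sum>j<k. \<bar>M i j\<bar>)) \<longlonglongrightarrow>
        suminf (\<lambda>j. \<bar>M i j\<bar>) - suminf (\<lambda>j. \<bar>M i j\<bar>)"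
      by (intro tendsto_diff tendsto_const summable_LIMSEQ M_summable)
    then have "(\<lambda>k. 2 * (\<Sum>l. \<bar>M i (k + l)\<bar>)) \<longlonglongrightarrow> 2 * 0"
      by (intro tendsto_mult tendsto_const)
        (simp add: suminf_minus_initial_segment[OF M_summable, symmetric] add.commute)
    then have lim: "(\<lambda>k. 2 * (\<Sum>l. \<bar>M i (k + l)\<bar>)) \<longlonglongrightarrow> 0" by simp
    show "?d \<longlonglongrightarrow> 0"
    proof (rule tendsto_sandwich[OF _ _ tendsto_const lim])
      have s: "summable (\<lambda>j. \<bar>M_trunc k i j - M i j\<bar>)" for k
        by (rule summable_comparison_test'[OF summable_add[OF M_trunc_summable M_summable]])
          (simp, rule abs_triangle_ineq4)
      show "\<forall>\<^sub>F k in sequentially. 0 \<le> ?d k"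
        by (intro always_eventually allI) (auto simp: row_norm_def intro!: suminf_nonneg s)
      show "\<forall>\<^sub>F k in sequentially. ?d k \<le> 2 * (\<Sum>l. \<bar>M i (k + l)\<bar>)"
        using eventually_ge_at_top[of "max k1 i"]
      proof eventually_elim
        case (elim k)
        then show ?case using row_norm_M_trunc_diff_le[OF k1, of k i] by simp
      qed
    qed
  qed
  then show ?thesis by blast
qed

lemma kernel_op_M_trunc:
  "kernel_op (M_trunc k) y i = (if i \<le> k then complex_of_real (q i) *
     (\<Sum>j\<le>k. complex_of_real (lump k (P i) j - lump k \<pi> j) * (y j / complex_of_real (q j))) else 0)"
proof -
  have "kernel_op (M_trunc k) y i = (\<Sum>j\<le>k. complex_of_real (M_trunc k i j) * y j)"
    unfolding kernel_op_def by (rule suminf_finite) (auto simp: M_trunc_def)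
  then show ?thesis by (auto simp: M_trunc_def sum_distrib_left intro!: sum.cong)
qed

lemma mem_spectrum_truncated:
  "z \<in> spectrum (truncated_kernel P k) \<longleftrightarrow>
    (\<exists>g. (\<exists>i\<le>k. g i \<noteq> 0) \<and> (\<forall>i\<le>k. (\<Sum>j\<le>k. complex_of_real (lump k (P i) j) * g j) = z * g i))"
proof -
  define T where "T = truncated_kernel P k"
  have T: "T \<in> carrier_mat (k + 1) (k + 1)" by (simp add: T_def truncated_kernel_def)
  have Tv: "vec_index (T *\<^sub>v v) i = (\<Sum>j\<le>k. complex_of_real (lump k (P i) j) * vec_index v j)"
    if "v \<in> carrier_vec (k + 1)" "i \<le> k" for v i
    using that
    by (auto simp: T_def truncated_kernel_def scalar_prod_def lump_def atLeast0LessThan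
        simp flip: lessThan_Suc_atMost intro!: sum.cong)
  show ?thesis
  proof
    assume "z \<in> spectrum (truncated_kernel P k)"
    then obtain v where v: "v \<in> carrier_vec (k + 1)" "v \<noteq> 0\<^sub>v (k + 1)" "T *\<^sub>v v = z \<cdot>\<^sub>v v"
      using T by (auto simp: spectrum_def eigenvalue_def eigenvector_def T_def[symmetric])
    have "\<exists>i\<le>k. vec_index v i \<noteq> 0"
    proof (rule ccontr)
      assume "\<not> ?thesis"
      then have "v = 0\<^sub>v (k + 1)" using v(1) by (intro eq_vecI) auto
      then show False using v(2) by contradiction
    qed
    moreover have "(\<Sum>j\<le>k. complex_of_real (lump k (P i) j) * vec_index v j) = z * vec_index v i" if "i \<le> k" for i
      using Tv[OF v(1) that] v(1) that unfolding v(3) by simp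
    ultimately show "\<exists>g. (\<exists>i\<le>k. g i \<noteq> 0) \<and>
        (\<forall>i\<le>k. (\<Sum>j\<le>k. complex_of_real (lump k (P i) j) * g j) = z * g i)" by blast
  next
    assume "\<exists>g. (\<exists>i\<le>k. g i \<noteq> 0) \<and>
        (\<forall>i\<le>k. (\<Sum>j\<le>k. complex_of_real (lump k (P i) j) * g j) = z * g i)"
    then obtain g i0 where g: "i0 \<le> k" "g i0 \<noteq> 0"
      "\<And>i. i \<le> k \<Longrightarrow> (\<Sum>j\<le>k. complex_of_real (lump k (P i) j) * g j) = z * g i" by blast
    define v where "v = Matrix.vec (k + 1) g"
    have v: "v \<in> carrier_vec (k + 1)" by (simp add: v_def)
    have "vec_index v i0 \<noteq> vec_index (0\<^sub>v (k + 1)) i0" using g by (simp add: v_def)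
    then have "v \<noteq> 0\<^sub>v (k + 1)" by metis
    moreover have "T *\<^sub>v v = z \<cdot>\<^sub>v v"
    proof (rule eq_vecI)
      fix i assume "i < dim_vec (z \<cdot>\<^sub>v v)"
      then have i: "i \<le> k" by (simp add: v_def)
      have "vec_index (T *\<^sub>v v) i = (\<Sum>j\<le>k. complex_of_real (lump k (P i) j) * g j)"
        unfolding Tv[OF v i] by (intro sum.cong) (auto simp: v_def)
      then show "vec_index (T *\<^sub>v v) i = vec_index (z \<cdot>\<^sub>v v) i" using g(3)[OF i] i by (simp add: v_def)
    qed (use T in \<open>simp add: v_def\<close>)
    ultimately show "z \<in> spectrum (truncated_kernel P k)"
      using T v by (auto simp: spectrum_def eigenvalue_def eigenvector_def T_def[symmetric])
  qed
qed

text \<open>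
  Subtracting the (truncated) invariant projection only moves the eigenvalue \<open>1\<close> of constant
  functions: for \<open>z \<noteq> 0, 1\<close>, eigenvectors correspond to each other by adding a constant.
\<close>

lemma spectrum_truncated_iff:
  assumes z: "z \<noteq> 0" "z \<noteq> 1"
  shows "z \<in> spectrum (truncated_kernel P k) \<longleftrightarrow>
    (\<exists>y. Bseq y \<and> (\<exists>i. y i \<noteq> 0) \<and> (\<forall>i. kernel_op (M_trunc k) y i = z * y i))"
proof -
  have sP: "(\<Sum>j\<le>k. complex_of_real (lump k (P i) j)) = 1" for i
    using sum_lump[OF P_summable_row, of k i] P_sums[of i] by (simp add: sums_iff flip: of_real_sum)
  have sp: "(\<Sum>j\<le>k. complex_of_real (lump k \<pi> j)) = 1"
    using sum_lump[OF pi_summable, of k] pi_sums by (simp add: sums_iff flip: of_real_sum)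
  let ?P = "\<lambda>g i. \<Sum>j\<le>k. complex_of_real (lump k (P i) j) * g j"
  let ?p = "\<lambda>g. \<Sum>j\<le>k. complex_of_real (lump k \<pi> j) * g j"
  have diff: "(\<Sum>j\<le>k. complex_of_real (lump k (P i) j - lump k \<pi> j) * g j) = ?P g i - ?p g" for g i
    by (simp add: left_diff_distrib sum_subtractf)
  show ?thesis
  proof
    assume "z \<in> spectrum (truncated_kernel P k)"
    then obtain g i1 where g: "i1 \<le> k" "g i1 \<noteq> 0" "\<And>i. i \<le> k \<Longrightarrow> ?P g i = z * g i"
      unfolding mem_spectrum_truncated by blast
    \<comment> \<open>Subtracting \<open>c\<close> absorbs the mean term: \<open>z * g i - ?p g = z * (g i - c)\<close>.\<close>
    define c where "c = ?p g / z"
    define y where "y i = (if i \<le> k then complex_of_real (q i) * (g i - c) else 0)" for i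
    have "kernel_op (M_trunc k) y i = z * y i" for i
    proof (cases "i \<le> k")
      case True
      then have yi: "y i = complex_of_real (q i) * (g i - c)" by (simp add: y_def)
      have "kernel_op (M_trunc k) y i = complex_of_real (q i) *
          (\<Sum>j\<le>k. complex_of_real (lump k (P i) j - lump k \<pi> j) * (g j - c))"
        using True unfolding kernel_op_M_trunc by (auto simp: y_def intro!: sum.cong)
      also have "(\<Sum>j\<le>k. complex_of_real (lump k (P i) j - lump k \<pi> j) * (g j - c)) = ?P g i - ?p g"
        unfolding diff by (simp add: right_diff_distrib sum_subtractf sP sp flip: sum_distrib_right)
      also have "\<dots> = z * (g i - c)" using g(3)[OF True] z by (simp add: c_def right_diff_distrib)
      finally show ?thesis by (simp add: yi mult_ac)
    qed (simp add: kernel_op_M_trunc y_def)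
    moreover have "\<exists>i. y i \<noteq> 0"
    proof (rule ccontr)
      assume "\<not> (\<exists>i. y i \<noteq> 0)"
      then have gc: "g i = c" if "i \<le> k" for i using that by (auto simp: y_def split: if_splits)
      have "?P g i1 = (\<Sum>j\<le>k. complex_of_real (lump k (P i1) j)) * c"
        unfolding sum_distrib_right by (intro sum.cong) (auto simp: gc)
      then have "c = z * c" using g(1,3) by (simp add: sP gc)
      then show False using g(1,2) gc z by simp
    qed
    moreover have "Bseq y"
    proof (rule BseqI')
      show "norm (y i) \<le> (\<Sum>j\<le>k. norm (y j))" for i
        using member_le_sum[of i "{..k}" "\<lambda>j. norm (y j)"] by (cases "i \<le> k") (auto simp: y_def intro: sum_nonneg)
    qed
    ultimately show "\<exists>y. Bseq y \<and> (\<exists>i. y i \<noteq> 0) \<and> (\<forall>i. kernel_op (M_trunc k) y i = z * y i)" by blast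
  next
    assume "\<exists>y. Bseq y \<and> (\<exists>i. y i \<noteq> 0) \<and> (\<forall>i. kernel_op (M_trunc k) y i = z * y i)"
    then obtain y i1 where y: "y i1 \<noteq> 0" "\<And>i. kernel_op (M_trunc k) y i = z * y i" by blast
    have i1: "i1 \<le> k" using y(1) y(2)[of i1] z by (auto simp: kernel_op_M_trunc split: if_splits)
    define x where "x i = y i / complex_of_real (q i)" for i
    define c where "c = ?p x / (z - 1)"
    have Px: "?P x i - ?p x = z * x i" if "i \<le> k" for i
    proof -
      have "complex_of_real (q i) * (?P x i - ?p x) = z * y i"
        using y(2)[of i] that unfolding diff[symmetric] by (simp add: kernel_op_M_trunc x_def)
      then show ?thesis by (simp add: x_def field_simps)
    qed
    have "?P (\<lambda>j. x j + c) i = z * (x i + c)" if "i \<le> k" for i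
    proof -
      have "?P (\<lambda>j. x j + c) i = ?P x i + c"
        by (simp add: distrib_left sum.distrib sP flip: sum_distrib_right)
      moreover have "?p x + c = z * c" using z by (simp add: c_def field_simps)
      ultimately show ?thesis using Px[OF that] by (simp add: algebra_simps)
    qed
    moreover have "\<exists>i\<le>k. x i + c \<noteq> 0"
    proof (rule ccontr)
      assume "\<not> (\<exists>i\<le>k. x i + c \<noteq> 0)"
      then have xc: "x i = - c" if "i \<le> k" for i using that by (simp add: eq_neg_iff_add_eq_0)
      have "?P x i1 = (\<Sum>j\<le>k. complex_of_real (lump k (P i1) j)) * - c"
        unfolding sum_distrib_right by (intro sum.cong) (auto simp: xc)
      moreover have "?p x = (\<Sum>j\<le>k. complex_of_real (lump k \<pi> j)) * - c"
        unfolding sum_distrib_right by (intro sum.cong) (auto simp: xc)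
      ultimately have "z * x i1 = 0" using Px[OF i1] by (simp add: sP sp)
      then show False using z y(1) by (simp add: x_def)
    qed
    ultimately show "z \<in> spectrum (truncated_kernel P k)"
      unfolding mem_spectrum_truncated by (intro exI[of _ "\<lambda>j. x j + c"] conjI allI impI)
  qed
qed

lemma second_modulus_upper:
  "z \<in> spectrum (truncated_kernel P k) \<Longrightarrow> cmod z < 1 \<Longrightarrow> cmod z \<le> second_modulus P k"
  and second_modulus_least:
  "0 \<le> t \<Longrightarrow> (\<And>z. z \<in> spectrum (truncated_kernel P k) \<Longrightarrow> cmod z < 1 \<Longrightarrow> cmod z \<le> t) \<Longrightarrow> second_modulus P k \<le> t"
proof -
  define S where "S = {cmod z |z. z \<in> spectrum (truncated_kernel P k) \<and> cmod z < 1}"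
  have sm: "second_modulus P k = (if S = {} then 0 else Max S)"
    unfolding second_modulus_def Let_def S_def ..
  have "finite (spectrum (truncated_kernel P k))"
    by (rule card_finite_spectrum(1)[of _ "k + 1"]) (simp add: truncated_kernel_def)
  then have "finite (cmod ` spectrum (truncated_kernel P k))" by (rule finite_imageI)
  then have fin: "finite S" by (rule rev_finite_subset) (auto simp: S_def)
  show "cmod z \<le> second_modulus P k" if "z \<in> spectrum (truncated_kernel P k)" "cmod z < 1"
  proof -
    have "cmod z \<in> S" using that by (auto simp: S_def)
    then have "S \<noteq> {}" "cmod z \<le> Max S" using Max_ge[OF fin] by blast+
    then show ?thesis by (simp add: sm)
  qed
  show "second_modulus P k \<le> t"
    if "0 \<le> t" "\<And>z. z \<in> spectrum (truncated_kernel P k) \<Longrightarrow> cmod z < 1 \<Longrightarrow> cmod z \<le> t"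
  proof (cases "S = {}")
    case False
    then obtain z where "z \<in> spectrum (truncated_kernel P k)" "cmod z < 1" "Max S = cmod z"
      using Max_in[OF fin False] unfolding S_def by blast
    then show ?thesis using that(2) False by (simp add: sm)
  qed (simp add: sm that(1))
qed

end

section \<open>Admissible rates of convergence\<close>

definition admissible ::
  "(nat \<Rightarrow> nat \<Rightarrow> real) \<Rightarrow> (nat \<Rightarrow> real) \<Rightarrow> (nat \<Rightarrow> complex) set \<Rightarrow> ((nat \<Rightarrow> complex) \<Rightarrow> real) \<Rightarrow> real \<Rightarrow> bool"
  where
  "admissible P \<pi> X nrm \<rho> \<longleftrightarrow> 0 < \<rho> \<and> \<rho> < 1 \<and>
     (\<exists>C>0. \<forall>n\<ge>1. \<forall>f\<in>X.
        (\<lambda>i. (kernel_op P ^^ n) f i - mean_op \<pi> f i) \<in> X \<and>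
        nrm (\<lambda>i. (kernel_op P ^^ n) f i - mean_op \<pi> f i) \<le> C * \<rho> ^ n * nrm f)"

lemma convergence_rate_eq: "convergence_rate P \<pi> X nrm = Inf (ereal ` {\<rho>. admissible P \<pi> X nrm \<rho>})"
  by (simp add: convergence_rate_def admissible_def)

lemma admissible_mono:
  assumes "admissible P \<pi> X nrm \<rho>" and "\<rho> \<le> \<rho>'" "\<rho>' < 1" and nn: "\<And>f. f \<in> X \<Longrightarrow> 0 \<le> nrm f"
  shows "admissible P \<pi> X nrm \<rho>'"
proof -
  have \<rho>: "0 < \<rho>" using assms(1) by (simp add: admissible_def)
  obtain C where C: "0 < C" "\<And>n f. 1 \<le> n \<Longrightarrow> f \<in> X \<Longrightarrow>
        (\<lambda>i. (kernel_op P ^^ n) f i - mean_op \<pi> f i) \<in> X \<and>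
        nrm (\<lambda>i. (kernel_op P ^^ n) f i - mean_op \<pi> f i) \<le> C * \<rho> ^ n * nrm f"
    using assms(1) by (auto simp: admissible_def)
  have le: "C * \<rho> ^ n * nrm f \<le> C * \<rho>' ^ n * nrm f" if "f \<in> X" for n f
    using C(1) \<rho> assms(2) nn[OF that] by (intro mult_right_mono mult_left_mono power_mono) auto
  show ?thesis
    unfolding admissible_def
  proof (rule conjI[OF _ conjI[OF assms(3)]], use \<rho> assms(2) in simp,
      intro exI[of _ C] conjI[OF C(1)] allI impI ballI)
    fix n :: nat and f assume nf: "1 \<le> n" "f \<in> X"
    show "(\<lambda>i. (kernel_op P ^^ n) f i - mean_op \<pi> f i) \<in> X \<and>
        nrm (\<lambda>i. (kernel_op P ^^ n) f i - mean_op \<pi> f i) \<le> C * \<rho>' ^ n * nrm f"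
      using C(2)[OF nf] order_trans[OF _ le[OF nf(2)]] by blast
  qed
qed

context band_chain
begin

abbreviation "X2 \<equiv> ell2_space \<pi>"
abbreviation "n2 \<equiv> ell2_norm \<pi>"
definition weight :: "nat \<Rightarrow> real" where "weight = (\<lambda>n. \<pi> n powr (- 1 / 2))"
abbreviation "XV \<equiv> weighted_space weight"
abbreviation "nV \<equiv> weighted_norm weight"

lemma inverse_weight: "inverse (weight n) = q n"
  using pi_nonneg[of n] by (simp add: weight_def q_def powr_minus powr_half_sqrt)

lemma XV_iff: "g \<in> XV \<longleftrightarrow> (\<exists>c. \<forall>n. q n * cmod (g n) \<le> c)"
  unfolding weighted_space_def inverse_weight by (auto simp: bdd_above_def)

lemma nV_upper: "g \<in> XV \<Longrightarrow> q n * cmod (g n) \<le> nV g"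
  unfolding weighted_norm_def inverse_weight
  by (rule cSUP_upper) (auto simp: weighted_space_def inverse_weight)

lemma nV_least: "(\<And>n. q n * cmod (g n) \<le> c) \<Longrightarrow> nV g \<le> c"
  unfolding weighted_norm_def inverse_weight by (rule cSUP_least) auto

lemma cmod_square_pi: "(cmod (f i))\<^sup>2 * \<pi> i = (cmod (complex_of_real (q i) * f i))\<^sup>2"
  by (simp add: norm_mult power_mult_distrib power2_eq_square q_square[symmetric])

lemma X2_iff: "f \<in> X2 \<longleftrightarrow> summable (\<lambda>i. (cmod (complex_of_real (q i) * f i))\<^sup>2)"
  by (simp add: ell2_space_def cmod_square_pi)

lemma n2_eq: "n2 f = sqrt (\<Sum>i. (cmod (complex_of_real (q i) * f i))\<^sup>2)"
  by (simp add: ell2_norm_def cmod_square_pi)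

lemma n2_upper:
  assumes "f \<in> X2" shows "q i * cmod (f i) \<le> n2 f"
proof -
  have "(cmod (complex_of_real (q i) * f i))\<^sup>2 \<le> (\<Sum>i. (cmod (complex_of_real (q i) * f i))\<^sup>2)"
    using sum_le_suminf[of "\<lambda>i. (cmod (complex_of_real (q i) * f i))\<^sup>2" "{i}"] assms by (simp add: X2_iff)
  then have "cmod (complex_of_real (q i) * f i) \<le> n2 f" unfolding n2_eq by (rule real_le_rsqrt)
  then show ?thesis by (simp add: norm_mult)
qed

lemma unit_seq_in_X2: "unit_seq j \<in> X2"
  unfolding X2_iff by (rule summable_finite[of "{j}"]) (auto simp: unit_seq_def)

lemma unit_seq_in_XV: "unit_seq j \<in> XV"
  unfolding XV_iff
  using mult_mono[OF q_le_1 cmod_unit_seq_le] by (intro exI[of _ 1] allI) simp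

lemma integrable_of_bounded:
  assumes "\<And>i. q i * cmod (f i) \<le> c" shows "integrable_seq f"
  unfolding integrable_seq_def
proof (rule summable_comparison_test')
  show "summable (\<lambda>i. q i * c)" by (intro summable_mult2 q_summable)
  show "norm (\<pi> i * norm (f i)) \<le> q i * c" for i
    using mult_left_mono[OF assms[of i] q_nonneg[of i]]
    by (simp add: q_square[symmetric] mult.assoc abs_mult)
qed

lemma mean_op_eq: "mean_op \<pi> f i = (\<Sum>j. complex_of_real (\<pi> j) * f j)"
  by (simp add: mean_op_def mult.commute)

lemma pow_integrable_mean:
  assumes "integrable_seq f"
  shows "integrable_seq ((kernel_op P ^^ n) f)"
    and "(\<Sum>j. complex_of_real (\<pi> j) * (kernel_op P ^^ n) f j) = (\<Sum>j. complex_of_real (\<pi> j) * f j)"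
proof (induction n)
  case (Suc n)
  {
    case 1
    show ?case using invariance_mean(1)[OF Suc(1)] by (simp add: kernel_op_def)
  next
    case 2
    show ?case using invariance_mean(2)[OF Suc(1)] Suc(2) by (simp add: kernel_op_def sums_iff)
  }
qed (use assms in auto)

lemma op_M_eq:
  assumes "\<And>i. q i * cmod (f i) \<le> c"
  shows "kernel_op M (\<lambda>j. complex_of_real (q j) * f j) i =
    complex_of_real (q i) * (kernel_op P f i - (\<Sum>j. complex_of_real (\<pi> j) * f j))"
proof -
  have int: "integrable_seq f" by (rule integrable_of_bounded[OF assms])
  have s1: "summable (\<lambda>j. complex_of_real (P i j) * f j)"
    by (rule summable_norm_cancel) (use P_summable[OF int, of i] in \<open>simp add: norm_mult\<close>)
  have s2: "summable (\<lambda>j. complex_of_real (\<pi> j) * f j)"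
    by (rule summable_norm_cancel) (use int in \<open>simp add: integrable_seq_def norm_mult pi_nonneg\<close>)
  have "(\<lambda>j. complex_of_real (M i j) * (complex_of_real (q j) * f j)) =
    (\<lambda>j. complex_of_real (q i) * (complex_of_real (P i j) * f j - complex_of_real (\<pi> j) * f j))"
    by (auto simp: M_def field_simps)
  then show ?thesis
    unfolding kernel_op_def using s1 s2 by (simp add: suminf_mult suminf_diff summable_diff)
qed

text \<open>
  The distance to equilibrium evolves by \<open>P\<close> alone; since its mean is zero from time \<open>1\<close> on, it evolves
  equally well by \<open>P - \<Pi>\<close>, which multiplication by \<open>q\<close> transports to \<open>M\<close>.
\<close>

lemma pow_M_eq:
  assumes f: "\<And>i. q i * cmod (f i) \<le> c" and n: "1 \<le> n"
  shows "(kernel_op M ^^ n) (\<lambda>j. complex_of_real (q j) * f j) i =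
    complex_of_real (q i) * ((kernel_op P ^^ n) f i - mean_op \<pi> f i)"
  using n
proof (induction n arbitrary: i rule: dec_induct)
  case base
  then show ?case using op_M_eq[OF f] by (simp add: mean_op_eq)
next
  case (step n)
  obtain n0 B where "tail_contraction M n0 1 B" using tail_contraction_M[OF alpha0_less_1] by blast
  then interpret tail_contraction M n0 1 B .
  define m where "m = (\<Sum>j. complex_of_real (\<pi> j) * f j)"
  define u where "u i = (kernel_op P ^^ n) f i - m" for i
  have int: "integrable_seq ((kernel_op P ^^ n) f)"
    by (rule pow_integrable_mean(1)[OF integrable_of_bounded[OF f]])
  have eq: "(kernel_op M ^^ n) (\<lambda>j. complex_of_real (q j) * f j) = (\<lambda>i. complex_of_real (q i) * u i)"
    using step.IH by (auto simp: mean_op_eq m_def u_def)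
  have "cmod (complex_of_real (q i) * u i) \<le> B ^ n * c" for i
    unfolding fun_cong[OF eq, symmetric] using f by (intro cmod_pow_le) (simp add: norm_mult)
  then have "q i * cmod (u i) \<le> B ^ n * c" for i by (simp add: norm_mult)
  note opu = op_M_eq[OF this]
  have mean_u: "(\<Sum>j. complex_of_real (\<pi> j) * u j) = 0"
  proof -
    have "(\<lambda>j. complex_of_real (\<pi> j) * (kernel_op P ^^ n) f j) sums m"
      unfolding m_def pow_integrable_mean(2)[OF integrable_of_bounded[OF f], of n, symmetric]
      by (rule summable_sums, rule summable_norm_cancel)
        (use int in \<open>simp add: integrable_seq_def norm_mult pi_nonneg\<close>)
    moreover have "(\<lambda>j. complex_of_real (\<pi> j) * m) sums (complex_of_real 1 * m)"
      by (intro sums_mult2 sums_of_real pi_sums)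
    ultimately have "(\<lambda>j. complex_of_real (\<pi> j) * (kernel_op P ^^ n) f j - complex_of_real (\<pi> j) * m) sums (m - complex_of_real 1 * m)"
      by (rule sums_diff)
    then show ?thesis by (simp add: u_def right_diff_distrib sums_iff)
  qed
  have P_u: "kernel_op P u i = (kernel_op P ^^ Suc n) f i - m" for i
  proof -
    have "(\<lambda>j. complex_of_real (P i j) * (kernel_op P ^^ n) f j) sums (kernel_op P ^^ Suc n) f i"
      unfolding funpow.simps o_apply kernel_op_def[of P "(kernel_op P ^^ n) f"]
      by (rule summable_sums, rule summable_norm_cancel) (use P_summable[OF int, of i] in \<open>simp add: norm_mult\<close>)
    moreover have "(\<lambda>j. complex_of_real (P i j) * m) sums (complex_of_real 1 * m)"
      by (intro sums_mult2 sums_of_real P_sums)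
    ultimately have "(\<lambda>j. complex_of_real (P i j) * (kernel_op P ^^ n) f j - complex_of_real (P i j) * m)
        sums ((kernel_op P ^^ Suc n) f i - complex_of_real 1 * m)"
      by (rule sums_diff)
    then show ?thesis by (simp add: u_def kernel_op_def right_diff_distrib sums_iff)
  qed
  show ?case
    unfolding funpow.simps o_apply eq using opu[of i] P_u[of i] mean_u
    by (simp add: mean_op_eq m_def)
qed

text \<open>
  The columns of the powers of \<open>M\<close> are the orbits of unit sequences.  These belong to both spaces, and both
  norms dominate the values weighted by \<open>q\<close>.
\<close>

lemma admissible_imp_entry_bound:
  assumes adm: "admissible P \<pi> X nrm \<rho>"
    and upper: "\<And>u i. u \<in> X \<Longrightarrow> q i * cmod (u i) \<le> nrm u" and unit: "unit_seq j \<in> X"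
  shows "\<exists>C\<ge>0. \<forall>n i. cmod ((kernel_op M ^^ n) (unit_seq j) i) \<le> C * \<rho> ^ n"
proof -
  obtain n0 B where "tail_contraction M n0 1 B" using tail_contraction_M[OF alpha0_less_1] by blast
  then interpret tail_contraction M n0 1 B .
  obtain C where C: "0 < C" "\<And>n f. 1 \<le> n \<Longrightarrow> f \<in> X \<Longrightarrow>
        (\<lambda>i. (kernel_op P ^^ n) f i - mean_op \<pi> f i) \<in> X \<and>
        nrm (\<lambda>i. (kernel_op P ^^ n) f i - mean_op \<pi> f i) \<le> C * \<rho> ^ n * nrm f"
    and \<rho>: "0 < \<rho>"
    using adm by (auto simp: admissible_def)
  define C' where "C' = max 1 (C * nrm (unit_seq j) / q j)"
  have "cmod ((kernel_op M ^^ n) (unit_seq j) i) \<le> C' * \<rho> ^ n" for n i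
  proof (cases "n = 0")
    case True then show ?thesis using cmod_unit_seq_le[of j i] by (simp add: C'_def)
  next
    case False
    define u where "u i = (kernel_op P ^^ n) (unit_seq j) i - mean_op \<pi> (unit_seq j) i" for i
    have u: "u \<in> X" "nrm u \<le> C * \<rho> ^ n * nrm (unit_seq j)"
      using C(2)[of n "unit_seq j"] unit False by (auto simp: u_def[abs_def])
    have "(\<lambda>i. complex_of_real (q i) * unit_seq j i) = (\<lambda>i. complex_of_real (q j) * unit_seq j i)"
      by (auto simp: unit_seq_def)
    moreover have "(kernel_op M ^^ n) (\<lambda>i. complex_of_real (q j) * unit_seq j i) i =
        complex_of_real (q j) * (kernel_op M ^^ n) (unit_seq j) i"
      by (subst pow_scale) auto
    ultimately have "complex_of_real (q j) * (kernel_op M ^^ n) (unit_seq j) i = complex_of_real (q i) * u i"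
      using pow_M_eq[of "unit_seq j" "nrm (unit_seq j)" n i] upper[OF unit] False by (simp add: u_def)
    then have "q j * cmod ((kernel_op M ^^ n) (unit_seq j) i) = q i * cmod (u i)"
      by (metis norm_mult norm_of_real abs_of_nonneg q_nonneg)
    also have "\<dots> \<le> C * \<rho> ^ n * nrm (unit_seq j)" using upper[OF u(1), of i] u(2) by simp
    finally have "cmod ((kernel_op M ^^ n) (unit_seq j) i) \<le> (C * nrm (unit_seq j) / q j) * \<rho> ^ n"
      by (simp add: pos_le_divide_eq mult_ac)
    also have "\<dots> \<le> C' * \<rho> ^ n" using \<rho> by (intro mult_right_mono) (auto simp: C'_def)
    finally show ?thesis .
  qed
  then show ?thesis by (intro exI[of _ C']) (auto simp: C'_def)
qed

lemma entry_bound_imp_corner_bound: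
  assumes "\<And>j. \<exists>C\<ge>0. \<forall>n i. cmod ((kernel_op M ^^ n) (unit_seq j) i) \<le> C * \<rho> ^ n" and "0 < \<rho>"
  shows "\<exists>C\<ge>0. \<forall>n. \<forall>i<n0. \<forall>j<n0. cmod ((kernel_op M ^^ n) (unit_seq j) i) \<le> C * \<rho> ^ n"
proof -
  obtain C where C: "\<And>j. 0 \<le> C j" "\<And>j n i. cmod ((kernel_op M ^^ n) (unit_seq j) i) \<le> C j * \<rho> ^ n"
    using assms(1) by metis
  have "cmod ((kernel_op M ^^ n) (unit_seq j) i) \<le> (\<Sum>j<n0. C j) * \<rho> ^ n" if "j < n0" for n i j
  proof -
    have "C j * \<rho> ^ n \<le> (\<Sum>j<n0. C j) * \<rho> ^ n"
      using that C(1) assms(2) by (intro mult_right_mono member_le_sum) auto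
    then show ?thesis using C(2)[of n j i] by simp
  qed
  then show ?thesis using C(1) by (intro exI[of _ "\<Sum>j<n0. C j"]) (auto intro!: sum_nonneg)
qed

text \<open>
  Transported by \<open>q\<close>, the supremum and the \<open>\<ell>\<^sup>2\<close> bounds for the powers of \<open>M\<close> are the norm estimates that
  admissibility asks for; for \<open>\<ell>\<^sup>2\<close> the supremum bound enters because the supremum is at most the \<open>\<ell>\<^sup>2\<close> norm.
\<close>

lemma corner_bound_imp_admissible:
  assumes tc: "tail_contraction M n0 r B" and col: "\<And>j n. (\<Sum>i<n. \<bar>tail_rows n0 M i j\<bar>) \<le> r"
    and \<rho>: "r < \<rho>" "\<rho> < 1"
    and corner: "\<exists>C\<ge>0. \<forall>n. \<forall>i<n0. \<forall>j<n0. cmod ((kernel_op M ^^ n) (unit_seq j) i) \<le> C * \<rho> ^ n"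
  shows "admissible P \<pi> XV nV \<rho>" and "admissible P \<pi> X2 n2 \<rho>"
proof -
  interpret tail_contraction M n0 r B by (rule tc)
  obtain C where C0: "0 \<le> C"
    and "\<forall>n. \<forall>i<n0. \<forall>j<n0. cmod ((kernel_op M ^^ n) (unit_seq j) i) \<le> C * \<rho> ^ n"
    using corner by blast
  then have C: "cmod ((kernel_op M ^^ n) (unit_seq j) i) \<le> C * \<rho> ^ n" if "i < n0" "j < n0" for n i j
    using that by simp
  have \<rho>0: "0 < \<rho>" using \<rho>(1) r_pos by simp
  define D where "D = max 1 (real n0 * C * B / (\<rho> - r))"
  have D: "0 < D" by (simp add: D_def)
  have bound: "cmod ((kernel_op M ^^ n) g i) \<le> D * \<rho> ^ n * c" if "\<And>j. cmod (g j) \<le> c" for g c n i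
    by (rule corner_bound_imp_norm_bound[OF \<rho>(1) C0 C D_def order_refl that])
  show "admissible P \<pi> XV nV \<rho>"
    unfolding admissible_def
  proof (intro conjI exI[of _ D] allI impI ballI \<rho>0 \<rho>(2) D)
    fix n :: nat and f assume n: "1 \<le> n" and f: "f \<in> XV"
    let ?u = "\<lambda>i. (kernel_op P ^^ n) f i - mean_op \<pi> f i"
    have le: "q i * cmod (?u i) \<le> D * \<rho> ^ n * nV f" for i
      using bound[of "\<lambda>j. complex_of_real (q j) * f j" "nV f" n i] nV_upper[OF f]
      unfolding pow_M_eq[OF nV_upper[OF f] n] by (simp add: norm_mult)
    then show "?u \<in> XV" by (auto simp: XV_iff)
    show "nV ?u \<le> D * \<rho> ^ n * nV f" by (rule nV_least[OF le])
  qed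
  define D2 where "D2 = max 1 (real n0 * D\<^sup>2 * \<rho>\<^sup>2 / (\<rho>\<^sup>2 - r\<^sup>2))"
  have D2: "0 < sqrt D2" by (simp add: D2_def)
  show "admissible P \<pi> X2 n2 \<rho>"
    unfolding admissible_def
  proof (rule conjI[OF \<rho>0 conjI[OF \<rho>(2)]], intro exI[of _ "sqrt D2"] conjI[OF D2] allI impI ballI)
    fix n :: nat and f assume n: "1 \<le> n" and f: "f \<in> X2"
    let ?u = "\<lambda>i. (kernel_op P ^^ n) f i - mean_op \<pi> f i"
    let ?g = "\<lambda>j. complex_of_real (q j) * f j"
    have sg: "summable (\<lambda>j. (cmod (?g j))\<^sup>2)" using f by (simp add: X2_iff)
    have g: "cmod (?g j) \<le> n2 f" for j using n2_upper[OF f, of j] by (simp add: norm_mult)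
    have "0 \<le> (\<Sum>j. (cmod (?g j))\<^sup>2)" by (intro suminf_nonneg sg) simp
    then have c: "(n2 f)\<^sup>2 \<le> (\<Sum>j. (cmod (?g j))\<^sup>2)" by (simp add: n2_eq)
    have "summable (\<lambda>i. (cmod ((kernel_op M ^^ n) ?g i))\<^sup>2) \<and>
      (\<Sum>i. (cmod ((kernel_op M ^^ n) ?g i))\<^sup>2) \<le> D2 * (\<rho> ^ n)\<^sup>2 * (\<Sum>j. (cmod (?g j))\<^sup>2)"
      by (rule pow_ell2_bound[OF col sg \<rho>(1) bound[OF g] c D2_def])
    then have s: "summable (\<lambda>i. (cmod (complex_of_real (q i) * ?u i))\<^sup>2)"
      and le: "(\<Sum>i. (cmod (complex_of_real (q i) * ?u i))\<^sup>2) \<le> D2 * (\<rho> ^ n)\<^sup>2 * (\<Sum>j. (cmod (?g j))\<^sup>2)"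
      unfolding pow_M_eq[OF n2_upper[OF f] n] by auto
    have "n2 ?u \<le> sqrt (D2 * (\<rho> ^ n)\<^sup>2 * (\<Sum>j. (cmod (?g j))\<^sup>2))"
      unfolding n2_eq[of ?u] by (rule real_sqrt_le_mono[OF le])
    also have "\<dots> = sqrt D2 * \<rho> ^ n * n2 f"
      using \<rho>0 by (simp add: real_sqrt_mult n2_eq)
    finally show "?u \<in> X2 \<and> n2 ?u \<le> sqrt D2 * \<rho> ^ n * n2 f" using s by (simp add: X2_iff)
  qed
qed

lemma admissible_2_imp_corner:
  assumes "admissible P \<pi> X2 n2 \<rho>"
  shows "\<exists>C\<ge>0. \<forall>n. \<forall>i<n0. \<forall>j<n0. cmod ((kernel_op M ^^ n) (unit_seq j) i) \<le> C * \<rho> ^ n"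
  using assms
  by (intro entry_bound_imp_corner_bound admissible_imp_entry_bound[OF assms n2_upper unit_seq_in_X2])
    (auto simp: admissible_def)

lemma admissible_V_imp_corner:
  assumes "admissible P \<pi> XV nV \<rho>"
  shows "\<exists>C\<ge>0. \<forall>n. \<forall>i<n0. \<forall>j<n0. cmod ((kernel_op M ^^ n) (unit_seq j) i) \<le> C * \<rho> ^ n"
  using assms
  by (intro entry_bound_imp_corner_bound admissible_imp_entry_bound[OF assms nV_upper unit_seq_in_XV])
    (auto simp: admissible_def)

lemma admissible_iff:
  assumes \<rho>: "alpha0 N a \<tau> < \<rho>" "\<rho> < 1"
  shows "admissible P \<pi> X2 n2 \<rho> \<longleftrightarrow> admissible P \<pi> XV nV \<rho>"
proof -
  obtain r where r: "alpha0 N a \<tau> < r" "r < \<rho>" using \<rho>(1) dense by blast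
  obtain n0 B where tc: "tail_contraction M n0 r B" "\<And>j n. (\<Sum>i<n. \<bar>tail_rows n0 M i j\<bar>) \<le> r"
    using tail_contraction_M[OF r(1)] by blast
  show ?thesis
    using corner_bound_imp_admissible[OF tc r(2) \<rho>(2)] admissible_2_imp_corner admissible_V_imp_corner by blast
qed

text \<open>
  A zero would give an eigenfunction of \<open>P - \<Pi>\<close> with eigenvalue \<open>1 / w\<close>.  Its mean vanishes, so it is an
  eigenfunction of \<open>P\<close> for an eigenvalue of modulus at least \<open>1\<close>.
\<close>

lemma corner_det_nonzero:
  assumes "tail_contraction M n0 r B" and "r < 1" and w: "cmod w \<le> 1"
  shows "corner_det M n0 w \<noteq> 0"
proof
  interpret tail_contraction M n0 r B by (rule assms)
  assume "corner_det M n0 w = 0"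
  moreover have "cmod w * r < 1" using mult_right_mono[OF w less_imp_le[OF r_pos]] assms(2) by simp
  ultimately obtain y where y: "Bseq y" "\<exists>i. y i \<noteq> 0" "\<And>i. y i = w * kernel_op M y i"
    using corner_det_zero_imp_eigenvector by blast
  have w0: "w \<noteq> 0" using y(2,3) by auto
  define g where "g i = y i / complex_of_real (q i)" for i
  define m where "m = (\<Sum>j. complex_of_real (\<pi> j) * g j)"
  obtain c where c: "\<And>i. cmod (y i) \<le> c" using y(1) by (auto simp: Bseq_def)
  have gc: "q i * cmod (g i) \<le> c" for i using c[of i] by (simp add: g_def norm_divide)
  have int: "integrable_seq g" by (rule integrable_of_bounded[OF gc])
  have yq: "y = (\<lambda>j. complex_of_real (q j) * g j)" by (auto simp: g_def)
  have Pg: "kernel_op P g i = inverse w * g i + m" for i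
  proof -
    have "complex_of_real (q i) * g i = w * (complex_of_real (q i) * (kernel_op P g i - m))"
      using y(3)[of i] op_M_eq[OF gc, of i] by (simp add: m_def flip: yq) (simp add: yq)
    then have "g i = w * (kernel_op P g i - m)" by simp
    then show ?thesis using w0 by (simp add: field_simps)
  qed
  have "m = 0"
  proof -
    have s1: "(\<lambda>i. complex_of_real (\<pi> i) * kernel_op P g i) sums m"
      using invariance_mean(2)[OF int] by (simp add: kernel_op_def m_def)
    have s2: "(\<lambda>i. complex_of_real (\<pi> i) * g i) sums m"
      unfolding m_def by (rule summable_sums, rule summable_norm_cancel)
        (use int in \<open>simp add: integrable_seq_def norm_mult pi_nonneg\<close>)
    have "(\<lambda>i. inverse w * (complex_of_real (\<pi> i) * g i) + complex_of_real (\<pi> i) * m) sums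
        (inverse w * m + complex_of_real 1 * m)"
      by (intro sums_add sums_mult s2 sums_mult2 sums_of_real pi_sums)
    moreover have "(\<lambda>i. inverse w * (complex_of_real (\<pi> i) * g i) + complex_of_real (\<pi> i) * m) =
        (\<lambda>i. complex_of_real (\<pi> i) * kernel_op P g i)"
      by (auto simp: Pg algebra_simps)
    ultimately have "(\<lambda>i. complex_of_real (\<pi> i) * kernel_op P g i) sums (inverse w * m + complex_of_real 1 * m)"
      by (simp only:)
    from sums_unique2[OF this s1] have "inverse w * m + m = m" by simp
    then show ?thesis using w0 by simp
  qed
  have "g i = 0" for i
  proof (rule no_peripheral_eigenvector[OF int])
    show "kernel_op P g i = inverse w * g i" for i using Pg \<open>m = 0\<close> by simp
    show "1 \<le> cmod (inverse w)" using w w0 by (simp add: norm_inverse one_le_inverse_iff)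
    show "(\<Sum>i. g i * complex_of_real (\<pi> i)) = 0" using \<open>m = 0\<close> by (simp add: m_def mult.commute)
  qed
  then show False using y(2) by (simp add: yq)
qed

lemma ex_admissible: "\<exists>\<rho>. alpha0 N a \<tau> < \<rho> \<and> \<rho> < 1 \<and> admissible P \<pi> X2 n2 \<rho>"
proof -
  obtain r where r: "alpha0 N a \<tau> < r" "r < 1" using alpha0_less_1 dense by blast
  obtain n0 B where tc: "tail_contraction M n0 r B" "\<And>j n. (\<Sum>i<n. \<bar>tail_rows n0 M i j\<bar>) \<le> r"
    using tail_contraction_M[OF r(1)] by blast
  interpret tail_contraction M n0 r B by (rule tc)
  obtain \<rho> where \<rho>: "r < \<rho>" "\<rho> < 1" "\<And>w. cmod w < 1 / \<rho> \<Longrightarrow> corner_det M n0 w \<noteq> 0"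
    using corner_det_nonzero_beyond[OF r(2) corner_det_nonzero[OF tc(1) r(2)]] by blast
  obtain \<rho>' where \<rho>': "\<rho> < \<rho>'" "\<rho>' < 1" using \<rho>(2) dense by blast
  have pos: "0 < \<rho>" "0 < \<rho>'" using \<rho>(1) \<rho>'(1) r_pos by auto
  have "\<exists>C\<ge>0. \<forall>n. \<forall>i<n0. \<forall>j<n0. cmod ((kernel_op M ^^ n) (unit_seq j) i) \<le> C * (1 / (1 / \<rho>')) ^ n"
    by (rule corner_bound_of_det_nonzero[of "1 / \<rho>", OF _ \<rho>(3)])
      (use \<rho>(1) \<rho>'(1) pos r_pos in \<open>auto simp: field_simps\<close>)
  then have "admissible P \<pi> X2 n2 \<rho>'"
    using \<rho>(1) \<rho>' by (intro corner_bound_imp_admissible(2)[OF tc]) auto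
  then show ?thesis using r \<rho> \<rho>' by (intro exI[of _ \<rho>']) auto
qed

lemma second_modulus_eventually_le:
  assumes "alpha0 N a \<tau> < \<rho>" and adm: "admissible P \<pi> X2 n2 \<rho>" and "\<rho> < \<rho>'"
  shows "\<forall>\<^sub>F k in sequentially. second_modulus P k \<le> \<rho>'"
proof -
  obtain r where r: "alpha0 N a \<tau> < r" "r < \<rho>" using assms(1) dense by blast
  obtain n0 B where tc: "tail_contraction M n0 r B" using tail_contraction_M[OF r(1)] by blast
  obtain k1 where "tail_contraction_limit M n0 r B (\<lambda>k. if k < k1 then M else M_trunc k)"
    using truncation_limit[OF tc] by blast
  then interpret tail_contraction_limit M n0 r B "\<lambda>k. if k < k1 then M else M_trunc k" .
  obtain C where C: "0 \<le> C"
    and "\<forall>n. \<forall>i<n0. \<forall>j<n0. cmod ((kernel_op M ^^ n) (unit_seq j) i) \<le> C * \<rho> ^ n"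
    using admissible_2_imp_corner[OF adm, of n0] by blast
  then have corner: "cmod ((kernel_op M ^^ n) (unit_seq j) i) \<le> C * \<rho> ^ n" if "i < n0" "j < n0" for n i j
    using that by simp
  have "\<forall>\<^sub>F k in sequentially. \<forall>z y. Bseq y \<longrightarrow> (\<exists>i. y i \<noteq> 0) \<longrightarrow>
      (\<forall>i. kernel_op (if k < k1 then M else M_trunc k) y i = z * y i) \<longrightarrow> cmod z \<le> \<rho>'"
    by (rule eigenvalues_eventually_small[OF r(2) \<open>\<rho> < \<rho>'\<close> C]) (rule corner)
  from this eventually_ge_at_top[of k1]
  show ?thesis
  proof eventually_elim
    case (elim k)
    show ?case
    proof (rule second_modulus_least)
      show "0 \<le> \<rho>'" using r_pos r(2) \<open>\<rho> < \<rho>'\<close> by simp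
      fix z assume z: "z \<in> spectrum (truncated_kernel P k)" "cmod z < 1"
      show "cmod z \<le> \<rho>'"
      proof (cases "z = 0")
        case False
        moreover have "z \<noteq> 1" using z(2) by auto
        ultimately obtain y where "Bseq y" "\<exists>i. y i \<noteq> 0" "\<forall>i. kernel_op (M_trunc k) y i = z * y i"
          using z spectrum_truncated_iff[of z k] by auto
        then show ?thesis using elim by auto
      qed (use \<open>0 \<le> \<rho>'\<close> in simp)
    qed
  qed
qed

text \<open>
  If the truncations have no eigenvalue of modulus in \<open>(\<rho>, 1)\<close> infinitely often, their characteristic
  functions vanish nowhere in the disc of radius \<open>1 / \<rho>\<close>: in the closed unit disc because they converge
  uniformly to a function without zeros there, outside because a zero is the inverse of an eigenvalue.
\<close>

lemma frequently_second_modulus_le_imp_admissible: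
  assumes \<rho>: "alpha0 N a \<tau> < \<rho>" "\<rho> < \<rho>'" "\<rho>' < 1"
    and freq: "\<exists>\<^sub>F k in sequentially. second_modulus P k \<le> \<rho>"
  shows "admissible P \<pi> X2 n2 \<rho>'"
proof -
  obtain r where r: "alpha0 N a \<tau> < r" "r < \<rho>" using \<rho>(1) dense by blast
  obtain n0 B where tc: "tail_contraction M n0 r B" "\<And>j n. (\<Sum>i<n. \<bar>tail_rows n0 M i j\<bar>) \<le> r"
    using tail_contraction_M[OF r(1)] by blast
  obtain k1 where "tail_contraction_limit M n0 r B (\<lambda>k. if k < k1 then M else M_trunc k)"
    using truncation_limit[OF tc(1)] by blast
  then interpret tail_contraction_limit M n0 r B "\<lambda>k. if k < k1 then M else M_trunc k" .
  have r1: "r < 1" using r(2) \<rho> by simp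
  have "1 < 1 / r" using r1 r_pos by simp
  then have "continuous_on (cball 0 1) (\<lambda>w. cmod (corner_det M n0 w))"
    by (intro continuous_on_norm holomorphic_on_imp_continuous_on
        holomorphic_on_subset[OF corner_det_holomorphic]) (auto intro: le_less_trans[of _ 1])
  then have "\<exists>w0\<in>cball 0 1. \<forall>w\<in>cball 0 1. cmod (corner_det M n0 w0) \<le> cmod (corner_det M n0 w)"
    by (intro continuous_attains_inf) auto
  then obtain w0 where w0: "w0 \<in> cball 0 1"
    "\<And>w. w \<in> cball 0 1 \<Longrightarrow> cmod (corner_det M n0 w0) \<le> cmod (corner_det M n0 w)" by blast
  define \<delta> where "\<delta> = cmod (corner_det M n0 w0)"
  have \<delta>: "0 < \<delta>" using corner_det_nonzero[OF tc(1) r1, of w0] w0(1) by (simp add: \<delta>_def)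
  have "\<forall>\<^sub>F k in sequentially. \<forall>w\<in>cball 0 1.
      dist (corner_det (if k < k1 then M else M_trunc k) n0 w) (corner_det M n0 w) < \<delta>"
    using corner_det_uniform_limit[of 1] r1 \<delta> by (simp add: uniform_limit_iff)
  then have ev: "\<forall>\<^sub>F k in sequentially. \<forall>w\<in>cball 0 1. corner_det (if k < k1 then M else M_trunc k) n0 w \<noteq> 0"
  proof eventually_elim
    case (elim k)
    show ?case
    proof
      fix w :: complex assume w: "w \<in> cball 0 1"
      have "\<delta> \<le> cmod (corner_det M n0 w)" using w0(2)[OF w] by (simp add: \<delta>_def)
      then show "corner_det (if k < k1 then M else M_trunc k) n0 w \<noteq> 0"
        using elim[rule_format, OF w] by (auto simp: dist_norm)
    qed
  qed
  have "\<exists>\<^sub>F k in sequentially. second_modulus P k \<le> \<rho> \<and> k1 \<le> k \<and>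
      (\<forall>w\<in>cball 0 1. corner_det (if k < k1 then M else M_trunc k) n0 w \<noteq> 0)"
    using frequently_eventually_frequently[OF freq eventually_conj[OF eventually_ge_at_top[of k1] ev]] .
  then have "\<exists>\<^sub>F k in sequentially. \<forall>w. cmod w < 1 / \<rho> \<longrightarrow> corner_det (if k < k1 then M else M_trunc k) n0 w \<noteq> 0"
  proof (rule frequently_elim1, intro allI impI notI)
    fix k and w :: complex
    assume k: "second_modulus P k \<le> \<rho> \<and> k1 \<le> k \<and>
      (\<forall>w\<in>cball 0 1. corner_det (if k < k1 then M else M_trunc k) n0 w \<noteq> 0)"
      and w: "cmod w < 1 / \<rho>" and det0: "corner_det (if k < k1 then M else M_trunc k) n0 w = 0"
    then have k': "second_modulus P k \<le> \<rho>" "corner_det (M_trunc k) n0 w = 0" by auto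
    have w1: "1 < cmod w" using k det0 by (force simp: not_le[symmetric])
    interpret k: tail_contraction "M_trunc k" n0 r B using approx[of k] k by simp
    have \<rho>pos: "0 < \<rho>" using r(2) r_pos by simp
    have "1 / \<rho> < 1 / r" using r(2) r_pos by (simp add: field_simps)
    then have "cmod w < 1 / r" using w by simp
    then have "cmod w * r < 1" using r_pos by (simp add: field_simps)
    then obtain y where y: "Bseq y" "\<exists>i. y i \<noteq> 0" "\<And>i. y i = w * kernel_op (M_trunc k) y i"
      using k.corner_det_zero_imp_eigenvector k'(2) by blast
    have wn0: "w \<noteq> 0" using w1 by auto
    have "kernel_op (M_trunc k) y i = inverse w * y i" for i
      using arg_cong[OF y(3)[of i], of "\<lambda>x. inverse w * x"] wn0 by (simp flip: mult.assoc)
    moreover have z: "inverse w \<noteq> 0" "inverse w \<noteq> 1" "cmod (inverse w) < 1"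
      using w1 wn0 by (auto simp: norm_inverse inverse_less_1_iff)
    ultimately have "inverse w \<in> spectrum (truncated_kernel P k)"
      using y(1,2) spectrum_truncated_iff by blast
    then have "cmod (inverse w) \<le> \<rho>" using second_modulus_upper z(3) k'(1) by fastforce
    then have "1 \<le> \<rho> * cmod w" using w1 by (auto simp: norm_inverse divide_le_eq inverse_eq_divide[of "cmod w"] split: if_splits)
    moreover have "\<rho> * cmod w < 1" using w \<rho>pos by (simp add: field_simps)
    ultimately show False by simp
  qed
  then have "\<exists>C\<ge>0. \<forall>n. \<forall>i<n0. \<forall>j<n0. cmod ((kernel_op M ^^ n) (unit_seq j) i) \<le> C * \<rho>' ^ n"
    using r(2) \<rho>(2) by (intro corner_bound_of_frequently_nonzero[of \<rho>]) auto
  then show ?thesis using r(2) \<rho> by (intro corner_bound_imp_admissible(2)[OF tc]) auto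
qed

end

section \<open>Comparison of the rates\<close>

text \<open>
  The order-theoretic core: \<open>A\<close> and \<open>A'\<close> stand for the sets of admissible rates on the two spaces and \<open>s\<close> for the
  second moduli of the truncations.  Above \<open>\<alpha>\<close> the sets agree and the moduli decide membership up to
  an arbitrarily small loss.
\<close>

lemma rates_from_admissible_sets:
  fixes A A' :: "real set" and s :: "nat \<Rightarrow> real" and \<alpha> :: real
  defines "\<rho> \<equiv> Inf (ereal ` A)" and "\<rho>' \<equiv> Inf (ereal ` A')"
  assumes same: "\<And>t. \<alpha> < t \<Longrightarrow> t < 1 \<Longrightarrow> t \<in> A \<longleftrightarrow> t \<in> A'"
    and up: "\<And>t u. t \<in> A \<Longrightarrow> t \<le> u \<Longrightarrow> u < 1 \<Longrightarrow> u \<in> A"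
    and up': "\<And>t u. t \<in> A' \<Longrightarrow> t \<le> u \<Longrightarrow> u < 1 \<Longrightarrow> u \<in> A'"
    and ex: "\<exists>t. \<alpha> < t \<and> t < 1 \<and> t \<in> A"
    and above: "\<And>t u. \<alpha> < t \<Longrightarrow> t \<in> A \<Longrightarrow> t < u \<Longrightarrow> \<forall>\<^sub>F k in sequentially. s k \<le> u"
    and below: "\<And>t u. \<alpha> < t \<Longrightarrow> t < u \<Longrightarrow> u < 1 \<Longrightarrow> \<exists>\<^sub>F k in sequentially. s k \<le> t \<Longrightarrow> u \<in> A"
  shows "((\<rho> \<le> ereal \<alpha> \<longleftrightarrow> \<rho>' \<le> ereal \<alpha>) \<and>
          (\<rho> \<le> ereal \<alpha> \<longrightarrow> limsup (\<lambda>k. ereal (s k)) \<le> ereal \<alpha>)) \<and>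
         ((\<rho> > ereal \<alpha> \<longleftrightarrow> \<rho>' > ereal \<alpha>) \<and>
          (\<rho> > ereal \<alpha> \<longrightarrow> \<rho> = \<rho>' \<and> (\<lambda>k. ereal (s k)) \<longlonglongrightarrow> \<rho>))"
proof -
  obtain t0 where t0: "\<alpha> < t0" "t0 < 1" "t0 \<in> A" using ex by blast
  have t0': "t0 \<in> A'" using same t0 by blast
  have less: "\<rho> < ereal t \<longleftrightarrow> (\<exists>u<t. u \<in> A)" for t
    unfolding \<rho>_def by (auto simp: Inf_less_iff)
  have less': "\<rho>' < ereal t \<longleftrightarrow> (\<exists>u<t. u \<in> A')" for t
    unfolding \<rho>'_def by (auto simp: Inf_less_iff)
  have \<rho>_t0: "\<rho> \<le> ereal t0" "\<rho>' \<le> ereal t0"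
    unfolding \<rho>_def \<rho>'_def using t0(3) t0' by (auto intro: INF_lower)
  have less_in: "\<exists>u. \<alpha> < u \<and> u < t \<and> u \<in> A" if t: "\<rho> < ereal t" "\<alpha> < t" "t < 1" for t
  proof -
    obtain u where u: "u < t" "u \<in> A" using t(1) unfolding less by blast
    obtain v where v: "\<alpha> < v" "v < t" using t(2) dense by blast
    have "max u v \<in> A" using up[OF u(2), of "max u v"] u v t by auto
    then show ?thesis using u v by (intro exI[of _ "max u v"]) auto
  qed
  have less_in': "\<exists>u. \<alpha> < u \<and> u < t \<and> u \<in> A'" if t: "\<rho>' < ereal t" "\<alpha> < t" "t < 1" for t
  proof -
    obtain u where u: "u < t" "u \<in> A'" using t(1) unfolding less' by blast
    obtain v where v: "\<alpha> < v" "v < t" using t(2) dense by blast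
    have "max u v \<in> A'" using up'[OF u(2), of "max u v"] u v t by auto
    then show ?thesis using u v by (intro exI[of _ "max u v"]) auto
  qed
  have eq: "\<rho> < ereal t \<longleftrightarrow> \<rho>' < ereal t" if t: "\<alpha> < t" "t < 1" for t
  proof
    assume "\<rho> < ereal t"
    then obtain u where "\<alpha> < u" "u < t" "u \<in> A" using less_in t by blast
    then show "\<rho>' < ereal t" using same[of u] t less' by auto
  next
    assume "\<rho>' < ereal t"
    then obtain u where "\<alpha> < u" "u < t" "u \<in> A'" using less_in' t by blast
    then show "\<rho> < ereal t" using same[of u] t less by auto
  qed
  have between: "\<exists>t. x < ereal t \<and> ereal t < y \<and> \<alpha> < t \<and> t < 1"
    if xy: "x < y" "ereal \<alpha> \<le> x" "y \<le> ereal 1" for x y :: ereal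
  proof -
    obtain t where t: "x < ereal t" "ereal t < y" using ereal_dense2[OF xy(1)] by blast
    have "ereal \<alpha> < ereal t" "ereal t < ereal 1"
      using le_less_trans[OF xy(2) t(1)] less_le_trans[OF t(2) xy(3)] by auto
    then show ?thesis using t by (intro exI[of _ t]) auto
  qed
  have "\<rho> < ereal 1" "\<rho>' < ereal 1" using \<rho>_t0 t0(2) by (auto intro: le_less_trans)
  note \<rho>1 = this this[THEN less_imp_le]
  have imp: "\<rho>' \<le> ereal \<alpha>" if asm: "\<rho> \<le> ereal \<alpha>"
  proof (rule ccontr)
    assume "\<not> \<rho>' \<le> ereal \<alpha>"
    then obtain t where t: "ereal \<alpha> < ereal t" "ereal t < \<rho>'" "\<alpha> < t" "t < 1"
      using between[of "ereal \<alpha>" \<rho>'] \<rho>1 by (auto simp: not_le)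
    then have "\<rho>' < ereal t" using eq[of t] le_less_trans[OF asm t(1)] by blast
    then show False using t(2) by simp
  qed
  have imp': "\<rho> \<le> ereal \<alpha>" if asm: "\<rho>' \<le> ereal \<alpha>"
  proof (rule ccontr)
    assume "\<not> \<rho> \<le> ereal \<alpha>"
    then obtain t where t: "ereal \<alpha> < ereal t" "ereal t < \<rho>" "\<alpha> < t" "t < 1"
      using between[of "ereal \<alpha>" \<rho>] \<rho>1 by (auto simp: not_le)
    then have "\<rho> < ereal t" using eq[of t] le_less_trans[OF asm t(1)] by blast
    then show False using t(2) by simp
  qed
  have upper: "\<forall>\<^sub>F k in sequentially. s k \<le> t" if t: "\<rho> < ereal t" "\<alpha> < t" "t < 1" for t
  proof -
    obtain u where "\<alpha> < u" "u < t" "u \<in> A" using less_in[OF t] by blast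
    then show ?thesis by (intro above)
  qed
  have a: "limsup (\<lambda>k. ereal (s k)) \<le> ereal \<alpha>" if asm: "\<rho> \<le> ereal \<alpha>"
  proof (rule ccontr)
    assume "\<not> limsup (\<lambda>k. ereal (s k)) \<le> ereal \<alpha>"
    then have "ereal \<alpha> < min (ereal 1) (limsup (\<lambda>k. ereal (s k)))" using t0 by auto
    then obtain t where t: "ereal t < min (ereal 1) (limsup (\<lambda>k. ereal (s k)))" "\<alpha> < t" "t < 1"
      using between[of "ereal \<alpha>" "min (ereal 1) (limsup (\<lambda>k. ereal (s k)))"] by auto
    have "\<forall>\<^sub>F k in sequentially. s k \<le> t" using t asm by (intro upper) (auto intro: le_less_trans)
    then have "limsup (\<lambda>k. ereal (s k)) \<le> ereal t" by (intro Limsup_bounded) simp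
    then show False using t(1) by (meson leD min_less_iff_conj)
  qed
  have b1: "\<rho> = \<rho>'" if asm: "ereal \<alpha> < \<rho>"
  proof (rule ccontr)
    have that': "ereal \<alpha> < \<rho>'" using imp' asm by (auto simp: not_le[symmetric])
    assume "\<rho> \<noteq> \<rho>'"
    then consider "\<rho> < \<rho>'" | "\<rho>' < \<rho>" by (meson linorder_neqE)
    then show False
    proof cases
      case 1
      then obtain t where "\<rho> < ereal t" "ereal t < \<rho>'" "\<alpha> < t" "t < 1"
        using between[of \<rho> \<rho>'] less_imp_le[OF asm] \<rho>1 by auto
      then show False using eq[of t] by auto
    next
      case 2
      then obtain t where "\<rho>' < ereal t" "ereal t < \<rho>" "\<alpha> < t" "t < 1"
        using between[of \<rho>' \<rho>] less_imp_le[OF that'] \<rho>1 by auto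
      then show False using eq[of t] by auto
    qed
  qed
  have b2: "(\<lambda>k. ereal (s k)) \<longlonglongrightarrow> \<rho>" if \<alpha>: "ereal \<alpha> < \<rho>"
  proof (rule order_tendstoI)
    fix x assume "x < \<rho>"
    then have "max x (ereal \<alpha>) < \<rho>" using \<alpha> by simp
    then obtain t where t: "max x (ereal \<alpha>) < ereal t" "ereal t < \<rho>" "\<alpha> < t" "t < 1"
      using between[of "max x (ereal \<alpha>)" \<rho>] \<rho>1 by auto
    obtain u where u: "ereal t < ereal u" "ereal u < \<rho>" "\<alpha> < u" "u < 1"
      using between[of "ereal t" \<rho>] t \<rho>1 by auto
    have "\<not> (\<exists>\<^sub>F k in sequentially. s k \<le> t)"
    proof
      assume "\<exists>\<^sub>F k in sequentially. s k \<le> t"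
      then have "u \<in> A" using t u by (intro below[of t u]) auto
      then have "\<rho> \<le> ereal u" unfolding \<rho>_def by (auto intro: INF_lower)
      then show False using u(2) by simp
    qed
    then have "\<forall>\<^sub>F k in sequentially. t < s k" by (simp add: not_frequently not_le)
    then show "\<forall>\<^sub>F k in sequentially. x < ereal (s k)"
      by (rule eventually_mono) (use t(1) in \<open>auto intro: less_trans\<close>)
  next
    fix x assume "\<rho> < x"
    then obtain t where t: "\<rho> < ereal t" "ereal t < min x (ereal 1)" "\<alpha> < t" "t < 1"
      using between[of \<rho> "min x (ereal 1)"] less_imp_le[OF \<alpha>] \<rho>1 by auto
    have "\<forall>\<^sub>F k in sequentially. s k \<le> t" using t by (intro upper)
    then show "\<forall>\<^sub>F k in sequentially. ereal (s k) < x"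
      by (rule eventually_mono) (use t(2) in \<open>auto intro: le_less_trans[of _ "ereal t"]\<close>)
  qed
  have iff: "\<rho> \<le> ereal \<alpha> \<longleftrightarrow> \<rho>' \<le> ereal \<alpha>" using imp imp' by blast
  then have "\<rho> > ereal \<alpha> \<longleftrightarrow> \<rho>' > ereal \<alpha>" by (simp only: not_le[symmetric])
  with iff a b1 b2 show ?thesis by blast
qed

theorem corollary1:
  fixes P :: "nat \<Rightarrow> nat \<Rightarrow> real" and \<pi> V :: "nat \<Rightarrow> real"
    and i\<^sub>0 N :: nat and a :: "int \<Rightarrow> real" and \<tau> \<alpha>\<^sub>0 :: real
  assumes kernel: "markov_kernel P"
    and irreducible: "irreducible_kernel P"
    and aperiodic: "aperiodic_kernel P"
    and invariant: "invariant_probability P \<pi>"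
    and unique: "\<And>\<mu>. invariant_probability P \<mu> \<Longrightarrow> \<mu> = \<pi>"
    and N_pos: "1 \<le> N"
    and band: "\<And>i j. i\<^sub>0 \<le> i \<Longrightarrow> int N < \<bar>int i - int j\<bar> \<Longrightarrow> P i j = 0"
    and a_range: "\<And>m. m \<in> {- int N..int N} \<Longrightarrow> a m \<in> {0..1}"
    and a_lim: "\<And>m. m \<in> {- int N..int N} \<Longrightarrow>
                  (\<lambda>i. P i (nat (int i + m))) \<longlonglongrightarrow> a m"
    and tau_range: "\<tau> \<in> {0..<1}"
    and tau_lim: "(\<lambda>i. \<pi> (i + 1) / \<pi> i) \<longlonglongrightarrow> \<tau>"
    and drift: "(\<Sum>k = - int N..int N. real_of_int k * a k) < 0"
    and V_def: "V = (\<lambda>n. \<pi> n powr (- 1 / 2))"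
    and alpha_def: "\<alpha>\<^sub>0 = alpha0 N a \<tau>"
  shows "((rate_ell2 P \<pi> \<le> ereal \<alpha>\<^sub>0 \<longleftrightarrow> rate_weighted P \<pi> V \<le> ereal \<alpha>\<^sub>0) \<and>
          (rate_ell2 P \<pi> \<le> ereal \<alpha>\<^sub>0 \<longrightarrow>
             limsup (\<lambda>k. ereal (second_modulus P k)) \<le> ereal \<alpha>\<^sub>0)) \<and>
         ((rate_ell2 P \<pi> > ereal \<alpha>\<^sub>0 \<longleftrightarrow> rate_weighted P \<pi> V > ereal \<alpha>\<^sub>0) \<and>
          (rate_ell2 P \<pi> > ereal \<alpha>\<^sub>0 \<longrightarrow>
             rate_ell2 P \<pi> = rate_weighted P \<pi> V \<and>
             (\<lambda>k. ereal (second_modulus P k)) \<longlonglongrightarrow> rate_ell2 P \<pi>))"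
proof -
  interpret band_chain P \<pi> i\<^sub>0 N a \<tau>
    using kernel irreducible aperiodic invariant band a_lim tau_range tau_lim drift
    by unfold_locales auto
  have V: "V = weight" unfolding V_def weight_def ..
  show ?thesis
    unfolding rate_ell2_def rate_weighted_def convergence_rate_eq V alpha_def
  proof (rule rates_from_admissible_sets)
    fix t u assume "t \<in> {\<rho>. admissible P \<pi> X2 n2 \<rho>}" "t \<le> u" "u < 1"
    then show "u \<in> {\<rho>. admissible P \<pi> X2 n2 \<rho>}"
      using admissible_mono[of P \<pi> X2 n2 t u] order_trans[OF mult_nonneg_nonneg n2_upper] by force
  next
    fix t u assume "t \<in> {\<rho>. admissible P \<pi> XV nV \<rho>}" "t \<le> u" "u < 1"
    then show "u \<in> {\<rho>. admissible P \<pi> XV nV \<rho>}"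
      using admissible_mono[of P \<pi> XV nV t u] order_trans[OF mult_nonneg_nonneg nV_upper] by force
  qed (use admissible_iff ex_admissible second_modulus_eventually_le
      frequently_second_modulus_le_imp_admissible in auto)
qed

end
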